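(* Let $N\ge 2$ and let $(\Omega_n)_n$ be a sequence of rhomboid-like convex bodies in $\mathbb{R}^N$ with vanishing relative width, i.e. $w^{(\mathrm{rel})}(\Omega_n)\to0$ as $n\to+\infty$. Then $(\Omega_n)_n$ is a maximizing sequence for the reverse Cheeger inequality $J(\Omega)<\pi^2/4$, that is, $$\lim_{n\to+\infty}J(\Omega_n)=\frac{\pi^2}{4}.$$
   Context: A convex body in $\mathbb{R}^N$ is a bounded, closed, convex set with nonempty interior. Cheeger constant, eigenvalue and $J$. For a nonempty bounded open set $\Omega\subset\mathbb{R}^N$, $$h(\Omega)=\inf\Big\{\frac{\mathrm{Per}(E)}{|E|}: E\subset\Omega,\ |E|>0\Big\},\qquad \lambda_1(\Omega)=\inf\Big\{\frac{\|\nabla v\|_2^2}{\|v\|_2^2}: v\in H^1_0(\Omega)\setminus\{0\}\Big\},\qquad J(\Omega)=\frac{\lambda_1(\Omega)}{h(\Omega)^2},$$ where $\mathrm{Per}$ is the variational (De Giorgi) perimeter and $|\cdot|$ is Lebesgue measure. For a convex body $\Omega$, the quantities $\lambda_1(\Omega),h(\Omega),J(\Omega)$ are those of its interior. Principal widths and directions. For a closed convex set $\Omega\subset\mathbb{R}^N$ with nonempty interior, let $\sigma_\Omega(\nu)=\sup_{x\in\Omega}\langle x,\nu\rangle$ and $w_\nu(\Omega)=\sigma_\Omega(\nu)+\sigma_\Omega(-\nu)\in[0,+\infty]$ for $\nu\in\mathbb{S}^{N-1}$. Set $w^{(1)}(\Omega)=\min_{\nu\in\mathbb{S}^{N-1}}w_\nu(\Omega)$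 and $V^{(1)}(\Omega)=\{u\in\mathbb{S}^{N-1}: w_u(\Omega)=w^{(1)}(\Omega)\}$. Recursively, for $i=2,\dots,N$, let $$w^{(i)}(\Omega)=\inf\{w_\nu(\Omega):\nu\in\mathbb{S}^{N-1},\ \langle\nu,u^{(j)}\rangle=0\ \forall j<i,\ \text{for some }(u^{(1)},\dots,u^{(i-1)})\in V^{(i-1)}(\Omega)\},$$ and let $V^{(i)}(\Omega)$ be the set of $i$-tuples $(u^{(1)},\dots,u^{(i)})$ with $(u^{(1)},\dots,u^{(i-1)})\in V^{(i-1)}(\Omega)$, $u^{(i)}\in\mathbb{S}^{N-1}$ orthogonal to $u^{(1)},\dots,u^{(i-1)}$, and $w_{u^{(i)}}(\Omega)=w^{(i)}(\Omega)$. (The infima are always attained.) The number $w^{(i)}(\Omega)$ is the $i$-th principal width, and any element $(\nu^{(1)},\dots,\nu^{(N)})\in V^{(N)}(\Omega)$ is a set of principal directions of $\Omega$. Relative width. $w^{(\mathrm{rel})}(\Omega)=w^{(1)}(\Omega)/w^{(2)}(\Omega)$. Rhomboid-like sets. For $\nu\in\mathbb{S}^{N-1}$ let $H_\nu(\Omega)=\{x:\langle x,\nu\rangle=\sigma_\Omega(\nu)\}$ and $F(\Omega,H_\nu(\Omega))=\Omega\cap H_\nu(\Omega)$. A convex body $\Omega\subset\mathbb{R}^N$ is rhomboid-like if there exist a set of principal directions $(\nu^{(1)},\dots,\nu^{(N)})$ of $\Omega$ and points $p^{(i)}\in F(\Omega,H_{\nu^{(i)}}(\Omega))$, $q^{(i)}\in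 F(\Omega,H_{-\nu^{(i)}}(\Omega))$, $i=1,\dots,N$, with $p^{(i)}-q^{(i)}\in\mathrm{span}\{\nu^{(1)},\dots,\nu^{(i)}\}$ and $\langle p^{(i)}-q^{(i)},\nu^{(i)}\rangle=w^{(i)}(\Omega)$ for all $i$, such that $p^{(i)},q^{(i)}\in\mathrm{span}\{\nu^{(1)},\nu^{(i)}\}$ for every $i=2,\dots,N$. *)

theory Defs
  imports "HOL-Analysis.Analysis"
begin

section \<open>Differentiable functions and divergence\<close>

definition partial_deriv :: "'a \<Rightarrow> ('a::euclidean_space \<Rightarrow> 'b::real_normed_vector) \<Rightarrow> 'a \<Rightarrow> 'b" where
  "partial_deriv b f x = frechet_derivative f (at x) b"

text \<open>\<open>Ck k f\<close>: \<open>f\<close> is \<open>k\<close> times continuously differentiable on the whole space, by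
  recursion on the partial derivatives.\<close>

primrec Ck :: "nat \<Rightarrow> ('a::euclidean_space \<Rightarrow> 'b::real_normed_vector) \<Rightarrow> bool" where
  "Ck 0 f \<longleftrightarrow> continuous_on UNIV f"
| "Ck (Suc k) f \<longleftrightarrow> f differentiable_on UNIV \<and> (\<forall>b\<in>Basis. Ck k (partial_deriv b f))"

definition support :: "('a::euclidean_space \<Rightarrow> 'b::real_normed_vector) \<Rightarrow> 'a set" where
  "support f = closure {x. f x \<noteq> 0}"

definition grad :: "('a::euclidean_space \<Rightarrow> real) \<Rightarrow> 'a \<Rightarrow> 'a" where
  "grad f x = (\<Sum>b\<in>Basis. partial_deriv b f x *\<^sub>R b)"

definition divergence :: "('a::euclidean_space \<Rightarrow> 'a) \<Rightarrow> 'a \<Rightarrow> real" where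
  "divergence F x = (\<Sum>b\<in>Basis. partial_deriv b F x \<bullet> b)"


section \<open>De Giorgi perimeter and Cheeger constant\<close>

definition perimeter :: "'a::euclidean_space set \<Rightarrow> ereal" where
  "perimeter E = (SUP F \<in> {F :: 'a \<Rightarrow> 'a. Ck 1 F \<and> compact (support F) \<and> (\<forall>x. norm (F x) \<le> 1)}.
     ereal (LINT x|lebesgue_on E. divergence F x))"

text \<open>The infimum is finite for nonempty bounded open \<open>\<Omega>\<close> (balls have finite perimeter), so the
  conversion to \<open>real\<close> is harmless there.\<close>

definition cheeger :: "'a::euclidean_space set \<Rightarrow> real" where
  "cheeger \<Omega> = real_of_ereal
     (INF E \<in> {E. E \<in> sets lebesgue \<and> E \<subseteq> \<Omega> \<and> measure lebesgue E > 0}.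
        perimeter E / ereal (measure lebesgue E))"


section \<open>The space \<open>H\<^sup>1\<^sub>0\<close> and the first Dirichlet eigenvalue\<close>

text \<open>Elements of \<open>L\<^sup>2(\<Omega>)\<close> are represented by functions on the whole space of which only the values
  on \<open>\<Omega>\<close> matter.\<close>

definition L2 :: "'a::euclidean_space set \<Rightarrow> ('a \<Rightarrow> 'b::euclidean_space) set" where
  "L2 \<Omega> = {f. f \<in> borel_measurable (lebesgue_on \<Omega>) \<and>
              integrable (lebesgue_on \<Omega>) (\<lambda>x. (norm (f x))\<^sup>2)}"

definition L2_norm :: "'a::euclidean_space set \<Rightarrow> ('a \<Rightarrow> 'b::euclidean_space) \<Rightarrow> real" where
  "L2_norm \<Omega> f = sqrt (LINT x|lebesgue_on \<Omega>. (norm (f x))\<^sup>2)"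

definition test_functions :: "'a::euclidean_space set \<Rightarrow> ('a \<Rightarrow> real) set" where
  "test_functions \<Omega> = {\<phi>. (\<forall>k. Ck k \<phi>) \<and> compact (support \<phi>) \<and> support \<phi> \<subseteq> \<Omega>}"

definition weak_gradient ::
    "'a::euclidean_space set \<Rightarrow> ('a \<Rightarrow> real) \<Rightarrow> ('a \<Rightarrow> 'a) \<Rightarrow> bool" where
  "weak_gradient \<Omega> v g \<longleftrightarrow> v \<in> L2 \<Omega> \<and> g \<in> L2 \<Omega> \<and>
     (\<forall>\<phi>\<in>test_functions \<Omega>. \<forall>b\<in>Basis.
        (LINT x|lebesgue_on \<Omega>. v x * partial_deriv b \<phi> x) =
        - (LINT x|lebesgue_on \<Omega>. (g x \<bullet> b) * \<phi> x))"

text \<open>\<open>H\<^sup>1\<^sub>0(\<Omega>)\<close> is the closure of the test functions in the norm of \<open>H\<^sup>1(\<Omega>)\<close>.\<close>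

definition H10 :: "'a::euclidean_space set \<Rightarrow> ('a \<Rightarrow> real) set" where
  "H10 \<Omega> = {v. \<exists>g. weak_gradient \<Omega> v g \<and>
     (\<exists>\<phi>. (\<forall>k::nat. \<phi> k \<in> test_functions \<Omega>) \<and>
        (\<lambda>k. L2_norm \<Omega> (\<lambda>x. \<phi> k x - v x)) \<longlonglongrightarrow> 0 \<and>
        (\<lambda>k. L2_norm \<Omega> (\<lambda>x. grad (\<phi> k) x - g x)) \<longlonglongrightarrow> 0)}"

definition lambda1 :: "'a::euclidean_space set \<Rightarrow> real" where
  "lambda1 \<Omega> = Inf {(L2_norm \<Omega> g)\<^sup>2 / (L2_norm \<Omega> v)\<^sup>2 | v g.
     v \<in> H10 \<Omega> \<and> weak_gradient \<Omega> v g \<and> L2_norm \<Omega> v \<noteq> 0}"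

definition cheeger_J :: "'a::euclidean_space set \<Rightarrow> real" where
  "cheeger_J \<Omega> = lambda1 \<Omega> / (cheeger \<Omega>)\<^sup>2"


section \<open>Convex bodies and principal widths\<close>

definition convex_body :: "'a::euclidean_space set \<Rightarrow> bool" where
  "convex_body \<Omega> \<longleftrightarrow> bounded \<Omega> \<and> closed \<Omega> \<and> convex \<Omega> \<and> interior \<Omega> \<noteq> {}"

definition support_fun :: "'a::euclidean_space set \<Rightarrow> 'a \<Rightarrow> ereal" where
  "support_fun \<Omega> \<nu> = (SUP x\<in>\<Omega>. ereal (x \<bullet> \<nu>))"

definition width :: "'a::euclidean_space set \<Rightarrow> 'a \<Rightarrow> ereal" where
  "width \<Omega> \<nu> = support_fun \<Omega> \<nu> + support_fun \<Omega> (- \<nu>)"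

text \<open>Given the set \<open>V\<close> of admissible tuples \<open>(u\<^sup>1, \<dots>, u\<^sup>i)\<close>, represented as lists, this is the
  \<open>(i+1)\<close>-st principal width.\<close>

definition next_width :: "'a::euclidean_space set \<Rightarrow> 'a list set \<Rightarrow> ereal" where
  "next_width \<Omega> V = (INF \<nu> \<in> {\<nu> \<in> sphere 0 1. \<exists>us\<in>V. \<forall>u\<in>set us. \<nu> \<bullet> u = 0}. width \<Omega> \<nu>)"

text \<open>The recursion starts at the empty tuple, where the orthogonality condition is void, so that
  the first step minimises the width over the whole unit sphere.\<close>

primrec principal_tuples :: "'a::euclidean_space set \<Rightarrow> nat \<Rightarrow> 'a list set" where
  "principal_tuples \<Omega> 0 = {[]}"
| "principal_tuples \<Omega> (Suc i) =
     {us @ [u] | us u. us \<in> principal_tuples \<Omega> i \<and> u \<in> sphere 0 1 \<and> (\<forall>u'\<in>set us. u \<bullet> u' = 0) \<and>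
        width \<Omega> u = next_width \<Omega> (principal_tuples \<Omega> i)}"

text \<open>Indexed from \<open>1\<close>; the value at \<open>0\<close> is meaningless.\<close>

definition principal_width :: "'a::euclidean_space set \<Rightarrow> nat \<Rightarrow> ereal" where
  "principal_width \<Omega> i = next_width \<Omega> (principal_tuples \<Omega> (i - 1))"

definition rel_width :: "'a::euclidean_space set \<Rightarrow> ereal" where
  "rel_width \<Omega> = principal_width \<Omega> 1 / principal_width \<Omega> 2"

definition principal_directions :: "'a::euclidean_space set \<Rightarrow> (nat \<Rightarrow> 'a) \<Rightarrow> bool" where
  "principal_directions \<Omega> \<nu> \<longleftrightarrow> map \<nu> [1..<Suc DIM('a)] \<in> principal_tuples \<Omega> DIM('a)"


section \<open>Rhomboid-like convex bodies\<close>

definition support_hyperplane :: "'a::euclidean_space set \<Rightarrow> 'a \<Rightarrow> 'a set" where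
  "support_hyperplane \<Omega> \<nu> = {x. ereal (x \<bullet> \<nu>) = support_fun \<Omega> \<nu>}"

definition rhomboid_like :: "'a::euclidean_space set \<Rightarrow> bool" where
  "rhomboid_like \<Omega> \<longleftrightarrow> (\<exists>(\<nu> :: nat \<Rightarrow> 'a) p q. principal_directions \<Omega> \<nu> \<and>
     (\<forall>i\<in>{1..DIM('a)}.
        p i \<in> \<Omega> \<inter> support_hyperplane \<Omega> (\<nu> i) \<and>
        q i \<in> \<Omega> \<inter> support_hyperplane \<Omega> (- \<nu> i) \<and>
        p i - q i \<in> span (\<nu> ` {1..i}) \<and>
        ereal ((p i - q i) \<bullet> \<nu> i) = principal_width \<Omega> i) \<and>
     (\<forall>i\<in>{2..DIM('a)}. p i \<in> span {\<nu> 1, \<nu> i} \<and> q i \<in> span {\<nu> 1, \<nu> i}))"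

end

theory Submission
  imports Defs
begin

text \<open>
  Let \<open>r\<close> be half the minimal width of a rhomboid-like body \<open>\<Omega>\<close> and \<open>\<nu>\<^sub>1\<close> its first principal
  direction. The body lies in the slab \<open>\<bar>(x - c) \<bullet> \<nu>\<^sub>1\<bar> \<le> r\<close>, and the proof finds in it a box with
  edges along the principal directions and half-sides \<open>a\<^sub>1, \<dots>, a\<^sub>N\<close>. Slab and box control both
  quantities in \<open>J\<close> (lemmas \<open>cheeger_bounds\<close> and \<open>lambda1_bounds\<close>):

    \<open>1/r \<le> h \<le> \<Sum>i. 1/a\<^sub>i\<close>  and  \<open>(\<pi>/2r)\<^sup>2 \<le> \<lambda>\<^sub>1 \<le> \<Sum>i. (\<pi>/2a\<^sub>i)\<^sup>2\<close>,

  so that \<open>(\<pi>\<^sup>2/4) / (\<Sum>i. r/a\<^sub>i)\<^sup>2 \<le> J \<le> (\<pi>\<^sup>2/4) \<Sum>i. (r/a\<^sub>i)\<^sup>2\<close>. Hence \<open>J\<close> tends to \<open>\<pi>\<^sup>2/4\<close> as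
  soon as \<open>r/a\<^sub>1\<close> tends to 1 and the other quotients \<open>r/a\<^sub>i\<close> tend to 0.

  The slab bounds are calibrations. For a slab centred at the origin the field
  \<open>(x \<bullet> \<nu>) \<nu> / r\<close> has norm at most 1 in the slab and divergence \<open>1/r\<close>. For the eigenvalue, the
  logarithmic derivative of the ground state \<open>cos (\<pi> t / 2r)\<close> of the interval turns the Dirichlet
  energy into a perfect square plus \<open>(\<pi>/2r)\<^sup>2\<close> times the mass. The box bounds test the two infima
  with the box itself and with a smooth truncation of the product of the cosines belonging to its
  edges.

  The edges of the box need not be parallel to the coordinate axes. Rotated coordinates and Fubini's
  theorem are avoided by using only that Lebesgue measure is invariant under translations. A
  directional derivative is a limit of difference quotients; an integral over the box of such a
  quotient telescopes to the two faces; and a translation by half an edge exchanges the squares of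
  sine and cosine (lemmas \<open>prism_flux_le\<close> and \<open>prism_sin_cos_swap\<close>).

  The box comes from convexity (lemma \<open>contains_box\<close>). The segment from \<open>q\<^sub>1\<close> to \<open>p\<^sub>1\<close> crosses the
  whole slab perpendicularly. The average of the segments from \<open>q\<^sub>i\<close> to \<open>p\<^sub>i\<close>, for \<open>i \<ge> 2\<close>, is a
  parallelepiped in \<open>\<Omega>\<close> whose shadow on the hyperplane orthogonal to \<open>\<nu>\<^sub>1\<close> is a box with sides
  \<open>w\<^sub>i/(N - 1)\<close>. Points \<open>(1 - s) P + s H\<close> with \<open>P\<close> in the first set and \<open>H\<close> in the second fill a
  box with \<open>a\<^sub>1\<close> close to \<open>(1 - 2s) r\<close> and the other \<open>a\<^sub>i\<close> of the order of \<open>s w\<^sub>2\<close>. The choice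
  \<open>s = sqrt (w\<^sub>1/w\<^sub>2)\<close> makes both \<open>s\<close> and \<open>w\<^sub>1/(s w\<^sub>2) = s\<close> vanish in the limit.
\<close>

section \<open>Calculus of the classes Ck\<close>

lemma partial_deriv_eq:
  assumes "(f has_derivative f') (at x)"
  shows "partial_deriv v f x = f' v"
  using frechet_derivative_at[OF assms] by (simp add: partial_deriv_def)

lemma has_derivative_partial_deriv:
  assumes "f differentiable (at x)"
  shows "(f has_derivative (\<lambda>v. partial_deriv v f x)) (at x)"
  using assms frechet_derivative_works by (fastforce simp: partial_deriv_def)

lemma Ck_Suc_differentiable: "Ck (Suc k) f \<Longrightarrow> f differentiable (at x)"
  by (simp add: differentiable_on_def)

lemma Ck_SucD: "Ck (Suc k) f \<Longrightarrow> Ck k f"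
proof (induction k arbitrary: f)
  case 0
  then show ?case
    by (simp add: differentiable_imp_continuous_on)
next
  case (Suc k)
  then show ?case by (metis Ck.simps(2))
qed

lemma Ck_le: "k \<le> n \<Longrightarrow> Ck n f \<Longrightarrow> Ck k f"
  by (induction n rule: dec_induct) (auto dest: Ck_SucD simp del: Ck.simps)

lemma Ck_continuous: "Ck k f \<Longrightarrow> continuous_on UNIV f"
  using Ck_le[of 0 k f] by simp

text \<open>Replaces the recursion through the chosen derivative by any explicit formula for it.\<close>

lemma Ck_SucI:
  assumes "\<And>x. (f has_derivative (\<lambda>v. f' v x)) (at x)" and "\<And>b. b \<in> Basis \<Longrightarrow> Ck k (f' b)"
  shows "Ck (Suc k) f"
proof -
  have "partial_deriv b f = f' b" for b
    using partial_deriv_eq[OF assms(1)] by auto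
  then show ?thesis
    using assms by (auto simp: differentiable_on_def intro: differentiableI)
qed

lemma Ck_const: "Ck k (\<lambda>x. c)"
proof (induction k arbitrary: c)
  case (Suc k)
  show ?case by (rule Ck_SucI[where f' = "\<lambda>v x. 0"]) (auto intro: Suc.IH)
qed auto

lemma Ck_add:
  assumes "Ck k f" "Ck k g" shows "Ck k (\<lambda>x. f x + g x)"
  using assms
proof (induction k arbitrary: f g)
  case 0
  then show ?case by (auto intro: continuous_intros)
next
  case (Suc k)
  show ?case
  proof (rule Ck_SucI)
    show "((\<lambda>x. f x + g x) has_derivative (\<lambda>v. partial_deriv v f x + partial_deriv v g x)) (at x)" for x
      using Suc.prems by (intro has_derivative_add has_derivative_partial_deriv Ck_Suc_differentiable)
    show "Ck k (\<lambda>x. partial_deriv b f x + partial_deriv b g x)" if "b \<in> Basis" for b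
      using Suc.prems Suc.IH that by simp
  qed
qed

lemma Ck_scaleR:
  fixes f :: "'a::euclidean_space \<Rightarrow> real" and g :: "'a \<Rightarrow> 'b::real_normed_vector"
  assumes "Ck k f" "Ck k g" shows "Ck k (\<lambda>x. f x *\<^sub>R g x)"
  using assms
proof (induction k arbitrary: f g)
  case 0
  then show ?case by (auto intro: continuous_intros)
next
  case (Suc k)
  show ?case
  proof (rule Ck_SucI)
    show "((\<lambda>x. f x *\<^sub>R g x) has_derivative
        (\<lambda>v. f x *\<^sub>R partial_deriv v g x + partial_deriv v f x *\<^sub>R g x)) (at x)" for x
      using Suc.prems by (intro has_derivative_scaleR has_derivative_partial_deriv Ck_Suc_differentiable)
    show "Ck k (\<lambda>x. f x *\<^sub>R partial_deriv b g x + partial_deriv b f x *\<^sub>R g x)" if "b \<in> Basis" for b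
      using Suc.prems Suc.IH that Ck_SucD[OF Suc.prems(1)] Ck_SucD[OF Suc.prems(2)]
      by (intro Ck_add) auto
  qed
qed

lemma Ck_mult:
  fixes f g :: "'a::euclidean_space \<Rightarrow> real"
  assumes "Ck k f" "Ck k g" shows "Ck k (\<lambda>x. f x * g x)"
  using Ck_scaleR[OF assms] by simp

lemma Ck_prod:
  fixes f :: "'i \<Rightarrow> 'a::euclidean_space \<Rightarrow> real"
  assumes "\<And>i. i \<in> I \<Longrightarrow> Ck k (f i)" shows "Ck k (\<lambda>x. \<Prod>i\<in>I. f i x)"
  using assms
  by (induction I rule: infinite_finite_induct) (auto intro: Ck_mult Ck_const)

lemma Ck_inner: "Ck k (\<lambda>x. (x - z) \<bullet> v)"
proof (cases k)
  case 0
  then show ?thesis by (auto intro!: continuous_intros)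
next
  case (Suc n)
  show ?thesis unfolding Suc
    by (rule Ck_SucI[where f' = "\<lambda>b x. b \<bullet> v"]) (auto intro!: derivative_eq_intros Ck_const)
qed

lemma Ck_sum:
  assumes "\<And>i. i \<in> I \<Longrightarrow> Ck k (f i)" shows "Ck k (\<lambda>x. \<Sum>i\<in>I. f i x)"
  using assms
  by (induction I rule: infinite_finite_induct) (auto intro: Ck_add Ck_const)

lemma Ck_norm_sq: "Ck k (\<lambda>x. x \<bullet> x)"
proof -
  have "Ck k (\<lambda>x::'a. \<Sum>b\<in>Basis. (x \<bullet> b) * (x \<bullet> b))"
    using Ck_inner[of k 0] by (intro Ck_sum Ck_mult) simp_all
  then show ?thesis
    by (simp flip: euclidean_inner)
qed

lemma has_derivative_compose_real:
  fixes f :: "'a::euclidean_space \<Rightarrow> real"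
  assumes "f differentiable (at x)" "(h has_real_derivative h') (at (f x))"
  shows "((\<lambda>x. h (f x)) has_derivative (\<lambda>v. h' * partial_deriv v f x)) (at x)"
  using diff_chain_at[OF has_derivative_partial_deriv[OF assms(1)] assms(2)[unfolded has_field_derivative_def]]
  by (simp add: o_def)

lemma C1_compose_real:
  fixes f :: "'a::euclidean_space \<Rightarrow> real"
  assumes "Ck 1 f" "\<And>t. (h has_real_derivative h' t) (at t)" "continuous_on UNIV h'"
  shows "Ck 1 (\<lambda>x. h (f x))"
  unfolding One_nat_def
proof (rule Ck_SucI)
  show "((\<lambda>x. h (f x)) has_derivative (\<lambda>v. h' (f x) * partial_deriv v f x)) (at x)" for x
    using assms by (intro has_derivative_compose_real Ck_Suc_differentiable[of 0]) auto
  show "Ck 0 (\<lambda>x. h' (f x) * partial_deriv b f x)" if "b \<in> Basis" for b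
  proof (rule Ck_mult)
    show "Ck 0 (\<lambda>x. h' (f x))"
      using continuous_on_compose2[OF assms(3) Ck_continuous[OF assms(1)]] by simp
    show "Ck 0 (partial_deriv b f)"
      using assms(1) that by simp
  qed
qed

lemma Ck_cos:
  fixes f :: "'a::euclidean_space \<Rightarrow> real"
  assumes "Ck k f" shows "Ck k (\<lambda>x. cos (f x + c))"
  using assms
proof (induction k arbitrary: c)
  case 0
  then show ?case by (auto intro!: continuous_intros)
next
  case (Suc k)
  show ?case
  proof (rule Ck_SucI)
    show "((\<lambda>x. cos (f x + c)) has_derivative
        (\<lambda>v. cos (f x + (c + pi / 2)) * partial_deriv v f x)) (at x)" for x
    proof (rule has_derivative_compose_real[OF Ck_Suc_differentiable[OF Suc.prems]])
      have "((\<lambda>t. cos (t + c)) has_real_derivative - sin (f x + c)) (at (f x))"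
        by (auto intro!: derivative_eq_intros)
      also have "- sin (f x + c) = cos (f x + (c + pi/2))"
        by (simp add: cos_add add.assoc[symmetric])
      finally show "((\<lambda>t. cos (t + c)) has_real_derivative cos (f x + (c + pi/2))) (at (f x))" .
    qed
    show "Ck k (\<lambda>x. cos (f x + (c + pi / 2)) * partial_deriv b f x)" if "b \<in> Basis" for b
      using Suc that Ck_SucD[OF Suc.prems] by (intro Ck_mult) auto
  qed
qed

text \<open>The functions \<open>exp (-a/s) / s\<^sup>m\<close>, extended by 0 to the left half-line. For varying \<open>m\<close> they span a
  space that is closed under differentiation, which gives their smoothness without any formula for the
  higher derivatives.\<close>

definition flat_exp :: "real \<Rightarrow> nat \<Rightarrow> real \<Rightarrow> real" where
  "flat_exp a m s = (if s > 0 then exp (- a / s) / s ^ m else 0)"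

lemma flat_exp_tendsto_0:
  assumes "a > 0" shows "(flat_exp a m \<longlongrightarrow> 0) (at 0)"
proof -
  have lim: "((\<lambda>s. (a / s) ^ m / exp (a / s) / a ^ m) \<longlongrightarrow> 0) (at_right (0::real))"
  proof -
    have "LIM s at_right 0. a / s :> at_top"
      using filterlim_tendsto_pos_mult_at_top[OF tendsto_const[of a] assms filterlim_inverse_at_top_right]
      by (simp add: divide_inverse)
    from tendsto_divide[OF filterlim_compose[OF tendsto_power_div_exp_0[of m] this] tendsto_const[of "a ^ m"]]
    show ?thesis using assms by simp
  qed
  have "(flat_exp a m \<longlongrightarrow> 0) (at_right 0)"
    by (rule Lim_transform_eventually[OF lim])
      (use assms in \<open>auto simp: flat_exp_def eventually_at_filter power_divide exp_minus field_simps\<close>)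
  moreover have "(flat_exp a m \<longlongrightarrow> 0) (at_left 0)"
    by (rule Lim_transform_eventually[OF tendsto_const]) (auto simp: flat_exp_def eventually_at_filter)
  ultimately show ?thesis
    by (simp add: filterlim_split_at)
qed

text \<open>At the origin the difference quotient of the \<open>m\<close>-th function is the function with index
  \<open>m + 1\<close>, which tends to 0.\<close>

lemma DERIV_flat_exp:
  assumes "a > 0"
  shows "(flat_exp a m has_real_derivative (- real m * flat_exp a (Suc m) s + a * flat_exp a (m + 2) s)) (at s)"
proof -
  consider "s > 0" | "s < 0" | "s = 0" by linarith
  then show ?thesis
  proof cases
    case 1
    have "((\<lambda>s. exp (- a / s) / s ^ m) has_real_derivative
        (- real m * flat_exp a (Suc m) s + a * flat_exp a (m + 2) s)) (at s)"
    proof -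
      have "((\<lambda>s. s ^ m) has_real_derivative real m * s ^ m / s) (at s)"
        using DERIV_pow[of m s] 1 by (cases m) auto
      moreover have "((\<lambda>s. exp (- a / s)) has_real_derivative exp (- a / s) * (a / s\<^sup>2)) (at s)"
        using 1 by (auto intro!: derivative_eq_intros simp: power2_eq_square)
      ultimately have "((\<lambda>s. exp (- a / s) / s ^ m) has_real_derivative
        (exp (- a / s) * (a / s\<^sup>2) * s ^ m - exp (- a / s) * (real m * s ^ m / s)) / (s ^ m * s ^ m)) (at s)"
        using 1 by (intro DERIV_divide) auto
      moreover have "(exp (- a / s) * (a / s\<^sup>2) * s ^ m - exp (- a / s) * (real m * s ^ m / s)) / (s ^ m * s ^ m)
        = - real m * flat_exp a (Suc m) s + a * flat_exp a (m + 2) s"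
        using 1 by (simp add: flat_exp_def divide_simps power2_eq_square) (simp add: algebra_simps)
      ultimately show ?thesis by simp
    qed
    then show ?thesis
      by (rule has_field_derivative_transform_within_open[of _ _ _ "{0<..}"])
        (use 1 in \<open>auto simp: flat_exp_def\<close>)
  next
    case 2
    have "((\<lambda>s. 0) has_real_derivative (- real m * flat_exp a (Suc m) s + a * flat_exp a (m + 2) s)) (at s)"
      using 2 by (simp add: flat_exp_def)
    then show ?thesis
      by (rule has_field_derivative_transform_within_open[of _ _ _ "{..<0}"])
        (use 2 in \<open>auto simp: flat_exp_def\<close>)
  next
    case 3
    have "(\<lambda>h. (flat_exp a m (0 + h) - flat_exp a m 0) / h) = flat_exp a (Suc m)"
      by (auto simp: flat_exp_def field_simps)
    then show ?thesis
      using flat_exp_tendsto_0[OF assms, of "Suc m"] 3 by (simp add: DERIV_def flat_exp_def)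
  qed
qed

lemma Ck_flat_exp:
  fixes f :: "'a::euclidean_space \<Rightarrow> real"
  assumes "a > 0" "Ck k f" shows "Ck k (\<lambda>x. flat_exp a m (f x))"
  using assms(2)
proof (induction k arbitrary: m)
  case 0
  have ic: "isCont (flat_exp a m) s" for s
    using DERIV_flat_exp[OF assms(1), of m s] by (rule DERIV_isCont)
  then have "continuous_on UNIV (flat_exp a m)"
    by (intro continuous_at_imp_continuous_on) blast
  from continuous_on_compose2[OF this] 0 show ?case
    by (metis Ck.simps(1) subset_UNIV)
next
  case (Suc k)
  have 1: "((\<lambda>x. flat_exp a m (f x)) has_derivative
        (\<lambda>v. (- real m * flat_exp a (Suc m) (f x) + a * flat_exp a (m + 2) (f x)) * partial_deriv v f x)) (at x)" for x
      by (rule has_derivative_compose_real[where h = "flat_exp a m"])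
        (rule Ck_Suc_differentiable[OF Suc.prems], rule DERIV_flat_exp[OF assms(1)])
  have 2: "Ck k (\<lambda>x. (- real m * flat_exp a (Suc m) (f x) + a * flat_exp a (m + 2) (f x)) * partial_deriv b f x)"
      if "b \<in> Basis" for b
  proof (rule Ck_mult)
    show "Ck k (\<lambda>x. - real m * flat_exp a (Suc m) (f x) + a * flat_exp a (m + 2) (f x))"
      by (rule Ck_add; rule Ck_mult[OF Ck_const Suc.IH[OF Ck_SucD[OF Suc.prems]]])
    show "Ck k (partial_deriv b f)"
      using Suc.prems that by simp
  qed
  show ?case using 1 2 by (rule Ck_SucI)
qed

text \<open>Only the basis directions occur in \<open>Ck\<close>; this extends the calculus to the directions of a
  rotated frame.\<close>

lemma partial_deriv_Basis:
  assumes "f differentiable (at x)"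
  shows "partial_deriv v f x = (\<Sum>b\<in>Basis. (v \<bullet> b) *\<^sub>R partial_deriv b f x)"
proof -
  have "linear (\<lambda>v. partial_deriv v f x)"
    using has_derivative_linear[OF has_derivative_partial_deriv[OF assms]] .
  then have lin: "linear (\<lambda>v. partial_deriv v f x)" .
  have "partial_deriv v f x = partial_deriv (\<Sum>b\<in>Basis. (v \<bullet> b) *\<^sub>R b) f x"
    by (simp add: euclidean_representation)
  also have "\<dots> = (\<Sum>b\<in>Basis. partial_deriv ((v \<bullet> b) *\<^sub>R b) f x)"
    using linear_sum[OF lin, of "\<lambda>b. (v \<bullet> b) *\<^sub>R b" Basis] .
  also have "\<dots> = (\<Sum>b\<in>Basis. (v \<bullet> b) *\<^sub>R partial_deriv b f x)"
    using linear_scale[OF lin] by simp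
  finally show ?thesis .
qed

lemma continuous_partial_deriv:
  assumes "Ck 1 f" shows "continuous_on UNIV (partial_deriv v f)"
proof -
  have eq: "partial_deriv v f = (\<lambda>x. \<Sum>b\<in>Basis. (v \<bullet> b) *\<^sub>R partial_deriv b f x)"
    using assms by (intro ext partial_deriv_Basis) (simp add: differentiable_on_def)
  show ?thesis
    unfolding eq using assms by (intro continuous_intros) simp
qed

lemma not_in_support: "x \<notin> support f \<Longrightarrow> f x = 0"
  using closure_subset[of "{x. f x \<noteq> 0}"] by (auto simp: support_def)

lemma partial_deriv_eq_0_outside:
  assumes "x \<notin> support f"
  shows "partial_deriv v f x = 0"
proof -
  have "((\<lambda>x. 0) has_derivative (\<lambda>v. 0)) (at x)" by simp
  then have "(f has_derivative (\<lambda>v. 0)) (at x)"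
  proof (rule has_derivative_transform_within_open[where s = "- support f"])
    show "open (- support f)" by (simp add: support_def open_Compl)
    show "0 = f y" if "y \<in> - support f" for y
      using that not_in_support[of y f] by simp
  qed (use assms in auto)
  then show ?thesis by (rule partial_deriv_eq)
qed

lemma support_partial_deriv: "support (partial_deriv v f) \<subseteq> support f"
  unfolding support_def[of "partial_deriv v f"]
proof (rule closure_minimal)
  show "{x. partial_deriv v f x \<noteq> 0} \<subseteq> support f"
    using partial_deriv_eq_0_outside by blast
qed (simp add: support_def)

lemma supportI: "f x \<noteq> 0 \<Longrightarrow> x \<in> support f"
  using not_in_support by metis

lemma closed_support: "closed (support f)"
  by (simp add: support_def)

lemma support_subset_closed: "closed K \<Longrightarrow> (\<And>x. f x \<noteq> 0 \<Longrightarrow> x \<in> K) \<Longrightarrow> support f \<subseteq> K"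
  unfolding support_def by (rule closure_minimal) auto

lemma compact_support_mono:
  assumes "compact (support g)" and "\<And>x. x \<notin> support g \<Longrightarrow> f x = 0"
  shows "compact (support f)"
proof -
  have "support f \<subseteq> support g"
    using assms(2) by (intro support_subset_closed closed_support) blast
  then show ?thesis
    using compact_Int_closed[OF assms(1) closed_support[of f]] by (simp add: Int_absorb1)
qed

section \<open>Difference quotients and integration by parts\<close>

lemma lborel_integral_shift:
  fixes f :: "'a::euclidean_space \<Rightarrow> real"
  assumes "f \<in> borel_measurable borel"
  shows "(LINT x|lborel. f (x + c)) = (LINT x|lborel. f x)"
proof -
  have "(LINT x|lborel. f x) = (LINT x|distr lborel borel ((+) c). f x)"
    by (simp add: lborel_distr_plus)
  also have "\<dots> = (LINT x|lborel. f (c + x))"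
    using assms by (intro integral_distr) auto
  finally show ?thesis by (simp add: add.commute)
qed

lemma lborel_integrable_shift:
  fixes f :: "'a::euclidean_space \<Rightarrow> real"
  assumes "integrable lborel f"
  shows "integrable lborel (\<lambda>x. f (x + c))"
proof -
  have "integrable (distr lborel borel ((+) c)) f"
    using assms by (simp add: lborel_distr_plus)
  then have "integrable lborel (\<lambda>x. f (c + x))"
    by (subst (asm) integrable_distr_eq) (use assms in auto)
  then show ?thesis by (simp add: add.commute)
qed

lemma partial_deriv_scale:
  assumes "f differentiable (at x)"
  shows "partial_deriv (c *\<^sub>R v) f x = c *\<^sub>R partial_deriv v f x"
  using linear_scale[OF has_derivative_linear[OF has_derivative_partial_deriv[OF assms]]] .

lemma DERIV_along_line:
  fixes f :: "'a::euclidean_space \<Rightarrow> real"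
  assumes "Ck 1 f"
  shows "((\<lambda>s. f (x + s *\<^sub>R v)) has_real_derivative partial_deriv v f (x + s *\<^sub>R v)) (at s)"
proof -
  have d: "f differentiable (at y)" for y
    using assms by (simp add: differentiable_on_def)
  have "((\<lambda>s. x + s *\<^sub>R v) has_derivative (\<lambda>h. h *\<^sub>R v)) (at s)"
    by (auto intro!: derivative_eq_intros)
  from diff_chain_at[OF this has_derivative_partial_deriv[OF d]]
  have "((\<lambda>s. f (x + s *\<^sub>R v)) has_derivative (\<lambda>h. h * partial_deriv v f (x + s *\<^sub>R v))) (at s)"
    by (simp add: o_def partial_deriv_scale[OF d])
  then show ?thesis
    by (simp add: has_field_derivative_def mult_commute_abs)
qed

lemma compact_support_bounded:
  fixes f :: "'a::euclidean_space \<Rightarrow> 'b::real_normed_vector"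
  assumes "continuous_on UNIV f" "compact (support f)"
  obtains K where "K > 0" "\<And>x. norm (f x) \<le> K"
proof -
  have "compact (f ` support f)"
    using assms by (intro compact_continuous_image) (auto intro: continuous_on_subset)
  then obtain K where K: "K > 0" "\<And>y. y \<in> f ` support f \<Longrightarrow> norm y \<le> K"
    using bounded_pos compact_imp_bounded by metis
  have "norm (f x) \<le> K" for x
    using K not_in_support[of x f] by (cases "x \<in> support f") auto
  then show ?thesis using K that by blast
qed

lemma compact_support_partial_deriv:
  "compact (support f) \<Longrightarrow> compact (support (partial_deriv v f))"
  by (erule compact_support_mono) (rule partial_deriv_eq_0_outside)

lemma integrable_bounded_support:
  fixes f :: "'a::euclidean_space \<Rightarrow> real"
  assumes "f \<in> borel_measurable borel" "\<And>x. \<bar>f x\<bar> \<le> K" "\<And>x. f x \<noteq> 0 \<Longrightarrow> x \<in> S" "bounded S"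
  shows "integrable lborel f"
proof -
  obtain R where R: "S \<subseteq> cball 0 R"
    using assms(4) unfolding bounded_iff subset_iff mem_cball_0 by blast
  have i: "integrable lborel (\<lambda>x. indicator (cball 0 R) x *\<^sub>R K)"
    using emeasure_bounded_finite[OF bounded_cball]
    by (intro integrable_scaleR_left integrable_real_indicator) auto
  have b: "norm (f x) \<le> norm (indicator (cball 0 R) x *\<^sub>R K)" for x
  proof (cases "f x = 0")
    case False
    then have "x \<in> cball 0 R" using assms(3) R by blast
    then show ?thesis using assms(2)[of x] by simp
  qed simp
  show ?thesis
    by (rule Bochner_Integration.integrable_bound[OF i _ AE_I2[OF b]]) (use assms(1) in simp)
qed

lemma integrable_compact_support:
  fixes f :: "'a::euclidean_space \<Rightarrow> real"
  assumes "continuous_on UNIV f" "compact (support f)"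
  shows "integrable lborel f"
proof -
  obtain K where "\<And>x. norm (f x) \<le> K"
    using compact_support_bounded[OF assms] by metis
  then show ?thesis
    using assms supportI[of f]
    by (intro integrable_bounded_support[of f K "support f"])
      (auto intro: borel_measurable_continuous_onI compact_imp_bounded)
qed

lemma integrable_norm_sq:
  assumes "continuous_on UNIV f" "compact (support f)"
  shows "integrable lborel (\<lambda>x. (norm (f x))\<^sup>2)"
  using not_in_support[of _ f] assms(1)
  by (intro integrable_compact_support compact_support_mono[OF assms(2)] continuous_intros) auto

text \<open>The step from derivatives to translations: by the mean value theorem the difference quotients are
  bounded by the maximum of the derivative, and they vanish outside one bounded set, so dominated
  convergence applies. The weight \<open>u\<close> will be 1 or the indicator function of a box.\<close>

lemma shift_quotient_tendsto:
  fixes f u :: "'a::euclidean_space \<Rightarrow> real"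
  assumes f: "Ck 1 f" "compact (support f)"
    and u: "u \<in> borel_measurable borel" "\<And>x. \<bar>u x\<bar> \<le> M" and l: "l > 0"
  shows "(\<lambda>k. LINT x|lborel. u x * ((f (x + (l / Suc k) *\<^sub>R v) - f x) / (l / Suc k)))
    \<longlonglongrightarrow> (LINT x|lborel. u x * partial_deriv v f x)"
proof -
  define t where "t k = l / Suc k" for k :: nat
  have t: "t k > 0" "t k \<le> l" for k
    using l by (auto simp: t_def divide_simps mult_le_cancel_left1)
  have "(\<lambda>k. l * (1 / Suc k)) \<longlonglongrightarrow> l * 0"
    by (intro tendsto_mult tendsto_const LIMSEQ_Suc[OF lim_1_over_n])
  then have t0: "t \<longlonglongrightarrow> 0" by (simp add: t_def[abs_def])
  have contf: "continuous_on UNIV f" and contd: "continuous_on UNIV (partial_deriv v f)"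
    using Ck_continuous[OF f(1)] continuous_partial_deriv[OF f(1)] .
  then have meas: "f \<in> borel_measurable borel" "partial_deriv v f \<in> borel_measurable borel"
    by (auto intro: borel_measurable_continuous_onI)
  obtain K where K: "K > 0" "\<And>x. norm (partial_deriv v f x) \<le> K"
    using compact_support_bounded[OF contd compact_support_partial_deriv[OF f(2)]] by metis
  obtain R where R: "\<And>x. f x \<noteq> 0 \<Longrightarrow> norm x \<le> R"
    using compact_imp_bounded[OF f(2)] supportI[of f] unfolding bounded_iff by metis
  \<comment> \<open>the dominating function: outside this ball \<open>f\<close> vanishes both at \<open>x\<close> and at its translates\<close>
  define w where "w x = (indicator (cball 0 (R + l * norm v)) x *\<^sub>R (M * K) :: real)" for x :: 'a
  have M: "M \<ge> 0" using u(2)[of 0] by linarith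
  have quot: "\<bar>(f (x + t k *\<^sub>R v) - f x) / t k\<bar> \<le> K" for x k
  proof -
    have "\<exists>z. 0 < z \<and> z < t k \<and> f (x + t k *\<^sub>R v) - f (x + 0 *\<^sub>R v) = (t k - 0) * partial_deriv v f (x + z *\<^sub>R v)"
      using t(1) DERIV_along_line[OF f(1)] by (intro MVT2) auto
    then obtain z where "f (x + t k *\<^sub>R v) - f x = t k * partial_deriv v f (x + z *\<^sub>R v)" by auto
    then show ?thesis using K(2)[of "x + z *\<^sub>R v"] t(1)[of k] by auto
  qed
  have quot0: "(f (x + t k *\<^sub>R v) - f x) / t k = 0" if "x \<notin> cball 0 (R + l * norm v)" for x k
  proof -
    have n: "norm x > R + l * norm v" using that by simp
    have "norm (x + t k *\<^sub>R v) \<ge> norm x - norm (t k *\<^sub>R v)"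
      using norm_diff_ineq by blast
    moreover have "norm (t k *\<^sub>R v) \<le> l * norm v"
      using t[of k] by (simp add: mult_right_mono)
    ultimately have "norm (x + t k *\<^sub>R v) > R" using n by linarith
    moreover have "norm x > R" using n l by (smt (verit) mult_nonneg_nonneg norm_ge_zero)
    ultimately have "f x = 0" "f (x + t k *\<^sub>R v) = 0"
      using R[of x] R[of "x + t k *\<^sub>R v"] by linarith+
    then show ?thesis by simp
  qed
  have "(\<lambda>k. LINT x|lborel. u x * ((f (x + t k *\<^sub>R v) - f x) / t k))
    \<longlonglongrightarrow> (LINT x|lborel. u x * partial_deriv v f x)"
  proof (rule integral_dominated_convergence[where w = w])
    show "integrable lborel w"
      unfolding w_def using M K
      by (intro integrable_bounded_support[of _ "M * K" "cball 0 (R + l * norm v)"])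
        (auto simp: indicator_def)
    show "AE x in lborel. (\<lambda>k. u x * ((f (x + t k *\<^sub>R v) - f x) / t k)) \<longlonglongrightarrow> u x * partial_deriv v f x"
    proof (intro AE_I2 tendsto_mult tendsto_const)
      fix x
      have "((\<lambda>h. (f (x + h *\<^sub>R v) - f x) / h) \<longlongrightarrow> partial_deriv v f x) (at 0)"
        using DERIV_along_line[OF f(1), of x v 0] by (simp add: DERIV_def)
      moreover have "filterlim t (at 0) sequentially"
        unfolding filterlim_at
        using t0 t(1) less_imp_neq[OF t(1)] by (auto intro!: always_eventually)
      ultimately show "(\<lambda>k. (f (x + t k *\<^sub>R v) - f x) / t k) \<longlonglongrightarrow> partial_deriv v f x"
        by (rule filterlim_compose)
    qed
    show "AE x in lborel. norm (u x * ((f (x + t k *\<^sub>R v) - f x) / t k)) \<le> w x" for k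
    proof (intro AE_I2)
      fix x
      show "norm (u x * ((f (x + t k *\<^sub>R v) - f x) / t k)) \<le> w x"
      proof (cases "x \<in> cball 0 (R + l * norm v)")
        case True
        have "\<bar>u x\<bar> * \<bar>(f (x + t k *\<^sub>R v) - f x) / t k\<bar> \<le> M * K"
          using u(2) quot M by (intro mult_mono) auto
        then show ?thesis using True by (simp add: w_def abs_mult)
      next
        case False
        then show ?thesis unfolding quot0[OF False] by (simp add: w_def)
      qed
    qed
  qed (use meas u in \<open>measurable\<close>)
  then show ?thesis by (simp add: t_def)
qed

text \<open>The difference quotients have integral 0 by translation invariance.\<close>

lemma integral_partial_deriv_eq_0:
  fixes f :: "'a::euclidean_space \<Rightarrow> real"
  assumes f: "Ck 1 f" "compact (support f)"
  shows "(LINT x|lborel. partial_deriv v f x) = 0"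
proof -
  have contf: "continuous_on UNIV f" using Ck_continuous[OF f(1)] .
  have int: "integrable lborel f"
    using contf f(2) by (rule integrable_compact_support)
  have "(LINT x|lborel. f (x + c) - f x) = 0" for c
    using lborel_integrable_shift[OF int, of c] int lborel_integral_shift[of f c] contf
    by (simp add: borel_measurable_continuous_onI)
  then have "(\<lambda>k. LINT x|lborel. 1 * ((f (x + (1 / Suc k) *\<^sub>R v) - f x) / (1 / Suc k))) = (\<lambda>k. 0)"
    by (intro ext) (simp del: of_nat_Suc)
  with shift_quotient_tendsto[OF f, of "\<lambda>x. 1" 1 1 v] show ?thesis
    by (simp add: LIMSEQ_const_iff)
qed

lemma integral_by_parts:
  fixes f g :: "'a::euclidean_space \<Rightarrow> real"
  assumes f: "Ck 1 f" and g: "Ck 1 g" "compact (support g)"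
  shows "(LINT x|lborel. f x * partial_deriv v g x) = - (LINT x|lborel. partial_deriv v f x * g x)"
proof -
  have d: "f differentiable (at x)" "g differentiable (at x)" for x
    using f g by (auto simp: differentiable_on_def)
  have eq: "partial_deriv v (\<lambda>x. f x * g x) x = f x * partial_deriv v g x + partial_deriv v f x * g x" for x
    by (rule partial_deriv_eq) (intro has_derivative_mult has_derivative_partial_deriv d)
  have i1: "integrable lborel (\<lambda>x. f x * partial_deriv v g x)"
    using compact_support_mono[OF compact_support_partial_deriv[OF g(2), of v], of "\<lambda>x. f x * partial_deriv v g x"]
      not_in_support[of _ "partial_deriv v g"] f g
    by (intro integrable_compact_support continuous_on_mult continuous_partial_deriv Ck_continuous[OF f]) auto
  have i2: "integrable lborel (\<lambda>x. partial_deriv v f x * g x)"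
    using compact_support_mono[OF g(2), of "\<lambda>x. partial_deriv v f x * g x"] not_in_support[of _ g] f g
    by (intro integrable_compact_support continuous_on_mult continuous_partial_deriv Ck_continuous[OF g(1)]) auto
  have "(LINT x|lborel. partial_deriv v (\<lambda>x. f x * g x) x) = 0"
    using compact_support_mono[OF g(2), of "\<lambda>x. f x * g x"] not_in_support[of _ g] f g
    by (intro integral_partial_deriv_eq_0 Ck_mult) auto
  then show ?thesis using i1 i2 by (simp add: eq)
qed

section \<open>Prisms along a direction\<close>

text \<open>An interval is a disjoint union of equal half-open intervals. Half-open intervals make this an
  identity at every point.\<close>

lemma indicator_interval_split:
  fixes y :: real
  assumes "t \<ge> 0"
  shows "indicator {\<alpha>..<\<alpha> + real k * t} y = (\<Sum>j<k. indicator {\<alpha>..<\<alpha> + t} (y - real j * t) :: real)"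
proof (induction k)
  case (Suc k)
  have "indicator {\<alpha>..<\<alpha> + real (Suc k) * t} y
    = (indicator {\<alpha>..<\<alpha> + real k * t} y + indicator {\<alpha>..<\<alpha> + t} (y - real k * t) :: real)"
    using assms by (auto simp: indicator_def algebra_simps) (smt (verit) mult_nonneg_nonneg of_nat_0_le_iff)+
  with Suc show ?case by simp
qed simp

text \<open>With \<open>C\<close> invariant along \<open>v\<close>, this is the part of a cylinder between two hyperplanes orthogonal
  to its axis.\<close>

definition prism :: "'a::euclidean_space set \<Rightarrow> 'a \<Rightarrow> 'a \<Rightarrow> real \<Rightarrow> real \<Rightarrow> 'a set" where
  "prism C v z l r = {x \<in> C. l \<le> (x - z) \<bullet> v \<and> (x - z) \<bullet> v < r}"

definition line_invariant :: "'a::euclidean_space set \<Rightarrow> 'a \<Rightarrow> bool" where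
  "line_invariant C v \<longleftrightarrow> (\<forall>x s. x + s *\<^sub>R v \<in> C \<longleftrightarrow> x \<in> C)"

lemma prism_borel [measurable]:
  assumes [measurable]: "C \<in> sets borel" shows "prism C v z l r \<in> sets borel"
proof -
  have "prism C v z l r = C \<inter> {x. l \<le> (x - z) \<bullet> v} \<inter> {x. (x - z) \<bullet> v < r}"
    by (auto simp: prism_def)
  also have "\<dots> \<in> sets borel"
    by (intro sets.Int borel_closed borel_open closed_Collect_le open_Collect_less
        continuous_intros assms)
  finally show ?thesis .
qed

lemma indicator_prism:
  "indicator (prism C v z l r) x = indicator C x * (indicator {l..<r} ((x - z) \<bullet> v) :: real)"
  by (auto simp: prism_def indicator_def)

lemma indicator_prism_shift:
  assumes "line_invariant C v" "norm v = 1"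
  shows "indicator (prism C v z l r) (x + s *\<^sub>R v)
    = indicator C x * (indicator {l..<r} ((x - z) \<bullet> v + s) :: real)"
proof -
  have "(x + s *\<^sub>R v - z) \<bullet> v = (x - z) \<bullet> v + s"
    using assms(2) by (simp add: inner_diff_left inner_add_left dot_square_norm)
  moreover have "x + s *\<^sub>R v \<in> C \<longleftrightarrow> x \<in> C"
    using assms(1) by (simp add: line_invariant_def)
  ultimately show ?thesis
    unfolding indicator_prism by (simp add: indicator_def)
qed

lemma integrable_indicator_bounded:
  fixes f :: "'a::euclidean_space \<Rightarrow> real"
  assumes "bounded E" "E \<in> sets borel" "f \<in> borel_measurable borel" "\<And>x. x \<in> E \<Longrightarrow> \<bar>f x\<bar> \<le> M"
  shows "integrable lborel (\<lambda>x. indicator E x * f x)"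
proof (rule integrable_bounded_support[where K = "\<bar>M\<bar>" and S = E])
  show "\<bar>indicat_real E x * f x\<bar> \<le> \<bar>M\<bar>" for x
    using assms(4)[of x] by (auto simp: indicator_def)
qed (use assms in \<open>auto simp: indicator_def split: if_splits\<close>)

text \<open>A prism consists of translates of its lowest slice.\<close>

lemma prism_measure_slices:
  assumes C: "line_invariant C v" "norm v = 1" "C \<in> sets borel"
    and b: "bounded (prism C v z l (l + real n * t))" and t: "t > 0" and n: "n > 0"
  shows "(LINT x|lborel. indicator (prism C v z l (l + real n * t)) x)
    = real n * (LINT x|lborel. indicator (prism C v z l (l + t)) x :: real)"
proof -
  let ?S = "prism C v z l (l + t)"
  have le: "l + t \<le> l + real n * t"
    using t n by (simp add: mult_le_cancel_right1)
  have "bounded ?S"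
  proof (rule bounded_subset[OF b], rule subsetI)
    fix x assume "x \<in> ?S"
    then show "x \<in> prism C v z l (l + real n * t)"
      unfolding prism_def mem_Collect_eq using le by linarith
  qed
  then have i: "integrable lborel (indicator ?S :: 'a \<Rightarrow> real)"
    using integrable_indicator_bounded[of ?S "\<lambda>x. 1" 1] C by auto
  have "indicator (prism C v z l (l + real n * t)) x
      = (\<Sum>j<n. indicator ?S (x + (- (real j * t)) *\<^sub>R v) :: real)" for x
    using t by (simp only: indicator_prism_shift[OF C(1,2)] indicator_prism[of _ _ _ _ "l + real n * t"]
      sum_distrib_left[symmetric] indicator_interval_split[OF less_imp_le] diff_conv_add_uminus)
  then have "(LINT x|lborel. indicator (prism C v z l (l + real n * t)) x)
    = (LINT x|lborel. (\<Sum>j<n. indicator ?S (x + (- (real j * t)) *\<^sub>R v) :: real))"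
    by simp
  also have "\<dots> = (\<Sum>j<n. LINT x|lborel. indicator ?S (x + (- (real j * t)) *\<^sub>R v) :: real)"
    by (intro Bochner_Integration.integral_sum lborel_integrable_shift[OF i])
  also have "\<dots> = (\<Sum>j<n. LINT x|lborel. indicator ?S x :: real)"
    using C(3) by (intro sum.cong refl lborel_integral_shift) auto
  finally show ?thesis by simp
qed

text \<open>Twice the area of the base is the volume divided by \<open>a\<close>, which is what the divergence theorem
  gives when \<open>f\<close> is 1 on one base and -1 on the other. Instead of areas of faces, the proof uses the
  two slices of thickness \<open>t\<close> in which the prism and its translate by \<open>t v\<close> differ; their volume is
  an exact fraction of that of the prism if the height \<open>2a\<close> is a multiple of \<open>t\<close>.\<close>

lemma prism_flux_le:
  fixes f :: "'a::euclidean_space \<Rightarrow> real"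
  assumes C: "line_invariant C v" "norm v = 1" "C \<in> sets borel"
    and b: "bounded (prism C v z (-a) a)" and a: "a > 0"
    and f: "Ck 1 f" "compact (support f)" "\<And>x. \<bar>f x\<bar> \<le> 1"
  shows "(LINT x|lborel. indicator (prism C v z (-a) a) x * partial_deriv v f x)
    \<le> (LINT x|lborel. indicator (prism C v z (-a) a) x) / a"
proof -
  let ?E = "prism C v z (-a) a"
  have contf: "continuous_on UNIV f" using Ck_continuous[OF f(1)] .
  then have mf [measurable]: "f \<in> borel_measurable borel"
    by (rule borel_measurable_continuous_onI)
  have lim: "(\<lambda>k. LINT x|lborel. indicator ?E x * ((f (x + (2 * a / Suc k) *\<^sub>R v) - f x) / (2 * a / Suc k)))
    \<longlonglongrightarrow> (LINT x|lborel. indicator ?E x * partial_deriv v f x)"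
    using a C by (intro shift_quotient_tendsto[OF f(1,2), of _ 1]) (auto simp: indicator_def)
  have "(LINT x|lborel. indicator ?E x * ((f (x + (2 * a / Suc k) *\<^sub>R v) - f x) / (2 * a / Suc k)))
    \<le> (LINT x|lborel. indicator ?E x) / a" for k
  proof -
    define t where "t = 2 * a / Suc k"
    have t: "t > 0" "t \<le> 2 * a" "-a + real (Suc k) * t = a"
      using a by (auto simp: t_def divide_simps mult_le_cancel_left1)
    let ?S = "prism C v z (-a) (-a + t)"
    have bS: "bounded ?S"
      using t by (intro bounded_subset[OF b]) (auto simp: prism_def)
    have iS: "integrable lborel (indicator ?S :: 'a \<Rightarrow> real)"
      using integrable_indicator_bounded[OF bS, of "\<lambda>x. 1" 1] C by auto
    have mS [measurable]: "?S \<in> sets borel" "?E \<in> sets borel" using C(3) by auto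
    have E: "(LINT x|lborel. indicator ?E x) = real (Suc k) * (LINT x|lborel. indicator ?S x :: real)"
      using prism_measure_slices[OF C, of z "-a" "Suc k" t] b t by (simp del: of_nat_Suc)
    have iEf: "integrable lborel (\<lambda>x. indicator ?E x * f x)"
      using integrable_indicator_bounded[OF b _ mf, of 1] f(3) mS by auto
    have iEft: "integrable lborel (\<lambda>x. indicator ?E (x + (-t) *\<^sub>R v) * f x)"
      using lborel_integrable_shift[OF integrable_indicator_bounded[OF b mS(2), of "\<lambda>x. f (x + t *\<^sub>R v)" 1], of "(-t) *\<^sub>R v"] f(3)
      by simp
    have iEft': "integrable lborel (\<lambda>x. indicator ?E x * f (x + t *\<^sub>R v))"
      using integrable_indicator_bounded[OF b mS(2), of "\<lambda>x. f (x + t *\<^sub>R v)" 1] f(3)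
      by simp
    have s: "(LINT x|lborel. indicator ?E x * f (x + t *\<^sub>R v))
      = (LINT x|lborel. indicator ?E (x + (-t) *\<^sub>R v) * f x)"
      using lborel_integral_shift[of "\<lambda>x. indicator ?E (x + (-t) *\<^sub>R v) * f x" "t *\<^sub>R v"] by simp
    have iS1: "integrable lborel (\<lambda>x. indicator ?S (x + (-(2 * a)) *\<^sub>R v) :: real)"
      by (rule lborel_integrable_shift[OF iS])
    have "(LINT x|lborel. indicator ?E x * ((f (x + t *\<^sub>R v) - f x) / t))
      = ((LINT x|lborel. indicator ?E x * f (x + t *\<^sub>R v)) - (LINT x|lborel. indicator ?E x * f x)) / t"
      using iEf iEft' by (simp add: right_diff_distrib flip: Bochner_Integration.integral_diff)
    also have "\<dots> = (LINT x|lborel. indicator ?E (x + (-t) *\<^sub>R v) * f x - indicator ?E x * f x) / t"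
      using iEf iEft by (simp add: s)
    also have "\<dots> \<le> (LINT x|lborel. indicator ?S (x + (-(2 * a)) *\<^sub>R v) + indicator ?S x) / t"
    proof (intro divide_right_mono integral_mono)
      \<comment> \<open>the translate of \<open>?E\<close> by \<open>t v\<close> gains the translate of the lowest slice \<open>?S\<close> by \<open>2a v\<close> and loses \<open>?S\<close>\<close>
      show "indicator ?E (x + (-t) *\<^sub>R v) * f x - indicator ?E x * f x
        \<le> indicator ?S (x + (-(2 * a)) *\<^sub>R v) + indicator ?S x" for x
      proof -
        define y where "y = (x - z) \<bullet> v"
        have "indicator ?E (x + (-t) *\<^sub>R v) * f x - indicator ?E x * f x
          = indicator C x * (indicator {-a..<a} (y + (-t)) - indicator {-a..<a} y) * f x"
          unfolding indicator_prism_shift[OF C(1,2)] by (simp add: indicator_prism y_def algebra_simps)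
        also have "indicator {-a..<a} (y + (-t)) - indicator {-a..<a} y
          = (indicator {-a..<-a+t} (y + (-(2*a))) - indicator {-a..<-a+t} y :: real)"
          using t by (auto simp: indicator_def)
        also have "indicator C x * \<dots> * f x
          = indicator ?S (x + (-(2 * a)) *\<^sub>R v) * f x + indicator ?S x * (- f x)"
          unfolding indicator_prism_shift[OF C(1,2)] by (simp add: indicator_prism y_def algebra_simps)
        also have "\<dots> \<le> indicator ?S (x + (-(2 * a)) *\<^sub>R v) * 1 + indicator ?S x * 1"
          using f(3)[of x] by (intro add_mono mult_left_mono) (auto simp: abs_le_iff)
        finally show ?thesis by simp
      qed
    qed (use iEf iEft iS iS1 t in auto)
    also have "\<dots> = 2 * (LINT x|lborel. indicator ?S x) / t"
      using iS iS1 lborel_integral_shift[of "indicator ?S" "(-(2 * a)) *\<^sub>R v"] by simp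
    also have "\<dots> = (LINT x|lborel. indicator ?E x) / a"
      unfolding E using a by (simp add: t_def del: of_nat_Suc)
    finally show ?thesis by (simp add: t_def)
  qed
  with lim show ?thesis by (intro LIMSEQ_le_const2) auto
qed

text \<open>Over the height of the prism, the angle runs through an interval of length \<open>\<pi>\<close>, a full period of
  the squares of sine and cosine. Moving the lower half up and the upper half down by \<open>a\<close> changes the
  angle by \<open>\<pi>/2\<close> and exchanges the two squares.\<close>

lemma prism_sin_cos_swap:
  fixes h :: "'a::euclidean_space \<Rightarrow> real"
  assumes C: "line_invariant C v" "norm v = 1" "C \<in> sets borel"
    and b: "bounded (prism C v z (-a) a)" and a: "a > 0"
    and h: "h \<in> borel_measurable borel" "\<And>x. \<bar>h x\<bar> \<le> M" "\<And>x s. h (x + s *\<^sub>R v) = h x"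
  shows "(LINT x|lborel. indicator (prism C v z (-a) a) x * (h x * (sin (pi * ((x - z) \<bullet> v) / (2 * a)))\<^sup>2))
    = (LINT x|lborel. indicator (prism C v z (-a) a) x * (h x * (cos (pi * ((x - z) \<bullet> v) / (2 * a)))\<^sup>2))"
proof -
  define G where "G T l r x = indicator (prism C v z l r) x * (h x * (T (pi * ((x - z) \<bullet> v) / (2 * a)))\<^sup>2)"
    for T :: "real \<Rightarrow> real" and l r x
  have trig: "\<bar>(T x)\<^sup>2\<bar> \<le> 1" if "T = sin \<or> T = cos" for T and x :: real
    using that sin_cos_squared_add[of x] by (auto simp: abs_square_le_1)
  have mG: "G T l r \<in> borel_measurable borel" if "T = sin \<or> T = cos" for T l r
  proof -
    have [measurable]: "T \<in> borel_measurable borel" using that by auto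
    show ?thesis unfolding G_def[abs_def] using C(3) h(1) by measurable
  qed
  have iG: "integrable lborel (G T l r)" if T: "T = sin \<or> T = cos" and lr: "-a \<le> l" "r \<le> a" for T l r
  proof -
    have bl: "bounded (prism C v z l r)" 
      using lr by (intro bounded_subset[OF b]) (auto simp: prism_def)
    have "\<bar>h x * (T (pi * ((x - z) \<bullet> v) / (2 * a)))\<^sup>2\<bar> \<le> M * 1" for x
      unfolding abs_mult using h(2)[of x] trig[OF T] by (intro mult_mono) auto
    moreover have [measurable]: "T \<in> borel_measurable borel" using T by auto
    ultimately show ?thesis
      unfolding G_def[abs_def] using C(3) h(1) 
      by (intro integrable_indicator_bounded[OF bl, where M = M]) simp_all
  qed
  have split: "(LINT x|lborel. G T (-a) a x) = (LINT x|lborel. G T (-a) 0 x) + (LINT x|lborel. G T 0 a x)"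
    if T: "T = sin \<or> T = cos" for T
  proof -
    have "G T (-a) a x = G T (-a) 0 x + G T 0 a x" for x
      using a by (auto simp: G_def prism_def indicator_def)
    then show ?thesis using iG[OF T] a by simp
  qed
  have yshift: "(x + s *\<^sub>R v - z) \<bullet> v = (x - z) \<bullet> v + s" for x s
    using C(2) by (simp add: inner_diff_left inner_add_left dot_square_norm)
  \<comment> \<open>translation by \<open>a v\<close> or by \<open>-a v\<close>, that is, by a quarter of a full turn\<close>
  have sw: "(LINT x|lborel. G sin (l + s) (r + s) x) = (LINT x|lborel. G cos l r x)"
    if "s = a \<or> s = -a" for s l r
  proof -
    have "G sin (l + s) (r + s) (x + s *\<^sub>R v) = G cos l r x" for x
    proof -
      have "pi * ((x - z) \<bullet> v + s) / (2 * a) = pi * ((x - z) \<bullet> v) / (2 * a) + (if s = a then 1 else -1) * (pi / 2)"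
        using that a by (auto simp: field_simps)
      then have "(sin (pi * ((x + s *\<^sub>R v - z) \<bullet> v) / (2 * a)))\<^sup>2 = (cos (pi * ((x - z) \<bullet> v) / (2 * a)))\<^sup>2"
        unfolding yshift by (auto simp: sin_add split: if_splits)
      then show ?thesis
        unfolding G_def indicator_prism_shift[OF C(1,2)] h(3)
        unfolding indicator_prism by (simp add: indicator_def)
    qed
    then show ?thesis
      using lborel_integral_shift[OF mG[of sin "l + s" "r + s"], of "s *\<^sub>R v"] by simp
  qed
  have "(LINT x|lborel. G sin (-a) a x) = (LINT x|lborel. G cos (-a) a x)"
    using split[of sin] split[of cos] sw[of "-a" 0 a] sw[of a "-a" 0] by simp
  then show ?thesis by (simp add: G_def)
qed

section \<open>Orthonormal boxes and their perimeter\<close>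

locale orthonormal_box =
  fixes I :: "'i set" and \<nu> :: "'i \<Rightarrow> 'a::euclidean_space" and z :: 'a and a :: "'i \<Rightarrow> real"
  assumes fin: "finite I" and card: "card I = DIM('a)"
    and ortho: "\<And>i j. i \<in> I \<Longrightarrow> j \<in> I \<Longrightarrow> \<nu> i \<bullet> \<nu> j = (if i = j then 1 else 0)"
    and pos: "\<And>i. i \<in> I \<Longrightarrow> a i > 0"
begin

definition box :: "'a set" where
  "box = {x. \<forall>i\<in>I. - a i \<le> (x - z) \<bullet> \<nu> i \<and> (x - z) \<bullet> \<nu> i < a i}"

definition walls :: "'i \<Rightarrow> 'a set" where
  "walls i = {x. \<forall>j\<in>I - {i}. - a j \<le> (x - z) \<bullet> \<nu> j \<and> (x - z) \<bullet> \<nu> j < a j}"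

lemma norm_dir: "i \<in> I \<Longrightarrow> norm (\<nu> i) = 1"
  using ortho[of i i] by (simp add: norm_eq_1)

lemma frame_expand: "(\<Sum>i\<in>I. (x \<bullet> \<nu> i) *\<^sub>R \<nu> i) = x"
proof -
  have inj: "inj_on \<nu> I"
    by (rule inj_onI) (metis ortho zero_neq_one)
  have orth: "pairwise orthogonal (\<nu> ` I)"
    using ortho by (auto simp: pairwise_def orthogonal_def)
  have "0 \<notin> \<nu> ` I"
    using norm_dir by force
  then have "independent (\<nu> ` I)"
    using pairwise_orthogonal_independent[OF orth] by blast
  moreover have "card (\<nu> ` I) = DIM('a)"
    using card_image[OF inj] card by simp
  ultimately have "span (\<nu> ` I) = UNIV"
    using card_eq_dim[of "\<nu> ` I" UNIV] fin by auto
  then have "(\<Sum>w\<in>\<nu> ` I. (x \<bullet> w) *\<^sub>R w) = x"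
    using norm_dir fin by (intro orthonormal_basis_expand orth) auto
  then show ?thesis
    using inj by (simp add: sum.reindex)
qed

lemma inner_frame: "x \<bullet> y = (\<Sum>i\<in>I. (x \<bullet> \<nu> i) * (y \<bullet> \<nu> i))"
proof -
  have "x \<bullet> y = (\<Sum>i\<in>I. (x \<bullet> \<nu> i) *\<^sub>R \<nu> i) \<bullet> y" by (simp add: frame_expand)
  also have "\<dots> = (\<Sum>i\<in>I. (x \<bullet> \<nu> i) * (y \<bullet> \<nu> i))"
    by (simp add: inner_sum_left inner_commute[of y])
  finally show ?thesis .
qed

text \<open>The divergence is a trace, so it may be computed in any orthonormal frame.\<close>

lemma trace_frame:
  assumes "linear L" shows "(\<Sum>b\<in>Basis. L b \<bullet> b) = (\<Sum>i\<in>I. L (\<nu> i) \<bullet> \<nu> i)"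
proof -
  have "(\<Sum>b\<in>Basis. L b \<bullet> b) = (\<Sum>b\<in>Basis. \<Sum>i\<in>I. (b \<bullet> \<nu> i) * (L b \<bullet> \<nu> i))"
    by (subst inner_frame) (simp add: mult.commute)
  also have "\<dots> = (\<Sum>i\<in>I. (\<Sum>b\<in>Basis. (\<nu> i \<bullet> b) *\<^sub>R L b) \<bullet> \<nu> i)"
    by (subst sum.swap) (simp add: inner_sum_left inner_commute[of "\<nu> _"])
  also have "\<dots> = (\<Sum>i\<in>I. L (\<Sum>b\<in>Basis. (\<nu> i \<bullet> b) *\<^sub>R b) \<bullet> \<nu> i)"
    by (simp add: linear_sum[OF assms] linear_cmul[OF assms])
  finally show ?thesis by (simp add: euclidean_representation)
qed

lemma bounded_box: "bounded box"
proof -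
  have "norm (x - z) \<le> (\<Sum>i\<in>I. a i)" if "x \<in> box" for x
  proof -
    have "norm (x - z) = norm (\<Sum>i\<in>I. ((x - z) \<bullet> \<nu> i) *\<^sub>R \<nu> i)" by (simp add: frame_expand)
    also have "\<dots> \<le> (\<Sum>i\<in>I. norm (((x - z) \<bullet> \<nu> i) *\<^sub>R \<nu> i))" by (rule norm_sum)
    also have "\<dots> \<le> (\<Sum>i\<in>I. a i)"
      using that norm_dir by (intro sum_mono) (auto simp: box_def abs_le_iff intro: less_imp_le)
    finally show ?thesis .
  qed
  then show ?thesis
    unfolding bounded_def by (metis dist_norm norm_minus_commute)
qed

lemma box_eq_prism: "i \<in> I \<Longrightarrow> box = prism (walls i) (\<nu> i) z (- a i) (a i)"
  by (auto simp: box_def walls_def prism_def)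

lemma walls_invariant: "i \<in> I \<Longrightarrow> line_invariant (walls i) (\<nu> i)"
  by (auto simp: line_invariant_def walls_def inner_diff_left inner_add_left ortho)

lemma walls_borel: "walls i \<in> sets borel"
proof -
  have "{x. - a j \<le> (x - z) \<bullet> \<nu> j} \<inter> {x. (x - z) \<bullet> \<nu> j < a j} \<in> sets borel" for j
    by (intro sets.Int borel_closed borel_open closed_Collect_le open_Collect_less continuous_intros)
  then have "{x \<in> space borel. - a j \<le> (x - z) \<bullet> \<nu> j \<and> (x - z) \<bullet> \<nu> j < a j} \<in> sets borel" for j
    by (simp add: Collect_conj_eq)
  then have "{x \<in> space borel. \<forall>j\<in>I - {i}. - a j \<le> (x - z) \<bullet> \<nu> j \<and> (x - z) \<bullet> \<nu> j < a j} \<in> sets borel"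
    using fin by (intro sets.sets_Collect_finite_All) auto
  then show ?thesis by (simp add: walls_def)
qed

lemma box_borel: "box \<in> sets borel"
proof -
  have "I \<noteq> {}" using card DIM_positive[where 'a='a] by auto
  then show ?thesis using box_eq_prism prism_borel[OF walls_borel] by (metis ex_in_conv)
qed

definition open_box :: "'a set" where
  "open_box = {x. \<forall>i\<in>I. \<bar>(x - z) \<bullet> \<nu> i\<bar> < a i}"

lemma open_open_box: "open open_box"
proof -
  have "open_box = (\<Inter>i\<in>I. {x. \<bar>(x - z) \<bullet> \<nu> i\<bar> < a i})"
    by (auto simp: open_box_def)
  then show ?thesis
    using fin by (auto intro!: open_INT open_Collect_less continuous_intros)
qed

lemma center_open_box: "z \<in> open_box"
  using pos by (simp add: open_box_def)

lemma open_box_subset: "open_box \<subseteq> box"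
  unfolding open_box_def box_def by fastforce

lemma measure_box: "(LINT x|lborel. indicator box x) = measure lebesgue box"
  using box_borel by simp

lemma measure_box_pos: "measure lebesgue box > 0"
proof -
  obtain e where e: "e > 0" "ball z e \<subseteq> box"
    using open_open_box center_open_box open_box_subset open_contains_ball by (metis order_trans)
  have "0 < measure lborel (ball z e)"
    using e(1) by (rule content_ball_pos)
  also have "\<dots> \<le> measure lborel box"
    using e(2) box_borel emeasure_bounded_finite[OF bounded_box]
    by (intro measure_mono_fmeasurable) (auto intro: fmeasurableI)
  finally show ?thesis using box_borel by simp
qed

text \<open>Each direction of the frame contributes one pair of opposite faces, whose total area
  is the volume divided by the half-side.\<close>

lemma perimeter_box_le: "perimeter box \<le> ereal (measure lebesgue box * (\<Sum>i\<in>I. 1 / a i))"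
  unfolding perimeter_def
proof (rule SUP_least, clarify)
  fix F :: "'a \<Rightarrow> 'a" assume F: "Ck 1 F" "compact (support F)" "\<forall>x. norm (F x) \<le> 1"
  have d: "F differentiable (at x)" for x
    using F(1) by (simp add: differentiable_on_def)
  have comp: "Ck 1 (\<lambda>x. F x \<bullet> w)" "partial_deriv v (\<lambda>x. F x \<bullet> w) x = partial_deriv v F x \<bullet> w" for v w x
  proof -
    have D: "((\<lambda>x. F x \<bullet> w) has_derivative (\<lambda>v. partial_deriv v F x \<bullet> w)) (at x)" for x
      by (intro has_derivative_inner_left has_derivative_partial_deriv d)
    then show "partial_deriv v (\<lambda>x. F x \<bullet> w) x = partial_deriv v F x \<bullet> w"
      by (rule partial_deriv_eq)
    show "Ck 1 (\<lambda>x. F x \<bullet> w)"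
      unfolding One_nat_def
      by (rule Ck_SucI[OF D]) (use F(1) in \<open>auto intro!: continuous_intros\<close>)
  qed
  have csupp: "compact (support (\<lambda>x. F x \<bullet> w))" for w
    using not_in_support[of _ F] by (intro compact_support_mono[OF F(2)]) simp
  have div: "divergence F x = (\<Sum>i\<in>I. partial_deriv (\<nu> i) (\<lambda>x. F x \<bullet> \<nu> i) x)" for x
    unfolding divergence_def comp
    using has_derivative_linear[OF has_derivative_partial_deriv[OF d]] by (rule trace_frame)
  have cont: "continuous_on UNIV (partial_deriv v (\<lambda>x. F x \<bullet> w))" for v w
    using continuous_partial_deriv[OF comp(1)] .
  have int: "integrable lborel (\<lambda>x. indicator box x * partial_deriv v (\<lambda>x. F x \<bullet> w) x)" for v w
  proof -
    obtain K where "\<And>x. norm (partial_deriv v (\<lambda>x. F x \<bullet> w) x) \<le> K"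
      using compact_support_bounded[OF cont compact_support_partial_deriv[OF csupp]] by metis
    then show ?thesis
      using borel_measurable_continuous_onI[OF cont]
      by (intro integrable_indicator_bounded[OF bounded_box box_borel]) auto
  qed
  have "(LINT x|lebesgue_on box. divergence F x) = (LINT x|lborel. indicator box x * divergence F x)"
  proof -
    have "(LINT x|lebesgue_on box. divergence F x) = (LINT x|lebesgue. indicator box x *\<^sub>R divergence F x)"
      using box_borel by (intro integral_restrict_space) auto
    also have "\<dots> = (LINT x|lborel. indicator box x *\<^sub>R divergence F x)"
      unfolding div using borel_measurable_continuous_onI[OF cont] box_borel
      by (intro integral_completion) auto
    finally show ?thesis by simp
  qed
  also have "\<dots> = (\<Sum>i\<in>I. LINT x|lborel. indicator box x * partial_deriv (\<nu> i) (\<lambda>x. F x \<bullet> \<nu> i) x)"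
    unfolding div sum_distrib_left using int by (intro Bochner_Integration.integral_sum)
  also have "\<dots> \<le> (\<Sum>i\<in>I. measure lebesgue box / a i)"
  proof (rule sum_mono)
    fix i assume i: "i \<in> I"
    have "\<bar>F x \<bullet> \<nu> i\<bar> \<le> 1" for x
      using Cauchy_Schwarz_ineq2[of "F x" "\<nu> i"] F(3) norm_dir[OF i] by (metis mult.right_neutral order_trans)
    then show "(LINT x|lborel. indicator box x * partial_deriv (\<nu> i) (\<lambda>x. F x \<bullet> \<nu> i) x) \<le> measure lebesgue box / a i"
      using prism_flux_le[OF walls_invariant[OF i] norm_dir[OF i] walls_borel _ pos[OF i] comp(1) csupp, of z]
        bounded_box measure_box
      by (simp flip: box_eq_prism[OF i])
  qed
  finally show "ereal (LINT x|lebesgue_on box. divergence F x) \<le> ereal (measure lebesgue box * (\<Sum>i\<in>I. 1 / a i))"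
    by (simp add: sum_distrib_left)
qed

end

section \<open>Cheeger constant between a slab and a box\<close>

definition pos_sq :: "real \<Rightarrow> real" where "pos_sq t = (max 0 t)\<^sup>2"

text \<open>A continuously differentiable step from 1 on the left of 1 to 0 on the right of 2.\<close>

definition cutoff :: "real \<Rightarrow> real" where "cutoff t = pos_sq (1 - pos_sq (t - 1))"

lemma DERIV_pos_sq: "(pos_sq has_real_derivative 2 * max 0 t) (at t)"
proof -
  consider "t > 0" | "t < 0" | "t = 0" by linarith
  then show ?thesis
  proof cases
    case 1
    have "((\<lambda>t. t\<^sup>2) has_real_derivative 2 * max 0 t) (at t)"
      using 1 by (auto intro!: derivative_eq_intros)
    then show ?thesis
      by (rule has_field_derivative_transform_within_open[of _ _ _ "{0<..}"])
        (use 1 in \<open>auto simp: pos_sq_def\<close>)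
  next
    case 2
    have "((\<lambda>t. 0) has_real_derivative 2 * max 0 t) (at t)"
      using 2 by auto
    then show ?thesis
      by (rule has_field_derivative_transform_within_open[of _ _ _ "{..<0}"])
        (use 2 in \<open>auto simp: pos_sq_def\<close>)
  next
    case 3
    have "(\<lambda>h. (pos_sq (0 + h) - pos_sq 0) / h) = (\<lambda>h. max 0 h)"
      by (auto simp: pos_sq_def max_def power2_eq_square)
    moreover have "((\<lambda>h::real. max 0 h) \<longlongrightarrow> max 0 0) (at 0)"
      by (intro tendsto_intros)
    ultimately show ?thesis
      using 3 by (simp add: DERIV_def)
  qed
qed

lemma C1_pos_sq: "Ck 1 f \<Longrightarrow> Ck 1 (\<lambda>x. pos_sq (f x))"
  by (rule C1_compose_real[OF _ DERIV_pos_sq]) (auto intro!: continuous_intros)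

lemma C1_diff_const: "Ck 1 f \<Longrightarrow> Ck 1 (\<lambda>x. c - f x :: real)"
  using Ck_add[OF Ck_const[of 1 c] Ck_mult[OF Ck_const[of 1 "-1"]], of f] by simp

lemma C1_cutoff: 
  assumes "Ck 1 f" shows "Ck 1 (\<lambda>x. cutoff (f x))"
proof -
  have "Ck 1 (\<lambda>x. f x - 1)"
    using Ck_add[OF assms Ck_const[of 1 "-1"]] by simp
  then show ?thesis
    unfolding cutoff_def by (intro C1_pos_sq C1_diff_const)
qed

lemma cutoff_eq_1: "t \<le> 1 \<Longrightarrow> cutoff t = 1"
  by (simp add: cutoff_def pos_sq_def)

lemma cutoff_eq_0: 
  assumes "t \<ge> 2" shows "cutoff t = 0"
proof -
  have "1 \<le> (t - 1)\<^sup>2" using assms by (simp add: one_le_power)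
  then show ?thesis using assms by (simp add: cutoff_def pos_sq_def)
qed

lemma cutoff_bounds: "0 \<le> cutoff t" "cutoff t \<le> 1"
  by (auto simp: cutoff_def pos_sq_def max_def power_le_one)

text \<open>The field \<open>(x \<bullet> v) v / r\<close> calibrates the slab, but it has to be cut off to get compact support and
  norm at most 1 everywhere. The cut-off across the slab needs some room outside it, where the field
  exceeds norm 1; the factor \<open>1 + \<rho>\<close> compensates for this.\<close>

lemma slab_perimeter_ge:
  fixes \<Omega> :: "'a::euclidean_space set"
  assumes \<Omega>: "open \<Omega>" "bounded \<Omega>" and v: "norm v = 1" and r: "r > 0"
    and slab: "\<And>x. x \<in> \<Omega> \<Longrightarrow> \<bar>(x - z) \<bullet> v\<bar> < r"
    and E: "E \<in> sets lebesgue" "E \<subseteq> \<Omega>" and \<rho>: "\<rho> > 0"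
  shows "ereal (measure lebesgue E / ((1 + \<rho>) * r)) \<le> perimeter E"
proof -
  obtain R where R: "R > 0" "\<And>x. x \<in> \<Omega> \<Longrightarrow> norm x \<le> R"
    using \<Omega>(2) bounded_pos by metis
  define s where "s x = (x - z) \<bullet> v" for x
  define c where "c = 1 / ((1 + \<rho>) * r)"
  define g where "g x = (c * s x) * (cutoff (1 + (s x * s x * (1 / r\<^sup>2) - 1) * (1 / \<rho>)) * cutoff (x \<bullet> x * (1 / R\<^sup>2)))" for x
  define F where "F x = g x *\<^sub>R v" for x
  have Ck_s: "Ck 1 s" unfolding s_def[abs_def] by (rule Ck_inner)
  have "Ck 1 (\<lambda>x. 1 + (s x * s x * (1 / r\<^sup>2) + - 1) * (1 / \<rho>))"
    by (intro Ck_add Ck_mult Ck_const Ck_s)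
  then have Ck_g: "Ck 1 g" unfolding g_def[abs_def]
    by (intro Ck_mult C1_cutoff Ck_const Ck_s Ck_norm_sq) simp_all
  have "Ck 1 F" unfolding F_def[abs_def]
    by (intro Ck_scaleR Ck_g Ck_const)
  moreover have "compact (support F)"
  proof -
    have "x \<in> cball 0 (2 * R)" if "F x \<noteq> 0" for x
    proof -
      have "cutoff (x \<bullet> x * (1 / R\<^sup>2)) \<noteq> 0"
        using that by (auto simp: F_def g_def)
      then have "x \<bullet> x * (1 / R\<^sup>2) < 2"
        using cutoff_eq_0 not_less by blast
      then have "(norm x)\<^sup>2 < 2 * R\<^sup>2"
        using R(1) by (simp add: divide_simps dot_square_norm)
      also have "\<dots> \<le> (2 * R)\<^sup>2" by (simp add: power2_eq_square)
      finally have "norm x < 2 * R"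
        by (rule power2_less_imp_less) (use R(1) in simp)
      then show ?thesis by simp
    qed
    then have "support F \<subseteq> cball 0 (2 * R)"
      by (intro support_subset_closed) auto
    then show ?thesis
      using compact_Int_closed[OF compact_cball closed_support, of 0 "2 * R" F] by (simp add: Int_absorb1)
  qed
  moreover have "norm (F x) \<le> 1" for x
  proof (cases "cutoff (1 + (s x * s x * (1 / r\<^sup>2) - 1) * (1 / \<rho>)) = 0")
    case True
    then show ?thesis by (simp add: F_def g_def)
  next
    case False
    then have "1 + (s x * s x * (1 / r\<^sup>2) - 1) * (1 / \<rho>) < 2"
      using cutoff_eq_0 not_less by blast
    then have "(s x / r)\<^sup>2 < 1 + \<rho>"
      using \<rho> r by (simp add: divide_simps power2_eq_square) (simp add: algebra_simps)
    also have "\<dots> \<le> (1 + \<rho>)\<^sup>2"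
      using \<rho> by (simp add: power2_eq_square)
    finally have "\<bar>s x / r\<bar>\<^sup>2 \<le> (1 + \<rho>)\<^sup>2"
      unfolding power2_abs by (rule less_imp_le)
    then have "\<bar>s x / r\<bar> \<le> 1 + \<rho>"
      by (rule power2_le_imp_le) (use \<rho> in simp)
    then have "\<bar>c * s x\<bar> \<le> 1"
      using \<rho> r by (simp add: c_def abs_mult divide_simps)
    moreover have "\<bar>cutoff a * cutoff b\<bar> \<le> 1" for a b
      using cutoff_bounds by (simp add: abs_mult mult_le_one)
    ultimately show ?thesis
      unfolding F_def g_def using v by (simp add: abs_mult[of "c * s x"] mult_le_one)
  qed
  ultimately have "ereal (LINT x|lebesgue_on E. divergence F x) \<le> perimeter E"
    unfolding perimeter_def by (intro SUP_upper) auto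
  moreover have "divergence F x = c" if "x \<in> \<Omega>" for x
  proof -
    have "((\<lambda>x. (c * ((x - z) \<bullet> v)) *\<^sub>R v) has_derivative (\<lambda>h. (c * (h \<bullet> v)) *\<^sub>R v)) (at x)"
      by (auto intro!: derivative_eq_intros)
    then have "(F has_derivative (\<lambda>h. (c * (h \<bullet> v)) *\<^sub>R v)) (at x)"
    proof (rule has_derivative_transform_within_open[OF _ \<Omega>(1) that])
      fix y assume y: "y \<in> \<Omega>"
      have "\<bar>s y\<bar> * \<bar>s y\<bar> \<le> r * r"
        using slab[OF y] by (intro mult_mono) (auto simp: s_def)
      then have "s y * s y * (1 / r\<^sup>2) \<le> 1"
        using r by (simp add: divide_simps power2_eq_square)
      then have "(s y * s y * (1 / r\<^sup>2) - 1) * (1 / \<rho>) \<le> 0"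
        using \<rho> by (intro mult_nonpos_nonneg) auto
      then have "1 + (s y * s y * (1 / r\<^sup>2) - 1) * (1 / \<rho>) \<le> 1"
        by linarith
      moreover have "y \<bullet> y \<le> R * R"
        using mult_mono[OF R(2)[OF y] R(2)[OF y]] R(1) by (simp add: dot_square_norm power2_eq_square)
      then have "y \<bullet> y * (1 / R\<^sup>2) \<le> 1"
        using R(1) by (simp add: divide_simps power2_eq_square)
      ultimately show "(c * ((y - z) \<bullet> v)) *\<^sub>R v = F y"
        by (simp add: F_def g_def cutoff_eq_1 s_def)
    qed
    then have "partial_deriv b F x \<bullet> b = c * ((v \<bullet> b) * (v \<bullet> b))" for b
      by (simp add: partial_deriv_eq inner_commute)
    then show ?thesis
      unfolding divergence_def
      using v by (simp add: norm_eq_1 flip: sum_distrib_left euclidean_inner)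
  qed
  then have "(LINT x|lebesgue_on E. divergence F x) = (LINT x|lebesgue_on E. c)"
    using E(2) by (intro Bochner_Integration.integral_cong) auto
  then have "(LINT x|lebesgue_on E. divergence F x) = measure lebesgue E * c"
    using E(1) by (simp add: measure_restrict_space)
  ultimately show ?thesis by (simp add: c_def)
qed

text \<open>The previous bound in the limit of vanishing \<open>\<rho>\<close>.\<close>

lemma cheeger_INF_ge:
  fixes \<Omega> :: "'a::euclidean_space set"
  assumes \<Omega>: "open \<Omega>" "bounded \<Omega>" and v: "norm v = 1" and r: "r > 0"
    and slab: "\<And>x. x \<in> \<Omega> \<Longrightarrow> \<bar>(x - z) \<bullet> v\<bar> < r"
  shows "ereal (1 / r) \<le> (INF E \<in> {E. E \<in> sets lebesgue \<and> E \<subseteq> \<Omega> \<and> measure lebesgue E > 0}.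
        perimeter E / ereal (measure lebesgue E))"
proof (rule INF_greatest, clarify)
  fix E assume E: "E \<in> sets lebesgue" "E \<subseteq> \<Omega>" "measure lebesgue E > 0"
  have lim: "(\<lambda>n. ereal (1 / ((1 + 1 / real (Suc n)) * r))) \<longlonglongrightarrow> ereal (1 / ((1 + 0) * r))"
    unfolding tendsto_ereal using r by (intro tendsto_intros LIMSEQ_Suc[OF lim_1_over_n]) auto
  have "ereal (1 / ((1 + 1 / real (Suc n)) * r)) \<le> perimeter E / ereal (measure lebesgue E)" for n
    using ereal_divide_right_mono[OF slab_perimeter_ge[OF \<Omega> v r slab E(1,2), of "1 / real (Suc n)"],
        of "ereal (measure lebesgue E)"] E(3)
    by (simp del: of_nat_Suc)
  then have "ereal (1 / ((1 + 0) * r)) \<le> perimeter E / ereal (measure lebesgue E)"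
    by (intro LIMSEQ_le_const2[OF lim]) blast
  then show "ereal (1 / r) \<le> perimeter E / ereal (measure lebesgue E)"
    by simp
qed

lemma (in orthonormal_box) cheeger_INF_le:
  assumes "box \<subseteq> \<Omega>"
  shows "(INF E \<in> {E. E \<in> sets lebesgue \<and> E \<subseteq> \<Omega> \<and> measure lebesgue E > 0}.
        perimeter E / ereal (measure lebesgue E)) \<le> ereal (\<Sum>i\<in>I. 1 / a i)"
proof (rule INF_lower2)
  show "box \<in> {E. E \<in> sets lebesgue \<and> E \<subseteq> \<Omega> \<and> measure lebesgue E > 0}"
    using assms box_borel measure_box_pos by auto
  show "perimeter box / ereal (measure lebesgue box) \<le> ereal (\<Sum>i\<in>I. 1 / a i)"
    using ereal_divide_right_mono[OF perimeter_box_le, of "ereal (measure lebesgue box)"] measure_box_pos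
    by simp
qed

lemma cheeger_bounds:
  assumes \<Omega>: "open \<Omega>" "bounded \<Omega>" and v: "norm v = 1" and r: "r > 0"
    and slab: "\<And>x. x \<in> \<Omega> \<Longrightarrow> \<bar>(x - z) \<bullet> v\<bar> < r"
    and box: "orthonormal_box I \<nu> a" "orthonormal_box.box I \<nu> y a \<subseteq> \<Omega>"
  shows "1 / r \<le> cheeger \<Omega>" "cheeger \<Omega> \<le> (\<Sum>i\<in>I. 1 / a i)"
proof -
  define h where "h = (INF E \<in> {E. E \<in> sets lebesgue \<and> E \<subseteq> \<Omega> \<and> measure lebesgue E > 0}.
        perimeter E / ereal (measure lebesgue E))"
  have "ereal (1 / r) \<le> h" "h \<le> ereal (\<Sum>i\<in>I. 1 / a i)"
    unfolding h_def
    using cheeger_INF_ge[OF \<Omega> v r slab] orthonormal_box.cheeger_INF_le[OF box] by auto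
  moreover have "cheeger \<Omega> = real_of_ereal h"
    by (simp add: cheeger_def h_def)
  ultimately show "1 / r \<le> cheeger \<Omega>" "cheeger \<Omega> \<le> (\<Sum>i\<in>I. 1 / a i)"
    by (cases h; simp)+
qed

section \<open>The Poincare inequality in a slab\<close>

lemma continuous_on_glue_zero:
  fixes f :: "'a::topological_space \<Rightarrow> 'b::real_normed_vector"
  assumes "open U" "closed K" "K \<subseteq> U" "continuous_on U f" "\<And>x. x \<notin> K \<Longrightarrow> f x = 0"
  shows "continuous_on UNIV f"
proof -
  have "continuous_on (- K) f \<longleftrightarrow> continuous_on (- K) (\<lambda>x. 0 :: 'b)"
    using assms(5) by (intro continuous_on_cong) auto
  then have "continuous_on (U \<union> - K) f"
    using assms by (intro continuous_on_open_Un) auto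
  moreover have "U \<union> - K = UNIV" using assms(3) by blast
  ultimately show ?thesis by simp
qed

lemma lebesgue_on_integral_eq_lborel:
  fixes f :: "'a::euclidean_space \<Rightarrow> real"
  assumes "f \<in> borel_measurable borel" "\<And>x. x \<notin> \<Omega> \<Longrightarrow> f x = 0" "\<Omega> \<in> sets borel"
  shows "(LINT x|lebesgue_on \<Omega>. f x) = (LINT x|lborel. f x)"
proof -
  have "(LINT x|lebesgue_on \<Omega>. f x) = (LINT x|lebesgue. indicator \<Omega> x *\<^sub>R f x)"
    using assms(3) by (intro integral_restrict_space) auto
  also have "(\<lambda>x. indicator \<Omega> x *\<^sub>R f x) = f"
    using assms(2) by (auto simp: indicator_def fun_eq_iff)
  also have "(LINT x|lebesgue. f x) = (LINT x|lborel. f x)"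
    using assms(1) by (intro integral_completion) auto
  finally show ?thesis .
qed

text \<open>With \<open>\<kappa> = \<pi>/2r\<close> and \<open>T = -\<kappa> tan (\<kappa> t)\<close>, the logarithmic derivative of the ground state
  \<open>cos (\<kappa> t)\<close> of the interval of half-length \<open>r\<close>, one has \<open>T' = -\<kappa>\<^sup>2 - T\<^sup>2\<close>. Integrating the derivative of \<open>\<phi>\<^sup>2 T\<close> to 0 therefore
  completes a square: the energy minus \<open>\<kappa>\<^sup>2\<close> times the mass is the integral of \<open>(\<phi>' - \<phi> T)\<^sup>2\<close>. The
  singularities of \<open>T\<close> lie on the boundary of the slab or outside it, away from the support of \<open>\<phi>\<close>.\<close>

lemma slab_poincare_smooth:
  fixes \<phi> :: "'a::euclidean_space \<Rightarrow> real"
  assumes \<phi>: "Ck 1 \<phi>" "compact (support \<phi>)" and v: "norm v = 1" and r: "r > 0"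
    and slab: "\<And>x. x \<in> support \<phi> \<Longrightarrow> \<bar>(x - z) \<bullet> v\<bar> < r"
  shows "(pi / (2 * r))\<^sup>2 * (LINT x|lborel. (\<phi> x)\<^sup>2) \<le> (LINT x|lborel. (partial_deriv v \<phi> x)\<^sup>2)"
proof -
  define \<kappa> where "\<kappa> = pi / (2 * r)"
  define s where "s x = (x - z) \<bullet> v" for x
  define T where "T x = - \<kappa> * tan (\<kappa> * s x)" for x
  define U where "U = {x. \<bar>s x\<bar> < r}"
  define g where "g x = (\<phi> x)\<^sup>2 * T x" for x
  have U: "open U" "support \<phi> \<subseteq> U"
    using slab by (auto simp: U_def s_def intro!: open_Collect_less continuous_intros)
  have cos_pos: "cos (\<kappa> * s x) \<noteq> 0" if "x \<in> U" for x
  proof -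
    have "\<kappa> > 0" using r by (simp add: \<kappa>_def)
    then have "\<bar>\<kappa> * s x\<bar> < \<kappa> * r"
      using that by (simp add: U_def abs_mult)
    then have "\<bar>\<kappa> * s x\<bar> < pi / 2"
      using r by (simp add: \<kappa>_def)
    then have "- (pi / 2) < \<kappa> * s x" "\<kappa> * s x < pi / 2"
      by linarith+
    then show ?thesis
      using cos_gt_zero_pi by (metis less_irrefl)
  qed
  have d\<phi>: "\<phi> differentiable (at x)" for x
    using \<phi>(1) by (simp add: differentiable_on_def)
  have contd: "continuous_on UNIV (partial_deriv w \<phi>)" for w
    using continuous_partial_deriv[OF \<phi>(1)] .
  have cont\<phi>: "continuous_on UNIV \<phi>"
    using Ck_continuous[OF \<phi>(1)] .
  have contT: "continuous_on U T"
    unfolding T_def[abs_def] tan_def using cos_pos unfolding s_def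
    by (intro continuous_intros) auto
  \<comment> \<open>the derivative of \<open>g\<close> in direction \<open>w\<close>, with \<open>T\<close> differentiated by its Riccati equation; it vanishes wherever \<open>\<phi>\<close> does\<close>
  define D where "D w x = \<phi> x * (2 * T x * partial_deriv w \<phi> x - \<phi> x * (\<kappa>\<^sup>2 + (T x)\<^sup>2) * (w \<bullet> v))" for w x
  have der: "(g has_derivative (\<lambda>w. D w x)) (at x)" for x
  proof (cases "x \<in> support \<phi>")
    case True
    then have x: "x \<in> U" using U by blast
    have "((\<lambda>x. \<kappa> * s x) has_derivative (\<lambda>w. \<kappa> * (w \<bullet> v))) (at x)"
      unfolding s_def by (auto intro!: derivative_eq_intros)
    from diff_chain_at[OF this DERIV_tan[OF cos_pos[OF x], unfolded has_field_derivative_def]]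
    have "((\<lambda>x. tan (\<kappa> * s x)) has_derivative (\<lambda>w. inverse ((cos (\<kappa> * s x))\<^sup>2) * (\<kappa> * (w \<bullet> v)))) (at x)"
      by (simp add: o_def)
    then have T: "(T has_derivative (\<lambda>w. - \<kappa> * (inverse ((cos (\<kappa> * s x))\<^sup>2) * (\<kappa> * (w \<bullet> v))))) (at x)"
      unfolding T_def[abs_def] by (rule has_derivative_mult_right)
    have sec: "inverse ((cos (\<kappa> * s x))\<^sup>2) = 1 + (tan (\<kappa> * s x))\<^sup>2"
      using tan_sec[OF cos_pos[OF x]] by (simp add: power_inverse)
    have tan: "\<kappa> * (\<kappa> * inverse ((cos (\<kappa> * s x))\<^sup>2)) = \<kappa>\<^sup>2 + (T x)\<^sup>2"
      unfolding sec by (simp add: T_def power2_eq_square algebra_simps)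
    have "(g has_derivative (\<lambda>w. (\<phi> x)\<^sup>2 * (- \<kappa> * (inverse ((cos (\<kappa> * s x))\<^sup>2) * (\<kappa> * (w \<bullet> v))))
      + (2 * \<phi> x * partial_deriv w \<phi> x) * T x)) (at x)"
      unfolding g_def[abs_def]
      by (rule has_derivative_mult[OF _ T])
        (use has_derivative_power[OF has_derivative_partial_deriv[OF d\<phi>], of 2] in \<open>simp add: mult_ac\<close>)
    moreover have "(\<phi> x)\<^sup>2 * (- \<kappa> * (inverse ((cos (\<kappa> * s x))\<^sup>2) * (\<kappa> * (w \<bullet> v))))
      + (2 * \<phi> x * partial_deriv w \<phi> x) * T x = D w x" for w
      unfolding D_def tan[symmetric] by (simp add: algebra_simps power2_eq_square)
    ultimately show ?thesis by simp
  next
    case False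
    have "((\<lambda>x. 0) has_derivative (\<lambda>w. 0)) (at x)" by simp
    then have "(g has_derivative (\<lambda>w. 0)) (at x)"
      by (rule has_derivative_transform_within_open[where s = "- support \<phi>"])
        (use False not_in_support[of _ \<phi>] closed_support[of \<phi>] in \<open>auto simp: g_def\<close>)
    then show ?thesis
      using not_in_support[OF False] by (simp add: D_def)
  qed
  have contD: "continuous_on UNIV (D w)" for w
  proof (rule continuous_on_glue_zero[OF U(1) closed_support U(2)])
    show "continuous_on U (D w)"
      unfolding D_def[abs_def]
      by (intro continuous_intros contT continuous_on_subset[OF cont\<phi>] continuous_on_subset[OF contd]) auto
  qed (simp add: D_def not_in_support)
  have "Ck 1 g"
    unfolding One_nat_def by (rule Ck_SucI[OF der]) (simp add: contD)
  moreover have "compact (support g)"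
    using not_in_support[of _ \<phi>] by (intro compact_support_mono[OF \<phi>(2)]) (simp add: g_def)
  ultimately have "(LINT x|lborel. partial_deriv v g x) = 0"
    by (rule integral_partial_deriv_eq_0)
  then have I0: "(LINT x|lborel. D v x) = 0"
    using partial_deriv_eq[OF der] by simp
  have iD: "integrable lborel (D v)"
    using not_in_support[of _ \<phi>]
    by (intro integrable_compact_support[OF contD] compact_support_mono[OF \<phi>(2)]) (simp add: D_def)
  have i1: "integrable lborel (\<lambda>x. (\<phi> x)\<^sup>2)"
    using integrable_norm_sq[OF cont\<phi> \<phi>(2)] by simp
  have i2: "integrable lborel (\<lambda>x. (partial_deriv v \<phi> x)\<^sup>2)"
    using integrable_norm_sq[OF contd compact_support_partial_deriv[OF \<phi>(2)]] by simp
  have "\<kappa>\<^sup>2 * (LINT x|lborel. (\<phi> x)\<^sup>2) = (LINT x|lborel. \<kappa>\<^sup>2 * (\<phi> x)\<^sup>2 + D v x)"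
    using i1 iD I0 by simp
  also have "\<dots> \<le> (LINT x|lborel. (partial_deriv v \<phi> x)\<^sup>2)"
  proof (intro integral_mono)
    fix x
    have "(partial_deriv v \<phi> x)\<^sup>2 - (\<kappa>\<^sup>2 * (\<phi> x)\<^sup>2 + D v x) = (partial_deriv v \<phi> x - \<phi> x * T x)\<^sup>2"
      using v by (simp add: D_def norm_eq_1 power2_eq_square algebra_simps)
    then show "\<kappa>\<^sup>2 * (\<phi> x)\<^sup>2 + D v x \<le> (partial_deriv v \<phi> x)\<^sup>2"
      by (metis diff_ge_0_iff_ge zero_le_power2)
  qed (use i1 i2 iD in auto)
  finally show ?thesis by (simp add: \<kappa>_def)
qed

lemma L2_norm_sq: "(L2_norm \<Omega> f)\<^sup>2 = (LINT x|lebesgue_on \<Omega>. (norm (f x))\<^sup>2)"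
  unfolding L2_norm_def by (rule real_sqrt_pow2) simp

lemma norm_add_sq_le:
  fixes x y :: "'b::real_inner"
  assumes "\<epsilon> > 0"
  shows "(norm (x + y))\<^sup>2 \<le> (1 + \<epsilon>) * (norm x)\<^sup>2 + (1 + 1 / \<epsilon>) * (norm y)\<^sup>2"
proof -
  have "0 \<le> (norm (\<epsilon> *\<^sub>R x - y))\<^sup>2 / \<epsilon>" using assms by simp
  also have "\<dots> = \<epsilon> * (x \<bullet> x) - 2 * (x \<bullet> y) + (y \<bullet> y) / \<epsilon>"
    using assms by (simp add: power2_norm_eq_inner inner_diff_left inner_diff_right inner_commute field_simps)
  finally show ?thesis
    by (simp add: power2_norm_eq_inner inner_add_left inner_add_right inner_commute[of y x] algebra_simps)
qed

lemma L2_add: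
  assumes "f \<in> L2 \<Omega>" "h \<in> L2 \<Omega>" shows "(\<lambda>x. f x + h x) \<in> L2 \<Omega>"
proof -
  have [measurable]: "f \<in> borel_measurable (lebesgue_on \<Omega>)" "h \<in> borel_measurable (lebesgue_on \<Omega>)"
    using assms by (auto simp: L2_def)
  have "integrable (lebesgue_on \<Omega>) (\<lambda>x. (norm (f x + h x))\<^sup>2)"
  proof (rule Bochner_Integration.integrable_bound)
    show "integrable (lebesgue_on \<Omega>) (\<lambda>x. 2 * (norm (f x))\<^sup>2 + 2 * (norm (h x))\<^sup>2)"
      using assms by (simp add: L2_def)
    show "AE x in lebesgue_on \<Omega>. norm ((norm (f x + h x))\<^sup>2) \<le> norm (2 * (norm (f x))\<^sup>2 + 2 * (norm (h x))\<^sup>2)"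
      using norm_add_sq_le[of 1 "f _" "h _"] by (intro AE_I2) simp
  qed measurable
  then show ?thesis by (simp add: L2_def)
qed

lemma L2_diff:
  assumes "f \<in> L2 \<Omega>" "h \<in> L2 \<Omega>" shows "(\<lambda>x. f x - h x) \<in> L2 \<Omega>"
proof -
  have "(\<lambda>x. - h x) \<in> L2 \<Omega>" using assms(2) by (auto simp: L2_def)
  from L2_add[OF assms(1) this] show ?thesis by simp
qed

lemma L2_integrable: "f \<in> L2 \<Omega> \<Longrightarrow> integrable (lebesgue_on \<Omega>) (\<lambda>x. (norm (f x))\<^sup>2)"
  by (simp add: L2_def)

lemma L2_inner_integrable:
  assumes "f \<in> L2 \<Omega>" "h \<in> L2 \<Omega>" shows "integrable (lebesgue_on \<Omega>) (\<lambda>x. f x \<bullet> h x)"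
proof -
  have [measurable]: "f \<in> borel_measurable (lebesgue_on \<Omega>)" "h \<in> borel_measurable (lebesgue_on \<Omega>)"
    using assms by (auto simp: L2_def)
  show ?thesis
  proof (rule Bochner_Integration.integrable_bound)
    show "integrable (lebesgue_on \<Omega>) (\<lambda>x. (norm (f x))\<^sup>2 + (norm (h x))\<^sup>2)"
      using assms by (simp add: L2_def)
    show "AE x in lebesgue_on \<Omega>. norm (f x \<bullet> h x) \<le> norm ((norm (f x))\<^sup>2 + (norm (h x))\<^sup>2)"
    proof (intro AE_I2)
      fix x
      have "\<bar>f x \<bullet> h x\<bar> \<le> norm (f x) * norm (h x)" by (rule Cauchy_Schwarz_ineq2)
      also have "\<dots> \<le> (norm (f x))\<^sup>2 + (norm (h x))\<^sup>2"
        using zero_le_power2[of "norm (f x) - norm (h x)"] zero_le_mult_iff[of "norm (f x)" "norm (h x)"]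
        by (simp add: power2_eq_square algebra_simps) (smt (verit) norm_ge_zero mult_nonneg_nonneg)
      finally show "norm (f x \<bullet> h x) \<le> norm ((norm (f x))\<^sup>2 + (norm (h x))\<^sup>2)" by simp
    qed
  qed measurable
qed

text \<open>A substitute for the triangle inequality that stays with squares; the constants become harmless
  when first \<open>h - f\<close> tends to 0 and then \<open>\<epsilon>\<close>.\<close>

lemma L2_norm_sq_young:
  assumes "f \<in> L2 \<Omega>" "h \<in> L2 \<Omega>" "\<epsilon> > 0"
  shows "(L2_norm \<Omega> f)\<^sup>2 \<le> (1 + \<epsilon>) * (L2_norm \<Omega> h)\<^sup>2 + (1 + 1 / \<epsilon>) * (L2_norm \<Omega> (\<lambda>x. h x - f x))\<^sup>2"
proof -
  have "(L2_norm \<Omega> f)\<^sup>2 \<le> (LINT x|lebesgue_on \<Omega>. (1 + \<epsilon>) * (norm (h x))\<^sup>2 + (1 + 1 / \<epsilon>) * (norm (h x - f x))\<^sup>2)"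
    unfolding L2_norm_sq
  proof (rule integral_mono)
    show "(norm (f x))\<^sup>2 \<le> (1 + \<epsilon>) * (norm (h x))\<^sup>2 + (1 + 1 / \<epsilon>) * (norm (h x - f x))\<^sup>2" for x
      using norm_add_sq_le[OF assms(3), of "h x" "f x - h x"] by (simp add: norm_minus_commute)
  qed (use assms L2_integrable[OF L2_diff[OF assms(2,1)]] in \<open>auto simp: L2_def\<close>)
  also have "\<dots> = (1 + \<epsilon>) * (L2_norm \<Omega> h)\<^sup>2 + (1 + 1 / \<epsilon>) * (L2_norm \<Omega> (\<lambda>x. h x - f x))\<^sup>2"
    unfolding L2_norm_sq
    using L2_integrable[OF assms(2)] L2_integrable[OF L2_diff[OF assms(2,1)]] by simp
  finally show ?thesis .
qed

lemma L2_compact_support: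
  fixes f :: "'a::euclidean_space \<Rightarrow> 'b::euclidean_space"
  assumes "continuous_on UNIV f" "compact (support f)" "\<Omega> \<in> sets borel"
  shows "f \<in> L2 \<Omega>"
proof -
  have "f \<in> borel_measurable (lebesgue_on \<Omega>)"
    using assms by (intro continuous_imp_measurable_on_sets_lebesgue) (auto intro: continuous_on_subset)
  moreover have "integrable lborel (\<lambda>x. (norm (f x))\<^sup>2)"
    using assms by (intro integrable_norm_sq)
  then have "integrable lebesgue (\<lambda>x. (norm (f x))\<^sup>2)"
    by (subst integrable_completion) (auto intro: borel_measurable_integrable)
  then have "integrable (lebesgue_on \<Omega>) (\<lambda>x. (norm (f x))\<^sup>2)"
    using assms(3) integrable_mult_indicator[of \<Omega> lebesgue "\<lambda>x. (norm (f x))\<^sup>2"]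
    by (subst integrable_restrict_space) auto
  ultimately show ?thesis by (simp add: L2_def)
qed

lemma test_functionsD:
  assumes "\<phi> \<in> test_functions \<Omega>"
  shows "Ck k \<phi>" "compact (support \<phi>)" "support \<phi> \<subseteq> \<Omega>"
  using assms by (auto simp: test_functions_def)

lemma test_functions_partial_deriv:
  assumes "\<phi> \<in> test_functions \<Omega>" "b \<in> Basis"
  shows "partial_deriv b \<phi> \<in> test_functions \<Omega>"
proof -
  have "Ck k (partial_deriv b \<phi>)" for k
    using test_functionsD(1)[OF assms(1), of "Suc k"] assms(2) by simp
  then show ?thesis
    using test_functionsD(2,3)[OF assms(1)] compact_support_partial_deriv[of \<phi> b] support_partial_deriv[of b \<phi>]
    by (auto simp: test_functions_def)
qed

lemma grad_inner:
  assumes "\<phi> differentiable (at x)" shows "grad \<phi> x \<bullet> w = partial_deriv w \<phi> x"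
  unfolding partial_deriv_Basis[OF assms, of w] grad_def
  by (simp add: inner_sum_left inner_commute[of w] mult.commute)

lemma continuous_grad: "Ck 1 \<phi> \<Longrightarrow> continuous_on UNIV (grad \<phi>)"
  unfolding grad_def[abs_def] by (intro continuous_intros continuous_partial_deriv)

lemma support_grad: "support (grad \<phi>) \<subseteq> support \<phi>"
proof (rule support_subset_closed[OF closed_support])
  fix x assume "grad \<phi> x \<noteq> 0"
  then show "x \<in> support \<phi>"
    using partial_deriv_eq_0_outside[of x \<phi>] by (cases "x \<in> support \<phi>") (auto simp: grad_def)
qed

lemma compact_support_grad: "compact (support \<phi>) \<Longrightarrow> compact (support (grad \<phi>))"
  by (rule compact_support_mono) (auto simp: grad_def partial_deriv_eq_0_outside)

lemma test_functions_L2: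
  assumes "\<phi> \<in> test_functions \<Omega>" "\<Omega> \<in> sets borel"
  shows "\<phi> \<in> L2 \<Omega>" "grad \<phi> \<in> L2 \<Omega>"
  using test_functionsD[OF assms(1)] assms(2)
  by (auto intro!: L2_compact_support Ck_continuous continuous_grad compact_support_grad)

lemma weak_gradient_grad:
  assumes \<phi>: "\<phi> \<in> test_functions \<Omega>" and \<Omega>: "open \<Omega>"
  shows "weak_gradient \<Omega> \<phi> (grad \<phi>)"
  unfolding weak_gradient_def
proof (intro conjI ballI)
  show "\<phi> \<in> L2 \<Omega>" "grad \<phi> \<in> L2 \<Omega>"
    using test_functions_L2[OF \<phi>] \<Omega> by auto
  fix \<psi> :: "'a \<Rightarrow> real" and b :: 'a assume \<psi>: "\<psi> \<in> test_functions \<Omega>" and b: "b \<in> Basis"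
  note f = test_functionsD[OF \<phi>] and p = test_functionsD[OF \<psi>]
  have d: "\<phi> differentiable (at x)" for x
    using f(1)[of 1] by (simp add: differentiable_on_def)
  have out: "\<phi> x = 0" "\<psi> x = 0" if "x \<notin> \<Omega>" for x
    using f(3) p(3) that not_in_support by blast+
  have c: "continuous_on UNIV (partial_deriv b \<psi>)" "continuous_on UNIV (partial_deriv b \<phi>)"
    "continuous_on UNIV \<phi>" "continuous_on UNIV \<psi>"
    using continuous_partial_deriv f(1) p(1) Ck_continuous by blast+
  have "(LINT x|lebesgue_on \<Omega>. \<phi> x * partial_deriv b \<psi> x) = (LINT x|lborel. \<phi> x * partial_deriv b \<psi> x)"
    using c out \<Omega> by (intro lebesgue_on_integral_eq_lborel borel_measurable_continuous_onI continuous_on_mult) auto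
  also have "\<dots> = - (LINT x|lborel. partial_deriv b \<phi> x * \<psi> x)"
    using f(1) p(1,2) by (rule integral_by_parts)
  also have "(LINT x|lborel. partial_deriv b \<phi> x * \<psi> x) = (LINT x|lebesgue_on \<Omega>. partial_deriv b \<phi> x * \<psi> x)"
    using c out \<Omega>
    by (intro lebesgue_on_integral_eq_lborel[symmetric] borel_measurable_continuous_onI continuous_on_mult) auto
  finally show "(LINT x|lebesgue_on \<Omega>. \<phi> x * partial_deriv b \<psi> x)
      = - (LINT x|lebesgue_on \<Omega>. (grad \<phi> x \<bullet> b) * \<psi> x)"
    by (simp add: grad_inner[OF d])
qed

text \<open>Each component of \<open>grad \<phi>\<close> is again a test function, so the pairing with a weak gradient is
  determined by \<open>u\<close> and \<open>\<phi>\<close>.\<close>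

lemma weak_gradient_inner_grad_unique:
  assumes g: "weak_gradient \<Omega> u g" "weak_gradient \<Omega> u g'" and \<phi>: "\<phi> \<in> test_functions \<Omega>" and \<Omega>: "\<Omega> \<in> sets borel"
  shows "(LINT x|lebesgue_on \<Omega>. g x \<bullet> grad \<phi> x) = (LINT x|lebesgue_on \<Omega>. g' x \<bullet> grad \<phi> x)"
proof -
  have *: "(LINT x|lebesgue_on \<Omega>. g x \<bullet> grad \<phi> x) =
      (\<Sum>b\<in>Basis. - (LINT x|lebesgue_on \<Omega>. u x * partial_deriv b (partial_deriv b \<phi>) x))"
    if g: "weak_gradient \<Omega> u g" for g
  proof -
    have gL: "g \<in> L2 \<Omega>" using g by (simp add: weak_gradient_def)
    have int: "integrable (lebesgue_on \<Omega>) (\<lambda>x. (g x \<bullet> b) * partial_deriv b \<phi> x)" if b: "b \<in> Basis" for b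
    proof -
      have t: "partial_deriv b \<phi> \<in> test_functions \<Omega>"
        using test_functions_partial_deriv[OF \<phi> b] .
      have "(\<lambda>x. partial_deriv b \<phi> x *\<^sub>R b) \<in> L2 \<Omega>"
      proof (rule L2_compact_support[OF _ _ \<Omega>])
        show "continuous_on UNIV (\<lambda>x. partial_deriv b \<phi> x *\<^sub>R b)"
          using Ck_continuous[OF test_functionsD(1)[OF t]] by (intro continuous_intros)
        show "compact (support (\<lambda>x. partial_deriv b \<phi> x *\<^sub>R b))"
          using not_in_support[of _ "partial_deriv b \<phi>"]
          by (intro compact_support_mono[OF test_functionsD(2)[OF t]]) simp
      qed
      from L2_inner_integrable[OF gL this] show ?thesis by (simp add: mult.commute)
    qed
    have "(LINT x|lebesgue_on \<Omega>. g x \<bullet> grad \<phi> x) = (LINT x|lebesgue_on \<Omega>. (\<Sum>b\<in>Basis. (g x \<bullet> b) * partial_deriv b \<phi> x))"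
      by (simp add: grad_def inner_sum_right mult.commute)
    also have "\<dots> = (\<Sum>b\<in>Basis. LINT x|lebesgue_on \<Omega>. (g x \<bullet> b) * partial_deriv b \<phi> x)"
      using int by (intro Bochner_Integration.integral_sum) auto
    also have "\<dots> = (\<Sum>b\<in>Basis. - (LINT x|lebesgue_on \<Omega>. u x * partial_deriv b (partial_deriv b \<phi>) x))"
      using g test_functions_partial_deriv[OF \<phi>] by (intro sum.cong) (auto simp: weak_gradient_def)
    finally show ?thesis .
  qed
  show ?thesis using *[OF g(1)] *[OF g(2)] by simp
qed

text \<open>On an open set two weak gradients of the same function agree almost everywhere, but an inequality
  suffices and is more elementary: expand \<open>\<parallel>grad \<phi>\<^sub>k - g\<parallel>\<^sup>2 \<ge> 0\<close> and replace \<open>g\<close> by \<open>g'\<close> in the mixed term, which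
  does not distinguish them.\<close>

lemma limit_gradient_minimal:
  assumes g: "weak_gradient \<Omega> u g" "weak_gradient \<Omega> u g'" and \<phi>: "\<And>k. \<phi> k \<in> test_functions \<Omega>"
    and \<Omega>: "\<Omega> \<in> sets borel" and lim: "(\<lambda>k. L2_norm \<Omega> (\<lambda>x. grad (\<phi> k) x - g' x)) \<longlonglongrightarrow> 0"
  shows "(L2_norm \<Omega> g')\<^sup>2 \<le> (L2_norm \<Omega> g)\<^sup>2"
proof -
  have gL: "g \<in> L2 \<Omega>" "g' \<in> L2 \<Omega>" using g by (auto simp: weak_gradient_def)
  have "(L2_norm \<Omega> g')\<^sup>2 - (L2_norm \<Omega> (\<lambda>x. grad (\<phi> k) x - g' x))\<^sup>2 \<le> (L2_norm \<Omega> g)\<^sup>2" for k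
  proof -
    have pL: "grad (\<phi> k) \<in> L2 \<Omega>" using test_functions_L2[OF \<phi> \<Omega>] by simp
    note int = L2_integrable[OF gL(1)] L2_integrable[OF gL(2)] L2_integrable[OF pL]
      L2_integrable[OF L2_diff[OF pL gL(1)]] L2_integrable[OF L2_diff[OF pL gL(2)]]
      L2_inner_integrable[OF gL(1) pL] L2_inner_integrable[OF gL(2) pL]
    have id: "(L2_norm \<Omega> (\<lambda>x. grad (\<phi> k) x - h x))\<^sup>2
      = (L2_norm \<Omega> (grad (\<phi> k)))\<^sup>2 + (L2_norm \<Omega> h)\<^sup>2 - 2 * (LINT x|lebesgue_on \<Omega>. h x \<bullet> grad (\<phi> k) x)"
      if "h \<in> L2 \<Omega>" for h
    proof -
      have "(norm (grad (\<phi> k) x - h x))\<^sup>2 = (norm (grad (\<phi> k) x))\<^sup>2 + (norm (h x))\<^sup>2 - 2 * (h x \<bullet> grad (\<phi> k) x)" for x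
        by (simp add: power2_norm_eq_inner inner_diff_left inner_diff_right inner_commute)
      then show ?thesis
        unfolding L2_norm_sq using L2_integrable[OF that] L2_integrable[OF pL] L2_inner_integrable[OF that pL]
        by simp
    qed
    show ?thesis
      using id[OF gL(1)] id[OF gL(2)] weak_gradient_inner_grad_unique[OF g \<phi> \<Omega>, of k]
        zero_le_power2[of "L2_norm \<Omega> (\<lambda>x. grad (\<phi> k) x - g x)"] by linarith
  qed
  moreover have "(\<lambda>k. (L2_norm \<Omega> g')\<^sup>2 - (L2_norm \<Omega> (\<lambda>x. grad (\<phi> k) x - g' x))\<^sup>2) \<longlonglongrightarrow> (L2_norm \<Omega> g')\<^sup>2 - 0\<^sup>2"
    by (intro tendsto_intros lim)
  ultimately show ?thesis
    using LIMSEQ_le_const2 by fastforce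
qed

text \<open>The inequality for test functions passes to the limit in the definition of \<open>H\<^sup>1\<^sub>0\<close>. This bounds
  the energy of the limit gradient from below, and the one given is at least as large.\<close>

lemma slab_poincare:
  fixes \<Omega> :: "'a::euclidean_space set"
  assumes \<Omega>: "open \<Omega>" and e: "norm e = 1" and r: "r > 0"
    and slab: "\<And>x. x \<in> \<Omega> \<Longrightarrow> \<bar>(x - z) \<bullet> e\<bar> < r"
    and u: "u \<in> H10 \<Omega>" "weak_gradient \<Omega> u g"
  shows "(pi / (2 * r))\<^sup>2 * (L2_norm \<Omega> u)\<^sup>2 \<le> (L2_norm \<Omega> g)\<^sup>2"
proof -
  define \<kappa> where "\<kappa> = (pi / (2 * r))\<^sup>2"
  have \<kappa>: "\<kappa> \<ge> 0" by (simp add: \<kappa>_def)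
  have \<Omega>b: "\<Omega> \<in> sets borel" using \<Omega> by simp
  obtain g' \<phi> where g': "weak_gradient \<Omega> u g'" and \<phi>: "\<And>k. \<phi> k \<in> test_functions \<Omega>"
    and lim: "(\<lambda>k. L2_norm \<Omega> (\<lambda>x. \<phi> k x - u x)) \<longlonglongrightarrow> 0"
        "(\<lambda>k. L2_norm \<Omega> (\<lambda>x. grad (\<phi> k) x - g' x)) \<longlonglongrightarrow> 0"
    using u(1) unfolding H10_def by blast
  have L: "u \<in> L2 \<Omega>" "g' \<in> L2 \<Omega>" using g' by (auto simp: weak_gradient_def)
  have test: "\<kappa> * (L2_norm \<Omega> (\<phi> k))\<^sup>2 \<le> (L2_norm \<Omega> (grad (\<phi> k)))\<^sup>2" for k
  proof -
    note t = test_functionsD[OF \<phi>[of k]]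
    have d: "\<phi> k differentiable (at x)" for x
      using t(1)[of 1] by (simp add: differentiable_on_def)
    have out: "\<phi> k x = 0" "partial_deriv e (\<phi> k) x = 0" if "x \<notin> \<Omega>" for x
      using t(3) that not_in_support partial_deriv_eq_0_outside by blast+
    have c: "continuous_on UNIV (\<phi> k)" "continuous_on UNIV (partial_deriv e (\<phi> k))"
      using Ck_continuous[OF t(1)] continuous_partial_deriv[OF t(1)] .
    have "(L2_norm \<Omega> (\<phi> k))\<^sup>2 = (LINT x|lborel. (\<phi> k x)\<^sup>2)"
      unfolding L2_norm_sq real_norm_def power2_abs
      using c out \<Omega>b by (intro lebesgue_on_integral_eq_lborel borel_measurable_continuous_onI continuous_intros) auto
    then have "\<kappa> * (L2_norm \<Omega> (\<phi> k))\<^sup>2 \<le> (LINT x|lborel. (partial_deriv e (\<phi> k) x)\<^sup>2)"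
      using slab_poincare_smooth[OF t(1,2) e r, of z] slab t(3) by (auto simp: \<kappa>_def)
    also have "\<dots> = (LINT x|lebesgue_on \<Omega>. (partial_deriv e (\<phi> k) x)\<^sup>2)"
      using c out \<Omega>b by (intro lebesgue_on_integral_eq_lborel[symmetric] borel_measurable_continuous_onI continuous_intros) auto
    also have "\<dots> \<le> (L2_norm \<Omega> (grad (\<phi> k)))\<^sup>2"
      unfolding L2_norm_sq
    proof (rule integral_mono)
      have "partial_deriv e (\<phi> k) \<in> L2 \<Omega>"
        using t \<Omega>b c by (intro L2_compact_support compact_support_partial_deriv) auto
      then show "integrable (lebesgue_on \<Omega>) (\<lambda>x. (partial_deriv e (\<phi> k) x)\<^sup>2)"
        by (simp add: L2_def)
      show "integrable (lebesgue_on \<Omega>) (\<lambda>x. (norm (grad (\<phi> k) x))\<^sup>2)"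
        using test_functions_L2[OF \<phi> \<Omega>b] L2_integrable by blast
      show "(partial_deriv e (\<phi> k) x)\<^sup>2 \<le> (norm (grad (\<phi> k) x))\<^sup>2" for x
        unfolding grad_inner[OF d, symmetric]
        using Cauchy_Schwarz_ineq2[of "grad (\<phi> k) x" e] e by (intro power2_le_iff_abs_le[THEN iffD2]) auto
    qed
    finally show ?thesis .
  qed
  have "\<kappa> * (L2_norm \<Omega> u)\<^sup>2 \<le> (1 + \<epsilon>) * ((1 + \<epsilon>) * (L2_norm \<Omega> g')\<^sup>2)" if \<epsilon>: "\<epsilon> > 0" for \<epsilon>
  proof -
    define E1 where "E1 k = L2_norm \<Omega> (\<lambda>x. \<phi> k x - u x)" for k
    define E2 where "E2 k = L2_norm \<Omega> (\<lambda>x. grad (\<phi> k) x - g' x)" for k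
    have "\<kappa> * (L2_norm \<Omega> u)\<^sup>2 \<le> (1 + \<epsilon>) * ((1 + \<epsilon>) * (L2_norm \<Omega> g')\<^sup>2 + (1 + 1 / \<epsilon>) * (E2 k)\<^sup>2)
        + \<kappa> * (1 + 1 / \<epsilon>) * (E1 k)\<^sup>2" for k
    proof -
      have p: "\<phi> k \<in> L2 \<Omega>" "grad (\<phi> k) \<in> L2 \<Omega>" using test_functions_L2[OF \<phi> \<Omega>b] by auto
      have "\<kappa> * (L2_norm \<Omega> u)\<^sup>2 \<le> \<kappa> * ((1 + \<epsilon>) * (L2_norm \<Omega> (\<phi> k))\<^sup>2 + (1 + 1 / \<epsilon>) * (E1 k)\<^sup>2)"
        unfolding E1_def using L2_norm_sq_young[OF L(1) p(1) \<epsilon>] \<kappa> by (rule mult_left_mono)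
      also have "\<dots> = (1 + \<epsilon>) * (\<kappa> * (L2_norm \<Omega> (\<phi> k))\<^sup>2) + \<kappa> * (1 + 1 / \<epsilon>) * (E1 k)\<^sup>2"
        by (simp add: algebra_simps)
      also have "(1 + \<epsilon>) * (\<kappa> * (L2_norm \<Omega> (\<phi> k))\<^sup>2) \<le> (1 + \<epsilon>) * (L2_norm \<Omega> (grad (\<phi> k)))\<^sup>2"
        using test[of k] \<epsilon> by (intro mult_left_mono) auto
      also have "(L2_norm \<Omega> (grad (\<phi> k)))\<^sup>2 \<le> (1 + \<epsilon>) * (L2_norm \<Omega> g')\<^sup>2 + (1 + 1 / \<epsilon>) * (E2 k)\<^sup>2"
        using L2_norm_sq_young[OF p(2) L(2) \<epsilon>]
        unfolding E2_def L2_norm_sq by (simp add: norm_minus_commute)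
      finally show ?thesis using \<epsilon> by (simp add: mult_left_mono)
    qed
    moreover have "(\<lambda>k. (1 + \<epsilon>) * ((1 + \<epsilon>) * (L2_norm \<Omega> g')\<^sup>2 + (1 + 1 / \<epsilon>) * (E2 k)\<^sup>2)
        + \<kappa> * (1 + 1 / \<epsilon>) * (E1 k)\<^sup>2) \<longlonglongrightarrow> (1 + \<epsilon>) * ((1 + \<epsilon>) * (L2_norm \<Omega> g')\<^sup>2 + (1 + 1 / \<epsilon>) * 0\<^sup>2)
        + \<kappa> * (1 + 1 / \<epsilon>) * 0\<^sup>2"
      using lim unfolding E1_def E2_def by (intro tendsto_intros)
    ultimately show ?thesis
      using LIMSEQ_le_const by fastforce
  qed
  then have "\<kappa> * (L2_norm \<Omega> u)\<^sup>2 \<le> (1 + 1 / real (Suc n)) * ((1 + 1 / real (Suc n)) * (L2_norm \<Omega> g')\<^sup>2)" for n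
    by (simp del: of_nat_Suc)
  moreover have "(\<lambda>n. (1 + 1 / real (Suc n)) * ((1 + 1 / real (Suc n)) * (L2_norm \<Omega> g')\<^sup>2))
    \<longlonglongrightarrow> (1 + 0) * ((1 + 0) * (L2_norm \<Omega> g')\<^sup>2)"
    by (intro tendsto_intros LIMSEQ_Suc[OF lim_1_over_n])
  ultimately have "\<kappa> * (L2_norm \<Omega> u)\<^sup>2 \<le> (1 + 0) * ((1 + 0) * (L2_norm \<Omega> g')\<^sup>2)"
    by (intro LIMSEQ_le_const) auto
  also have "\<dots> \<le> (L2_norm \<Omega> g)\<^sup>2"
    using limit_gradient_minimal[OF u(2) g' \<phi> \<Omega>b lim(2)] by simp
  finally show ?thesis by (simp add: \<kappa>_def)
qed

lemma test_functions_H10: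
  assumes \<phi>: "\<phi> \<in> test_functions \<Omega>" and \<Omega>: "open \<Omega>"
  shows "\<phi> \<in> H10 \<Omega>"
proof -
  have "L2_norm \<Omega> (\<lambda>x. \<phi> x - \<phi> x) = 0" "L2_norm \<Omega> (\<lambda>x. grad \<phi> x - grad \<phi> x) = 0"
    by (simp_all add: L2_norm_def)
  then show ?thesis
    unfolding H10_def using weak_gradient_grad[OF \<phi> \<Omega>] \<phi>
    by (intro CollectI exI[of _ "grad \<phi>"] conjI exI[of _ "\<lambda>k. \<phi>"]) auto
qed

lemma lambda1_le_test_function:
  assumes \<phi>: "\<phi> \<in> test_functions \<Omega>" and \<Omega>: "open \<Omega>" and nz: "L2_norm \<Omega> \<phi> \<noteq> 0"
  shows "lambda1 \<Omega> \<le> (L2_norm \<Omega> (grad \<phi>))\<^sup>2 / (L2_norm \<Omega> \<phi>)\<^sup>2"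
  unfolding lambda1_def using weak_gradient_grad[OF \<phi> \<Omega>] test_functions_H10[OF \<phi> \<Omega>] nz
  by (intro cInf_lower bdd_belowI[of _ 0]) auto

section \<open>First eigenvalue of a set containing a box\<close>

text \<open>Near a point of \<open>U\<close> the function agrees with \<open>\<Phi>\<close>, and near a point outside \<open>K\<close> it vanishes; the
  two open sets cover the space. The same description holds for its partial derivatives.\<close>

lemma Ck_cut:
  assumes "open U" "closed K" "K \<subseteq> U" "\<And>k. Ck k \<Phi>" "\<And>x. x \<in> U - K \<Longrightarrow> \<Phi> x = 0"
  shows "Ck k (\<lambda>x. if x \<in> U then \<Phi> x else 0)"
  using assms(4,5)
proof (induction k arbitrary: \<Phi>)
  case 0
  have "continuous_on UNIV (\<lambda>x. if x \<in> U then \<Phi> x else 0)"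
  proof (rule continuous_on_glue_zero[OF assms(1-3)])
    have "continuous_on U \<Phi>"
      using Ck_continuous[OF 0(1)] continuous_on_subset by blast
    then show "continuous_on U (\<lambda>x. if x \<in> U then \<Phi> x else 0)"
      by (rule continuous_on_eq) simp
  qed (use 0(2) in auto)
  then show ?case by simp
next
  case (Suc k)
  have d: "\<Phi> differentiable (at x)" for x
    using Suc.prems(1)[of 1] by (simp add: differentiable_on_def)
  have zero: "partial_deriv w \<Phi> x = 0" if "x \<in> U - K" for w x
  proof -
    have "((\<lambda>x. 0) has_derivative (\<lambda>w. 0)) (at x)" by simp
    then have "(\<Phi> has_derivative (\<lambda>w. 0)) (at x)"
      by (rule has_derivative_transform_within_open[where s = "U - K"])
        (use that Suc.prems(2) assms in auto)
    then show ?thesis by (rule partial_deriv_eq)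
  qed
  show ?case
  proof (rule Ck_SucI)
    show "((\<lambda>x. if x \<in> U then \<Phi> x else 0) has_derivative (\<lambda>w. if x \<in> U then partial_deriv w \<Phi> x else 0)) (at x)" for x
    proof (cases "x \<in> U")
      case True
      then have "((\<lambda>x. if x \<in> U then \<Phi> x else 0) has_derivative (\<lambda>w. partial_deriv w \<Phi> x)) (at x)"
        using assms(1) by (intro has_derivative_transform_within_open[OF has_derivative_partial_deriv[OF d]]) auto
      then show ?thesis using True by simp
    next
      case False
      have "((\<lambda>x. 0) has_derivative (\<lambda>w. 0)) (at x)" by simp
      then have "((\<lambda>x. if x \<in> U then \<Phi> x else 0) has_derivative (\<lambda>w. 0)) (at x)"
        by (rule has_derivative_transform_within_open[where s = "- K"])
          (use False Suc.prems(2) assms in auto)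
      then show ?thesis using False by simp
    qed
    show "Ck k (\<lambda>x. if x \<in> U then partial_deriv b \<Phi> x else 0)" if "b \<in> Basis" for b
      using Suc.prems(1) that zero by (intro Suc.IH) (metis Ck.simps(2))+
  qed
qed

lemma partial_deriv_line_invariant:
  fixes f :: "'a::euclidean_space \<Rightarrow> real"
  assumes "Ck 1 f" "\<And>x s. f (x + s *\<^sub>R v) = f x"
  shows "partial_deriv v f x = 0"
  using DERIV_unique[OF DERIV_along_line[OF assms(1), of x v 0], unfolded assms(2), OF DERIV_const]
  by simp

text \<open>A smooth version of \<open>max 0 (s - \<epsilon>)\<close>. Since \<open>exp (-w) (1 + w) \<le> 1\<close>, it does not
  increase distances, and composition with it does not increase Dirichlet energies.\<close>

definition soft_threshold :: "real \<Rightarrow> real \<Rightarrow> real" where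
  "soft_threshold \<epsilon> s = (s - \<epsilon>) * flat_exp \<epsilon> 0 (s - \<epsilon>)"

lemma soft_threshold_eq_0: "s \<le> \<epsilon> \<Longrightarrow> soft_threshold \<epsilon> s = 0"
  by (simp add: soft_threshold_def flat_exp_def)

text \<open>From \<open>exp (-w) \<ge> 1 - w\<close> the function is at least \<open>s - 2\<epsilon>\<close>.\<close>

lemma soft_threshold_sq_ge:
  assumes "\<epsilon> > 0" "s \<ge> 0"
  shows "s\<^sup>2 - 4 * \<epsilon> * s \<le> (soft_threshold \<epsilon> s)\<^sup>2"
proof (cases "s \<le> 2 * \<epsilon>")
  case True
  then have "s * (s - 4 * \<epsilon>) \<le> 0"
    using assms by (intro mult_nonneg_nonpos) auto
  then show ?thesis
    using zero_le_square[of "soft_threshold \<epsilon> s"] unfolding power2_eq_square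
    by (simp only: right_diff_distrib mult_ac)
next
  case False
  then have t: "s - \<epsilon> > 0" using assms by simp
  have "1 - \<epsilon> / (s - \<epsilon>) \<le> exp (- \<epsilon> / (s - \<epsilon>))"
    using exp_ge_add_one_self[of "- \<epsilon> / (s - \<epsilon>)"] by simp
  then have "(s - \<epsilon>) * (1 - \<epsilon> / (s - \<epsilon>)) \<le> soft_threshold \<epsilon> s"
    using t by (simp add: soft_threshold_def flat_exp_def)
  moreover have "(s - \<epsilon>) * (1 - \<epsilon> / (s - \<epsilon>)) = s - 2 * \<epsilon>"
    using t by (simp add: field_simps)
  ultimately have "(s - 2 * \<epsilon>)\<^sup>2 \<le> (soft_threshold \<epsilon> s)\<^sup>2"
    using False by (intro power_mono) auto
  moreover have "s\<^sup>2 - 4 * \<epsilon> * s \<le> (s - 2 * \<epsilon>)\<^sup>2"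
    by (simp add: power2_eq_square algebra_simps)
  ultimately show ?thesis by linarith
qed

lemma DERIV_soft_threshold:
  assumes "\<epsilon> > 0"
  obtains D where "\<bar>D\<bar> \<le> 1" "(soft_threshold \<epsilon> has_real_derivative D) (at s)"
proof -
  let ?t = "s - \<epsilon>"
  let ?D = "flat_exp \<epsilon> 0 ?t + ?t * (\<epsilon> * flat_exp \<epsilon> 2 ?t)"
  have "((\<lambda>s. flat_exp \<epsilon> 0 (s - \<epsilon>)) has_real_derivative \<epsilon> * flat_exp \<epsilon> 2 ?t) (at s)"
  proof -
    have shift: "((\<lambda>s. s - \<epsilon>) has_real_derivative 1) (at s)"
      by (auto intro!: derivative_eq_intros)
    have "(flat_exp \<epsilon> 0 has_real_derivative \<epsilon> * flat_exp \<epsilon> 2 ?t) (at ?t)"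
      using DERIV_flat_exp[OF assms, of 0 ?t] by (simp add: numeral_2_eq_2)
    from DERIV_chain2[where f = "flat_exp \<epsilon> 0" and g = "\<lambda>s. s - \<epsilon>", OF this shift]
    show ?thesis by simp
  qed
  then have "(soft_threshold \<epsilon> has_real_derivative ?D) (at s)"
    unfolding soft_threshold_def[abs_def] by (auto intro!: derivative_eq_intros)
  moreover have "\<bar>?D\<bar> \<le> 1"
  proof (cases "?t > 0")
    case True
    define w where "w = \<epsilon> / ?t"
    have w: "w \<ge> 0" using True assms by (simp add: w_def)
    have D: "?D = exp (- w) * (1 + w)"
    proof -
      define t where "t = ?t"
      have "t > 0" using True by (simp add: t_def)
      then have "flat_exp \<epsilon> 0 t + t * (\<epsilon> * flat_exp \<epsilon> 2 t) = exp (- (\<epsilon> / t)) * (1 + \<epsilon> / t)"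
        by (simp add: flat_exp_def power2_eq_square field_simps)
      then show ?thesis by (simp add: t_def w_def)
    qed
    also have "\<dots> \<le> exp (- w) * exp w"
      by (intro mult_left_mono exp_ge_add_one_self) simp
    also have "\<dots> = 1" by (simp add: exp_minus)
    finally have "?D \<le> 1" .
    moreover have "?D \<ge> 0" unfolding D using w by simp
    ultimately show ?thesis by linarith
  qed (simp add: flat_exp_def)
  ultimately show ?thesis using that by blast
qed

lemma Ck_soft_threshold:
  assumes "\<epsilon> > 0" "Ck k f" shows "Ck k (\<lambda>x. soft_threshold \<epsilon> (f x))"
proof -
  have "Ck k (\<lambda>x. f x + - \<epsilon>)" using assms(2) by (intro Ck_add Ck_const)
  then have "Ck k (\<lambda>x. f x - \<epsilon>)" by simp
  then show ?thesis
    unfolding soft_threshold_def by (intro Ck_mult Ck_flat_exp assms(1))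
qed

context orthonormal_box
begin

definition angle :: "'i \<Rightarrow> 'a \<Rightarrow> real" where
  "angle i x = pi * ((x - z) \<bullet> \<nu> i) / (2 * a i)"

text \<open>The product of the cosines is the first Dirichlet eigenfunction of the open box.\<close>

definition ground :: "'a \<Rightarrow> real" where
  "ground x = (\<Prod>i\<in>I. cos (angle i x))"

definition cofactor :: "'i \<Rightarrow> 'a \<Rightarrow> real" where
  "cofactor i x = (\<Prod>j\<in>I - {i}. cos (angle j x))"

lemma Ck_angle: "Ck k (angle i)"
proof -
  have "Ck k (\<lambda>x. (pi / (2 * a i)) * ((x - z) \<bullet> \<nu> i))"
    by (intro Ck_mult Ck_const Ck_inner)
  then show ?thesis by (simp add: angle_def[abs_def])
qed

lemma Ck_ground: "Ck k ground" and Ck_cofactor: "Ck k (cofactor i)"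
proof -
  have "Ck k (\<lambda>x. cos (angle i x))" for i using Ck_cos[OF Ck_angle, of k i 0] by simp
  then show "Ck k ground" "Ck k (cofactor i)"
    unfolding ground_def[abs_def] cofactor_def[abs_def] by (auto intro: Ck_prod)
qed

lemma ground_eq: "i \<in> I \<Longrightarrow> ground x = cos (angle i x) * cofactor i x"
  unfolding ground_def cofactor_def using fin by (simp add: prod.remove)

lemma abs_prod_cos_le: "\<bar>\<Prod>i\<in>J. cos (angle i x)\<bar> \<le> 1"
  unfolding abs_prod by (rule prod_le_1) auto

lemma cofactor_invariant:
  assumes "i \<in> I" shows "cofactor i (x + s *\<^sub>R \<nu> i) = cofactor i x"
proof -
  have "angle j (x + s *\<^sub>R \<nu> i) = angle j x" if "j \<in> I - {i}" for j
    using that assms by (auto simp: angle_def inner_diff_left inner_add_left ortho)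
  then show ?thesis by (simp add: cofactor_def)
qed

lemma partial_deriv_ground:
  assumes i: "i \<in> I"
  shows "partial_deriv (\<nu> i) ground x = - (pi / (2 * a i)) * sin (angle i x) * cofactor i x"
proof -
  have d: "cofactor i differentiable (at x)"
    using Ck_cofactor[of 1 i] by (simp add: differentiable_on_def)
  have eq: "angle i = (\<lambda>x. (pi / (2 * a i)) * ((x - z) \<bullet> \<nu> i))"
    by (simp add: fun_eq_iff angle_def)
  have "(angle i has_derivative (\<lambda>w. (pi / (2 * a i)) * (w \<bullet> \<nu> i))) (at x)"
    unfolding eq by (intro has_derivative_mult_right) (auto intro!: derivative_eq_intros)
  from has_derivative_cos[OF this]
  have c: "((\<lambda>x. cos (angle i x)) has_derivative (\<lambda>w. (pi / (2 * a i)) * (w \<bullet> \<nu> i) * - sin (angle i x))) (at x)"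
    by simp
  have "(ground has_derivative (\<lambda>w. cos (angle i x) * partial_deriv w (cofactor i) x
      + ((pi / (2 * a i)) * (w \<bullet> \<nu> i) * - sin (angle i x)) * cofactor i x)) (at x)"
    unfolding ground_eq[OF i, abs_def] by (rule has_derivative_mult[OF c has_derivative_partial_deriv[OF d]])
  then have "partial_deriv (\<nu> i) ground x = cos (angle i x) * partial_deriv (\<nu> i) (cofactor i) x
      + ((pi / (2 * a i)) * (\<nu> i \<bullet> \<nu> i) * - sin (angle i x)) * cofactor i x"
    by (rule partial_deriv_eq)
  moreover have "partial_deriv (\<nu> i) (cofactor i) x = 0"
    using Ck_cofactor cofactor_invariant[OF i] by (rule partial_deriv_line_invariant)
  ultimately show ?thesis using ortho[OF i i] by simp
qed

lemma cos_angle_nonneg: 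
  assumes "i \<in> I" "\<bar>(x - z) \<bullet> \<nu> i\<bar> \<le> a i" shows "cos (angle i x) \<ge> 0"
proof -
  have "\<bar>angle i x\<bar> = pi * \<bar>(x - z) \<bullet> \<nu> i\<bar> / (2 * a i)"
    using pos[OF assms(1)] by (simp add: angle_def abs_mult)
  also have "\<dots> \<le> pi * a i / (2 * a i)"
    using assms pos[OF assms(1)] by (intro divide_right_mono mult_left_mono) auto
  also have "\<dots> = pi / 2" using pos[OF assms(1)] by simp
  finally show ?thesis by (intro cos_ge_zero) auto
qed

lemma ground_nonneg: "x \<in> box \<Longrightarrow> ground x \<ge> 0"
  unfolding ground_def by (intro prod_nonneg cos_angle_nonneg) (auto simp: box_def abs_le_iff intro: less_imp_le)

lemma ground_boundary: 
  assumes "i \<in> I" "\<bar>(x - z) \<bullet> \<nu> i\<bar> = a i" shows "ground x = 0"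
proof -
  have "angle i x = pi / 2 \<or> angle i x = - (pi / 2)"
  proof -
    have "(x - z) \<bullet> \<nu> i = a i \<or> (x - z) \<bullet> \<nu> i = - a i"
      using assms(2) by linarith
    then show ?thesis using pos[OF assms(1)] by (auto simp: angle_def)
  qed
  then have "cos (angle i x) = 0" by (metis cos_pi_half cos_minus)
  then show ?thesis using ground_eq[OF assms(1)] by simp
qed

text \<open>In each direction the energy density is that of the eigenfunction with one squared cosine replaced by a
  squared sine, up to the factor \<open>(\<pi>/2a\<^sub>i)\<^sup>2\<close>.\<close>

lemma ground_dirichlet:
  "(\<Sum>i\<in>I. LINT x|lborel. indicator box x * (partial_deriv (\<nu> i) ground x)\<^sup>2)
    = (\<Sum>i\<in>I. (pi / (2 * a i))\<^sup>2) * (LINT x|lborel. indicator box x * (ground x)\<^sup>2)"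
  unfolding sum_distrib_right
proof (rule sum.cong[OF refl])
  fix i assume i: "i \<in> I"
  have "(LINT x|lborel. indicator box x * (partial_deriv (\<nu> i) ground x)\<^sup>2)
    = (pi / (2 * a i))\<^sup>2 * (LINT x|lborel. indicator box x * ((cofactor i x)\<^sup>2 * (sin (angle i x))\<^sup>2))"
    unfolding partial_deriv_ground[OF i] power_mult_distrib
    by (simp add: mult_ac flip: Bochner_Integration.integral_mult_right_zero)
  also have "(LINT x|lborel. indicator box x * ((cofactor i x)\<^sup>2 * (sin (angle i x))\<^sup>2))
    = (LINT x|lborel. indicator box x * ((cofactor i x)\<^sup>2 * (cos (angle i x))\<^sup>2))"
    unfolding box_eq_prism[OF i] angle_def
  proof (rule prism_sin_cos_swap[OF walls_invariant[OF i] norm_dir[OF i] walls_borel _ pos[OF i], where M = 1])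
    show "bounded (prism (walls i) (\<nu> i) z (- a i) (a i))"
      using bounded_box box_eq_prism[OF i] by simp
    show "(\<lambda>x. (cofactor i x)\<^sup>2) \<in> borel_measurable borel"
      using Ck_continuous[OF Ck_cofactor] by (intro borel_measurable_continuous_onI continuous_intros)
    show "\<bar>(cofactor i x)\<^sup>2\<bar> \<le> 1" for x
      using abs_prod_cos_le[where J = "I - {i}" and x = x] by (simp add: cofactor_def abs_square_le_1)
    show "(cofactor i (x + s *\<^sub>R \<nu> i))\<^sup>2 = (cofactor i x)\<^sup>2" for x s
      using cofactor_invariant[OF i] by simp
  qed
  also have "\<dots> = (LINT x|lborel. indicator box x * (ground x)\<^sup>2)"
    by (simp add: ground_eq[OF i] power_mult_distrib mult.commute)
  finally show "(LINT x|lborel. indicator box x * (partial_deriv (\<nu> i) ground x)\<^sup>2)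
    = (pi / (2 * a i))\<^sup>2 * (LINT x|lborel. indicator box x * (ground x)\<^sup>2)" .
qed

lemma integrable_box:
  "continuous_on UNIV f \<Longrightarrow> (\<And>x. x \<in> box \<Longrightarrow> \<bar>f x\<bar> \<le> M) \<Longrightarrow> integrable lborel (\<lambda>x. indicator box x * f x)"
  for f :: "'a \<Rightarrow> real"
  by (intro integrable_indicator_bounded[OF bounded_box box_borel]) (auto intro: borel_measurable_continuous_onI)

text \<open>Extended by 0, the eigenfunction is only Lipschitz across the boundary of the box. Where it is below \<open>\<epsilon>\<close> the
  threshold cuts it to 0, which leaves a smooth function supported in the compact set \<open>core \<epsilon>\<close>.\<close>

definition trial :: "real \<Rightarrow> 'a \<Rightarrow> real" where
  "trial \<epsilon> x = (if x \<in> open_box then soft_threshold \<epsilon> (ground x) else 0)"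

definition core :: "real \<Rightarrow> 'a set" where
  "core \<epsilon> = {x. (\<forall>i\<in>I. \<bar>(x - z) \<bullet> \<nu> i\<bar> \<le> a i) \<and> ground x \<ge> \<epsilon>}"

lemma core_subset: "\<epsilon> > 0 \<Longrightarrow> core \<epsilon> \<subseteq> open_box"
  unfolding core_def open_box_def using ground_boundary by (force simp: less_le)

lemma closed_core: "closed (core \<epsilon>)"
proof -
  have "core \<epsilon> = (\<Inter>i\<in>I. {x. \<bar>(x - z) \<bullet> \<nu> i\<bar> \<le> a i}) \<inter> {x. \<epsilon> \<le> ground x}"
    by (auto simp: core_def)
  then show ?thesis
    using Ck_continuous[OF Ck_ground]
    by (auto intro!: closed_Int closed_INT closed_Collect_le continuous_intros)
qed

lemma trial_outside_core:
  assumes "\<epsilon> > 0" "x \<notin> core \<epsilon>" shows "trial \<epsilon> x = 0"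
proof (cases "x \<in> open_box")
  case True
  then have "ground x < \<epsilon>" using assms(2) by (auto simp: core_def open_box_def intro: less_imp_le)
  then show ?thesis by (simp add: trial_def soft_threshold_eq_0)
qed (simp add: trial_def)

lemma trial_test_function:
  assumes "\<epsilon> > 0" "box \<subseteq> \<Omega>" shows "trial \<epsilon> \<in> test_functions \<Omega>"
proof -
  have "Ck k (trial \<epsilon>)" for k
    unfolding trial_def[abs_def]
  proof (rule Ck_cut[OF open_open_box closed_core core_subset[OF assms(1)]])
    show "Ck k (\<lambda>x. soft_threshold \<epsilon> (ground x))" for k
      using Ck_soft_threshold[OF assms(1) Ck_ground] .
    show "soft_threshold \<epsilon> (ground x) = 0" if "x \<in> open_box - core \<epsilon>" for x
      using trial_outside_core[OF assms(1), of x] that by (simp add: trial_def)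
  qed
  moreover have s: "support (trial \<epsilon>) \<subseteq> core \<epsilon>"
    using trial_outside_core[OF assms(1)] by (intro support_subset_closed closed_core) blast
  moreover have "compact (support (trial \<epsilon>))"
    using s core_subset[OF assms(1)] open_box_subset bounded_box closed_support
    by (meson bounded_subset compact_eq_bounded_closed order_trans)
  ultimately show ?thesis
    using core_subset[OF assms(1)] open_box_subset assms(2) by (auto simp: test_functions_def)
qed

lemma trial_grad_le:
  assumes "\<epsilon> > 0"
  shows "(norm (grad (trial \<epsilon>) x))\<^sup>2 \<le> indicator box x * (\<Sum>i\<in>I. (partial_deriv (\<nu> i) ground x)\<^sup>2)"
proof -
  have d: "trial \<epsilon> differentiable (at x)"
    using test_functionsD(1)[OF trial_test_function[OF assms subset_refl], of 1] by (simp add: differentiable_on_def)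
  have sq: "(norm (grad (trial \<epsilon>) x))\<^sup>2 = (\<Sum>i\<in>I. (partial_deriv (\<nu> i) (trial \<epsilon>) x)\<^sup>2)"
    unfolding power2_norm_eq_inner
    by (subst inner_frame) (simp add: grad_inner[OF d] power2_eq_square)
  show ?thesis
  proof (cases "x \<in> open_box")
    case True
    obtain D where D: "\<bar>D\<bar> \<le> 1" "(soft_threshold \<epsilon> has_real_derivative D) (at (ground x))"
      using DERIV_soft_threshold[OF assms] .
    have dg: "ground differentiable (at x)"
      using Ck_ground[of 1] by (simp add: differentiable_on_def)
    have "((\<lambda>x. soft_threshold \<epsilon> (ground x)) has_derivative (\<lambda>w. D * partial_deriv w ground x)) (at x)"
      by (rule has_derivative_compose_real[OF dg D(2)])
    then have "(trial \<epsilon> has_derivative (\<lambda>w. D * partial_deriv w ground x)) (at x)"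
      by (rule has_derivative_transform_within_open[OF _ open_open_box True]) (simp add: trial_def)
    then have "partial_deriv w (trial \<epsilon>) x = D * partial_deriv w ground x" for w
      by (rule partial_deriv_eq)
    moreover have "D\<^sup>2 * b\<^sup>2 \<le> b\<^sup>2" for b
      using D(1) by (simp add: mult_left_le_one_le abs_square_le_1)
    ultimately show ?thesis
      unfolding sq using subsetD[OF open_box_subset True] by (auto simp: power_mult_distrib intro!: sum_mono)
  next
    case False
    then have "x \<notin> support (trial \<epsilon>)"
      using core_subset[OF assms] support_subset_closed[OF closed_core, of "trial \<epsilon>" \<epsilon>] trial_outside_core[OF assms]
      by blast
    then show ?thesis
      unfolding sq by (simp add: partial_deriv_eq_0_outside sum_nonneg)
  qed
qed

definition ground_mass :: real where
  "ground_mass = (LINT x|lborel. indicator box x * (ground x)\<^sup>2)"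

definition ground_mean :: real where
  "ground_mean = (LINT x|lborel. indicator box x * ground x)"

lemma continuous_ground: "continuous_on UNIV ground"
  using Ck_continuous[OF Ck_ground] .

lemma abs_ground_le: "\<bar>ground x\<bar> \<le> 1"
  unfolding ground_def by (rule abs_prod_cos_le)

lemma integrable_ground_sq: "integrable lborel (\<lambda>x. indicator box x * (ground x)\<^sup>2)"
  using abs_ground_le by (intro integrable_box[where M = 1] continuous_intros continuous_ground) (simp add: abs_square_le_1)

lemma integrable_ground: "integrable lborel (\<lambda>x. indicator box x * ground x)"
  using abs_ground_le by (intro integrable_box[where M = 1] continuous_ground)

lemma trial_mass_ge:
  assumes \<epsilon>: "\<epsilon> > 0" and \<Omega>: "open \<Omega>" "box \<subseteq> \<Omega>"
  shows "ground_mass - 4 * \<epsilon> * ground_mean \<le> (L2_norm \<Omega> (trial \<epsilon>))\<^sup>2"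
proof -
  note t = test_functionsD[OF trial_test_function[OF \<epsilon> \<Omega>(2)]]
  have ct: "continuous_on UNIV (trial \<epsilon>)" using Ck_continuous[OF t(1)] .
  have "ground_mass - 4 * \<epsilon> * ground_mean = (LINT x|lborel. indicator box x * (ground x)\<^sup>2 - 4 * \<epsilon> * (indicator box x * ground x))"
    unfolding ground_mass_def ground_mean_def using integrable_ground_sq integrable_ground by simp
  also have "\<dots> \<le> (LINT x|lborel. (trial \<epsilon> x)\<^sup>2)"
  proof (rule integral_mono)
    show "integrable lborel (\<lambda>x. (trial \<epsilon> x)\<^sup>2)"
      using integrable_norm_sq[OF ct t(2)] by simp
    show "indicator box x * (ground x)\<^sup>2 - 4 * \<epsilon> * (indicator box x * ground x) \<le> (trial \<epsilon> x)\<^sup>2" for x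
    proof (cases "x \<in> open_box")
      case True
      then have "ground x \<ge> 0" using ground_nonneg open_box_subset by blast
      from soft_threshold_sq_ge[OF \<epsilon> this] show ?thesis
        using True open_box_subset by (auto simp: trial_def indicator_def)
    next
      case False
      have "ground x = 0" if "x \<in> box"
      proof -
        obtain i where i: "i \<in> I" "\<not> \<bar>(x - z) \<bullet> \<nu> i\<bar> < a i"
          using False by (auto simp: open_box_def)
        then have "\<bar>(x - z) \<bullet> \<nu> i\<bar> = a i" using that by (auto simp: box_def abs_if not_less split: if_splits)
        then show ?thesis using ground_boundary[OF i(1)] by simp
      qed
      then show ?thesis by (auto simp: indicator_def)
    qed
  qed (use integrable_ground_sq integrable_ground in auto)
  also have "\<dots> = (L2_norm \<Omega> (trial \<epsilon>))\<^sup>2"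
    unfolding L2_norm_sq real_norm_def power2_abs
    using ct t(3) borel_open[OF \<Omega>(1)] not_in_support[of _ "trial \<epsilon>"]
    by (intro lebesgue_on_integral_eq_lborel[symmetric] borel_measurable_continuous_onI continuous_intros) auto
  finally show ?thesis .
qed

text \<open>The threshold does not increase the energy of the eigenfunction.\<close>

lemma trial_energy_le:
  assumes \<epsilon>: "\<epsilon> > 0" and \<Omega>: "open \<Omega>" "box \<subseteq> \<Omega>"
  shows "(L2_norm \<Omega> (grad (trial \<epsilon>)))\<^sup>2 \<le> (\<Sum>i\<in>I. (pi / (2 * a i))\<^sup>2) * ground_mass"
proof -
  note tf = trial_test_function[OF \<epsilon> \<Omega>(2)]
  note t = test_functionsD[OF tf]
  have cgr: "continuous_on UNIV (grad (trial \<epsilon>))" using continuous_grad[OF t(1)] .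
  have ip: "integrable lborel (\<lambda>x. indicator box x * (partial_deriv (\<nu> i) ground x)\<^sup>2)" if i: "i \<in> I" for i
  proof (rule integrable_box[where M = "(pi / (2 * a i))\<^sup>2"])
    show "continuous_on UNIV (\<lambda>x. (partial_deriv (\<nu> i) ground x)\<^sup>2)"
      by (intro continuous_intros continuous_partial_deriv Ck_ground)
    fix x
    have "\<bar>cofactor i x\<bar> \<le> 1" unfolding cofactor_def by (rule abs_prod_cos_le)
    then have "\<bar>sin (angle i x)\<bar> * \<bar>cofactor i x\<bar> \<le> 1" by (intro mult_le_one) auto
    then have "(sin (angle i x) * cofactor i x)\<^sup>2 \<le> 1" by (simp add: abs_square_le_1 abs_mult)
    then have "(pi / (2 * a i))\<^sup>2 * (sin (angle i x) * cofactor i x)\<^sup>2 \<le> (pi / (2 * a i))\<^sup>2"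
      by (simp add: mult_left_le)
    then show "\<bar>(partial_deriv (\<nu> i) ground x)\<^sup>2\<bar> \<le> (pi / (2 * a i))\<^sup>2"
      unfolding partial_deriv_ground[OF i] abs_power2 mult_minus_left power2_minus
      by (simp only: power_mult_distrib mult.assoc)
  qed
  have ig: "integrable lborel (\<lambda>x. (norm (grad (trial \<epsilon>) x))\<^sup>2)"
    by (rule integrable_norm_sq[OF cgr compact_support_grad[OF t(2)]])
  have out: "grad (trial \<epsilon>) x = 0" if "x \<notin> \<Omega>" for x
    using that t(3) support_grad[of "trial \<epsilon>"] not_in_support[of x "grad (trial \<epsilon>)"] by blast
  have "(L2_norm \<Omega> (grad (trial \<epsilon>)))\<^sup>2 = (LINT x|lborel. (norm (grad (trial \<epsilon>) x))\<^sup>2)"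
    unfolding L2_norm_sq using cgr out borel_open[OF \<Omega>(1)]
    by (intro lebesgue_on_integral_eq_lborel borel_measurable_continuous_onI continuous_intros) auto
  also have "\<dots> \<le> (LINT x|lborel. (\<Sum>i\<in>I. indicator box x * (partial_deriv (\<nu> i) ground x)\<^sup>2))"
    using ig ip trial_grad_le[OF \<epsilon>] by (intro integral_mono) (auto simp: sum_distrib_left)
  also have "\<dots> = (\<Sum>i\<in>I. (pi / (2 * a i))\<^sup>2) * ground_mass"
    unfolding ground_mass_def ground_dirichlet[symmetric] using ip by (intro Bochner_Integration.integral_sum)
  finally show ?thesis .
qed

text \<open>The eigenfunction is continuous and equal to 1 at the centre of the box.\<close>

lemma ground_mass_pos: "ground_mass > 0"
proof -
  have "ground_mass \<noteq> 0"
  proof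
    assume "ground_mass = 0"
    define N where "N = {x \<in> open_box. ground x > 0}"
    have "N = open_box \<inter> {x. 0 < ground x}" by (auto simp: N_def)
    then have oN: "open N"
      using open_open_box continuous_ground by (auto intro!: open_Int open_Collect_less continuous_intros)
    have "AE x in lborel. indicator box x * (ground x)\<^sup>2 = 0"
      using integral_nonneg_eq_0_iff_AE[OF integrable_ground_sq] \<open>ground_mass = 0\<close> by (simp add: ground_mass_def)
    then have "AE x in lborel. x \<notin> N"
      by (rule AE_mp) (use open_box_subset in \<open>auto simp: N_def indicator_def\<close>)
    then have "N \<in> null_sets lborel"
      using AE_iff_null_sets[of N lborel] oN by auto
    then have "negligible N"
      by (simp add: negligible_iff_null_sets null_sets_completionI)
    moreover have "z \<in> N"
      using center_open_box by (simp add: N_def ground_def angle_def)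
    ultimately show False
      using open_not_negligible[OF oN] by blast
  qed
  moreover have "ground_mass \<ge> 0" unfolding ground_mass_def by (intro integral_nonneg_AE) auto
  ultimately show ?thesis by simp
qed

lemma eventually_trial_mass_pos:
  "\<forall>\<^sub>F n in sequentially. ground_mass - 4 * (1 / real (Suc n)) * ground_mean > 0"
proof -
  have lim: "(\<lambda>n. ground_mass - 4 * (1 / real (Suc n)) * ground_mean) \<longlonglongrightarrow> ground_mass - 4 * 0 * ground_mean"
    by (intro tendsto_intros LIMSEQ_Suc[OF lim_1_over_n])
  then show "\<forall>\<^sub>F n in sequentially. ground_mass - 4 * (1 / real (Suc n)) * ground_mean > 0"
    using ground_mass_pos by (intro order_tendstoD(1)) auto
qed

text \<open>The Rayleigh quotient of the trial functions is at most that of the eigenfunction, up to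
  an error in the mass that vanishes with \<open>\<epsilon>\<close>.\<close>

lemma lambda1_le_box:
  assumes \<Omega>: "open \<Omega>" "box \<subseteq> \<Omega>"
  shows "lambda1 \<Omega> \<le> (\<Sum>i\<in>I. (pi / (2 * a i))\<^sup>2)"
proof -
  define S where "S = (\<Sum>i\<in>I. (pi / (2 * a i))\<^sup>2)"
  have le: "lambda1 \<Omega> * (ground_mass - 4 * \<epsilon> * ground_mean) \<le> S * ground_mass" if \<epsilon>: "\<epsilon> > 0" and n: "ground_mass - 4 * \<epsilon> * ground_mean > 0" for \<epsilon>
  proof (cases "lambda1 \<Omega> \<le> 0")
    case True
    then have "lambda1 \<Omega> * (ground_mass - 4 * \<epsilon> * ground_mean) \<le> 0"
      using n by (intro mult_nonpos_nonneg) auto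
    also have "0 \<le> S * ground_mass"
      using ground_mass_pos unfolding S_def by (intro mult_nonneg_nonneg sum_nonneg) auto
    finally show ?thesis .
  next
    case False
    let ?m = "(L2_norm \<Omega> (trial \<epsilon>))\<^sup>2"
    have m: "?m > 0" using trial_mass_ge[OF \<epsilon> \<Omega>] n by linarith
    have "lambda1 \<Omega> \<le> (L2_norm \<Omega> (grad (trial \<epsilon>)))\<^sup>2 / ?m"
      using m by (intro lambda1_le_test_function[OF trial_test_function[OF \<epsilon> \<Omega>(2)] \<Omega>(1)]) auto
    then have "lambda1 \<Omega> * ?m \<le> (L2_norm \<Omega> (grad (trial \<epsilon>)))\<^sup>2"
      using m by (simp add: pos_le_divide_eq)
    moreover have "lambda1 \<Omega> * (ground_mass - 4 * \<epsilon> * ground_mean) \<le> lambda1 \<Omega> * ?m"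
      using False trial_mass_ge[OF \<epsilon> \<Omega>] by (intro mult_left_mono) auto
    ultimately show ?thesis using trial_energy_le[OF \<epsilon> \<Omega>, folded S_def] by linarith
  qed
  have lim: "(\<lambda>n. ground_mass - 4 * (1 / real (Suc n)) * ground_mean) \<longlonglongrightarrow> ground_mass - 4 * 0 * ground_mean"
    by (intro tendsto_intros LIMSEQ_Suc[OF lim_1_over_n])
  have "\<forall>\<^sub>F n in sequentially. lambda1 \<Omega> * (ground_mass - 4 * (1 / real (Suc n)) * ground_mean) \<le> S * ground_mass"
    using eventually_trial_mass_pos by (rule eventually_mono) (intro le, auto)
  then have "lambda1 \<Omega> * (ground_mass - 4 * 0 * ground_mean) \<le> S * ground_mass"
    by (rule tendsto_upperbound[OF tendsto_mult[OF tendsto_const lim]]) simp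
  then show ?thesis
    using ground_mass_pos by (simp add: S_def)
qed

lemma exists_nonzero_test_function:
  assumes \<Omega>: "open \<Omega>" "box \<subseteq> \<Omega>"
  obtains \<phi> where "\<phi> \<in> test_functions \<Omega>" "L2_norm \<Omega> \<phi> \<noteq> 0"
proof -
  obtain n :: nat where n: "ground_mass - 4 * (1 / real (Suc n)) * ground_mean > 0"
    using eventually_happens[OF eventually_trial_mass_pos] by auto
  have e: "1 / real (Suc n) > 0" by simp
  from trial_mass_ge[OF e \<Omega>] n have "L2_norm \<Omega> (trial (1 / real (Suc n))) \<noteq> 0"
    by (auto simp del: of_nat_Suc)
  then show ?thesis using that trial_test_function[OF e \<Omega>(2)] by blast
qed

end

lemma lambda1_bounds:
  assumes \<Omega>: "open \<Omega>" and v: "norm v = 1" and r: "r > 0"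
    and slab: "\<And>x. x \<in> \<Omega> \<Longrightarrow> \<bar>(x - z) \<bullet> v\<bar> < r"
    and box: "orthonormal_box I \<nu> a" "orthonormal_box.box I \<nu> y a \<subseteq> \<Omega>"
  shows "(pi / (2 * r))\<^sup>2 \<le> lambda1 \<Omega>" "lambda1 \<Omega> \<le> (\<Sum>i\<in>I. (pi / (2 * a i))\<^sup>2)"
proof -
  show "lambda1 \<Omega> \<le> (\<Sum>i\<in>I. (pi / (2 * a i))\<^sup>2)"
    by (rule orthonormal_box.lambda1_le_box[OF box(1) \<Omega> box(2)])
  obtain \<phi> where \<phi>: "\<phi> \<in> test_functions \<Omega>" "L2_norm \<Omega> \<phi> \<noteq> 0"
    by (rule orthonormal_box.exists_nonzero_test_function[OF box(1) \<Omega> box(2)])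
  show "(pi / (2 * r))\<^sup>2 \<le> lambda1 \<Omega>"
    unfolding lambda1_def
  proof (rule cInf_greatest)
    show "{(L2_norm \<Omega> g)\<^sup>2 / (L2_norm \<Omega> v)\<^sup>2 |v g. v \<in> H10 \<Omega> \<and> weak_gradient \<Omega> v g \<and> L2_norm \<Omega> v \<noteq> 0} \<noteq> {}"
      using test_functions_H10[OF \<phi>(1) \<Omega>] weak_gradient_grad[OF \<phi>(1) \<Omega>] \<phi>(2) by blast
    fix q assume "q \<in> {(L2_norm \<Omega> g)\<^sup>2 / (L2_norm \<Omega> v)\<^sup>2 |v g. v \<in> H10 \<Omega> \<and> weak_gradient \<Omega> v g \<and> L2_norm \<Omega> v \<noteq> 0}"
    then obtain u g where u: "u \<in> H10 \<Omega>" "weak_gradient \<Omega> u g" "L2_norm \<Omega> u \<noteq> 0"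
      and q: "q = (L2_norm \<Omega> g)\<^sup>2 / (L2_norm \<Omega> u)\<^sup>2" by blast
    have "(pi / (2 * r))\<^sup>2 * (L2_norm \<Omega> u)\<^sup>2 \<le> (L2_norm \<Omega> g)\<^sup>2"
      by (rule slab_poincare[OF \<Omega> v r slab u(1,2)])
    then show "(pi / (2 * r))\<^sup>2 \<le> q"
      unfolding q using u(3) by (subst pos_le_divide_eq) auto
  qed
qed

section \<open>The quotient J between a slab and a box\<close>

lemma cheeger_J_bounds:
  fixes \<Omega> :: "'a::euclidean_space set"
  assumes \<Omega>: "open \<Omega>" "bounded \<Omega>" and v: "norm v = 1" and r: "r > 0"
    and slab: "\<And>x. x \<in> \<Omega> \<Longrightarrow> \<bar>(x - z) \<bullet> v\<bar> < r"
    and box: "orthonormal_box I \<nu> a" "orthonormal_box.box I \<nu> y a \<subseteq> \<Omega>"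
  shows "pi\<^sup>2 / 4 / (\<Sum>i\<in>I. r / a i)\<^sup>2 \<le> cheeger_J \<Omega>" "cheeger_J \<Omega> \<le> pi\<^sup>2 / 4 * (\<Sum>i\<in>I. (r / a i)\<^sup>2)"
proof -
  note h = cheeger_bounds[OF \<Omega> v r slab box]
  note l = lambda1_bounds[OF \<Omega>(1) v r slab box]
  have h0: "cheeger \<Omega> > 0" using h(1) r by (smt (verit) divide_pos_pos)
  have S: "(\<Sum>i\<in>I. r / a i) = r * (\<Sum>i\<in>I. 1 / a i)"
    by (simp add: sum_distrib_left)
  have "pi\<^sup>2 / 4 / (\<Sum>i\<in>I. r / a i)\<^sup>2 = (pi / (2 * r))\<^sup>2 / (\<Sum>i\<in>I. 1 / a i)\<^sup>2"
    unfolding S using r by (simp add: power_mult_distrib power_divide)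
  also have "\<dots> \<le> lambda1 \<Omega> / (cheeger \<Omega>)\<^sup>2"
    using l h h0 by (intro frac_le power_mono) (auto intro: order_trans[OF zero_le_power2 l(1)])
  finally show "pi\<^sup>2 / 4 / (\<Sum>i\<in>I. r / a i)\<^sup>2 \<le> cheeger_J \<Omega>" by (simp add: cheeger_J_def)
  have "(1 / r)\<^sup>2 \<le> (cheeger \<Omega>)\<^sup>2"
    using h(1) r by (intro power_mono) auto
  then have "cheeger_J \<Omega> \<le> (\<Sum>i\<in>I. (pi / (2 * a i))\<^sup>2) / (1 / r)\<^sup>2"
    unfolding cheeger_J_def using l r by (intro frac_le sum_nonneg) auto
  also have "\<dots> = (\<Sum>i\<in>I. (pi / (2 * a i))\<^sup>2 * r\<^sup>2)"
    using r by (simp add: sum_distrib_right power_divide)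
  also have "\<dots> = (\<Sum>i\<in>I. pi\<^sup>2 / 4 * (r / a i)\<^sup>2)"
    by (simp add: power_mult_distrib power_divide)
  finally show "cheeger_J \<Omega> \<le> pi\<^sup>2 / 4 * (\<Sum>i\<in>I. (r / a i)\<^sup>2)"
    by (simp add: sum_distrib_left)
qed

section \<open>Principal directions and widths\<close>

lemma principal_tuples_snoc:
  "map \<nu> [1..<Suc (Suc k)] \<in> principal_tuples \<Omega> (Suc k) \<longleftrightarrow>
    map \<nu> [1..<Suc k] \<in> principal_tuples \<Omega> k \<and> norm (\<nu> (Suc k)) = 1 \<and> (\<forall>i\<in>{1..k}. \<nu> (Suc k) \<bullet> \<nu> i = 0) \<and>
    width \<Omega> (\<nu> (Suc k)) = next_width \<Omega> (principal_tuples \<Omega> k)"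
proof -
  have split: "map \<nu> [1..<Suc (Suc k)] = map \<nu> [1..<Suc k] @ [\<nu> (Suc k)]" by simp
  have set: "set (map \<nu> [1..<Suc k]) = \<nu> ` {1..k}"
    by (simp only: set_map set_upt atLeastLessThanSuc_atLeastAtMost)
  have "us @ [u] \<in> principal_tuples \<Omega> (Suc k) \<longleftrightarrow> us \<in> principal_tuples \<Omega> k \<and> norm u = 1 \<and>
      (\<forall>u'\<in>set us. u \<bullet> u' = 0) \<and> width \<Omega> u = next_width \<Omega> (principal_tuples \<Omega> k)" for us u
    by auto
  then show ?thesis
    unfolding split by (simp only: set ball_simps)
qed

text \<open>The recursion only appends directions, so every initial segment is admissible.\<close>

lemma principal_directions_prefix:
  fixes \<Omega> :: "'a::euclidean_space set"
  assumes "principal_directions \<Omega> \<nu>" "k \<le> DIM('a)"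
  shows "map \<nu> [1..<Suc k] \<in> principal_tuples \<Omega> k"
  using assms(2)
proof (induction k rule: inc_induct)
  case base
  show ?case using assms(1) by (simp only: principal_directions_def)
next
  case (step k)
  then show ?case using principal_tuples_snoc by blast
qed

lemma principal_directions_orthonormal:
  fixes \<Omega> :: "'a::euclidean_space set"
  assumes \<nu>: "principal_directions \<Omega> \<nu>" and ij: "i \<in> {1..DIM('a)}" "j \<in> {1..DIM('a)}"
  shows "\<nu> i \<bullet> \<nu> j = (if i = j then 1 else 0)"
proof -
  have *: "norm (\<nu> i) = 1" "\<forall>j\<in>{1..<i}. \<nu> i \<bullet> \<nu> j = 0" if i: "i \<in> {1..DIM('a)}" for i
  proof -
    obtain k where k: "i = Suc k" using i by (cases i) auto
    then have "map \<nu> [1..<Suc (Suc k)] \<in> principal_tuples \<Omega> (Suc k)"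
      using principal_directions_prefix[OF \<nu>, of i] i by (simp del: upt_Suc)
    then show "norm (\<nu> i) = 1" "\<forall>j\<in>{1..<i}. \<nu> i \<bullet> \<nu> j = 0"
      unfolding principal_tuples_snoc k by (auto simp: atLeastLessThanSuc_atLeastAtMost)
  qed
  consider "i = j" | "j < i" | "i < j" by linarith
  then show ?thesis
  proof cases
    case 1
    then show ?thesis using *(1)[OF ij(1)] by (simp add: norm_eq_1)
  next
    case 2
    then show ?thesis using *(2)[OF ij(1)] ij(2) by auto
  next
    case 3
    then show ?thesis using *(2)[OF ij(2)] ij(1) by (auto simp: inner_commute)
  qed
qed

lemma next_width_mono:
  "next_width \<Omega> (principal_tuples \<Omega> k) \<le> next_width \<Omega> (principal_tuples \<Omega> (Suc k))"
  unfolding next_width_def by (rule INF_superset_mono) fastforce+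

text \<open>Each step of the recursion adds an orthogonality constraint and shrinks the set of competitors.\<close>

lemma principal_width_mono:
  assumes "1 \<le> i" "i \<le> j" shows "principal_width \<Omega> i \<le> principal_width \<Omega> j"
proof -
  have "i - 1 \<le> j - 1" using assms by simp
  then show ?thesis
    unfolding principal_width_def
    by (rule lift_Suc_mono_le[of "\<lambda>k. next_width \<Omega> (principal_tuples \<Omega> k)", OF next_width_mono])
qed

lemma support_hyperplane_ge:
  assumes "p \<in> support_hyperplane \<Omega> \<nu>" "x \<in> \<Omega>" shows "x \<bullet> \<nu> \<le> p \<bullet> \<nu>"
proof -
  have "ereal (x \<bullet> \<nu>) \<le> support_fun \<Omega> \<nu>"
    unfolding support_fun_def using assms(2) by (rule SUP_upper)
  also have "\<dots> = ereal (p \<bullet> \<nu>)" using assms(1) by (simp add: support_hyperplane_def)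
  finally show ?thesis by simp
qed

section \<open>Boxes in rhomboid-like bodies\<close>

text \<open>What a rhomboid-like body contributes to the estimates. The number \<open>W i\<close> will be the
  \<open>i\<close>-th principal width. Two features matter: \<open>p\<^sub>1 - q\<^sub>1\<close> is parallel to the first direction, and modulo that
  direction the other differences are parallel to the corresponding principal directions.\<close>

locale rhomboid_frame =
  fixes \<Omega> :: "'a::euclidean_space set" and \<nu> :: "nat \<Rightarrow> 'a" and p q :: "nat \<Rightarrow> 'a" and W :: "nat \<Rightarrow> real"
  assumes dim: "DIM('a) \<ge> 2"
    and convex: "convex \<Omega>" and bounded: "bounded \<Omega>"
    and ortho: "\<And>i j. i \<in> {1..DIM('a)} \<Longrightarrow> j \<in> {1..DIM('a)} \<Longrightarrow> \<nu> i \<bullet> \<nu> j = (if i = j then 1 else 0)"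
    and pq: "\<And>i. i \<in> {1..DIM('a)} \<Longrightarrow> p i \<in> \<Omega>" "\<And>i. i \<in> {1..DIM('a)} \<Longrightarrow> q i \<in> \<Omega>"
    and slab: "\<And>x. x \<in> \<Omega> \<Longrightarrow> q 1 \<bullet> \<nu> 1 \<le> x \<bullet> \<nu> 1" "\<And>x. x \<in> \<Omega> \<Longrightarrow> x \<bullet> \<nu> 1 \<le> p 1 \<bullet> \<nu> 1"
    and diff1: "p 1 - q 1 = W 1 *\<^sub>R \<nu> 1"
    and diff: "\<And>i. i \<in> {2..DIM('a)} \<Longrightarrow> \<exists>t. p i - q i = W i *\<^sub>R \<nu> i + t *\<^sub>R \<nu> 1"
    and W: "W 1 > 0" "W 2 > 0" "\<And>i. i \<in> {2..DIM('a)} \<Longrightarrow> W 2 \<le> W i"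
begin

text \<open>Let \<open>m = N - 1\<close>. Given \<open>x\<close>, the point \<open>H\<close> in the average of the segments from \<open>q\<^sub>i\<close> to \<open>p\<^sub>i\<close> is
  chosen so that \<open>(1 - s) P + s H\<close> has the right coordinates orthogonal to the first direction for
  every \<open>P\<close> on the segment from \<open>q\<^sub>1\<close> to \<open>p\<^sub>1\<close>, and then \<open>P\<close> on that segment so that the first coordinate
  is right as well. The height of \<open>H\<close> in the slab is unknown; it moves the first coordinate by at most
  \<open>s W\<^sub>1\<close>, and this is why the box is thinner than the slab by \<open>s W\<^sub>1\<close> on either side.\<close>

lemma contains_box:
  assumes m_def: "m = real (DIM('a) - 1)" and s: "0 < s" "s < 1"
  obtains z where "\<And>x. \<bar>(x - z) \<bullet> \<nu> 1\<bar> \<le> (1 - 2 * s) * W 1 / 2 \<Longrightarrow>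
      (\<And>i. i \<in> {2..DIM('a)} \<Longrightarrow> \<bar>(x - z) \<bullet> \<nu> i\<bar> \<le> s * W 2 / (2 * m)) \<Longrightarrow> x \<in> \<Omega>"
proof -
  have m_pos: "m > 0" using dim by (simp add: m_def)
  let ?J = "{2..DIM('a)}"
  have cJ: "real (card ?J) = m" using dim by (simp add: m_def)
  have J: "i \<in> {1..DIM('a)}" if "i \<in> ?J" for i using that by auto
  have one: "1 \<in> {1..DIM('a)}" using dim by auto
  have pqJ: "(p i - q i) \<bullet> \<nu> j = (if i = j then W i else 0)" if ij: "i \<in> ?J" "j \<in> ?J" for i j
  proof -
    obtain t where "p i - q i = W i *\<^sub>R \<nu> i + t *\<^sub>R \<nu> 1" using diff[OF ij(1)] by blast
    then show ?thesis using ij by (simp add: inner_add_left ortho)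
  qed
  define G where "G = (\<Sum>i\<in>?J. (1 / m) *\<^sub>R ((1 / 2) *\<^sub>R p i + (1 / 2) *\<^sub>R q i))"
  define b where "b = (1 - s) *\<^sub>R q 1 + s *\<^sub>R G"
  define c where "c = q 1 \<bullet> \<nu> 1 + W 1 / 2"
  \<comment> \<open>the centre lies over \<open>b\<close>, halfway between the faces of the slab\<close>
  define z where "z = b + (c - b \<bullet> \<nu> 1) *\<^sub>R \<nu> 1"
  have z1: "z \<bullet> \<nu> 1 = c" using ortho[OF one one] by (simp add: z_def inner_add_left)
  have zJ: "z \<bullet> \<nu> j = (1 - s) * (q 1 \<bullet> \<nu> j) + s * (G \<bullet> \<nu> j)" if "j \<in> ?J" for j
    using that ortho[OF one J[OF that]] by (simp add: z_def b_def inner_add_left)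
  show ?thesis
  proof (rule that[of z])
    fix x assume x1: "\<bar>(x - z) \<bullet> \<nu> 1\<bar> \<le> (1 - 2 * s) * W 1 / 2"
      and xJ: "\<And>i. i \<in> ?J \<Longrightarrow> \<bar>(x - z) \<bullet> \<nu> i\<bar> \<le> s * W 2 / (2 * m)"
    \<comment> \<open>the position on the segment from \<open>q\<^sub>i\<close> to \<open>p\<^sub>i\<close>, measured from its midpoint; the factor \<open>m / s\<close> undoes the averaging and the weight of \<open>H\<close>\<close>
    define k where "k i = m * ((x - z) \<bullet> \<nu> i) / (s * W i)" for i
    have k: "\<bar>k i\<bar> \<le> 1 / 2" if i: "i \<in> ?J" for i
    proof -
      have Wi: "W i > 0" "W 2 \<le> W i" using W(2) W(3)[OF i] by auto
      have "\<bar>k i\<bar> = m * \<bar>(x - z) \<bullet> \<nu> i\<bar> / (s * W i)"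
        using m_pos s Wi by (simp add: k_def abs_mult)
      also have "\<dots> \<le> m * (s * W 2 / (2 * m)) / (s * W i)"
        using xJ[OF i] m_pos s Wi by (intro divide_right_mono mult_left_mono) auto
      also have "\<dots> \<le> 1 / 2"
        using m_pos s Wi by (simp add: field_simps)
      finally show ?thesis .
    qed
    define H where "H = (\<Sum>i\<in>?J. (1 / m) *\<^sub>R ((1 / 2 + k i) *\<^sub>R p i + (1 / 2 - k i) *\<^sub>R q i))"
    have H\<Omega>: "H \<in> \<Omega>"
      unfolding H_def
    proof (rule convex_sum[OF _ convex])
      show "(\<Sum>i\<in>?J. 1 / m) = 1" using cJ m_pos by simp
      show "(1 / 2 + k i) *\<^sub>R p i + (1 / 2 - k i) *\<^sub>R q i \<in> \<Omega>" if "i \<in> ?J" for i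
        using k[OF that] pq[OF J[OF that]] by (intro convexD[OF convex]) (auto simp: abs_le_iff)
    qed (use m_pos in auto)
    have HG: "H = G + (\<Sum>i\<in>?J. (k i / m) *\<^sub>R (p i - q i))"
      unfolding H_def G_def sum.distrib[symmetric]
      by (intro sum.cong refl) (simp add: algebra_simps)
    have HJ: "H \<bullet> \<nu> j = G \<bullet> \<nu> j + (x - z) \<bullet> \<nu> j / s" if j: "j \<in> ?J" for j
    proof -
      have "(\<Sum>i\<in>?J. (k i / m) *\<^sub>R (p i - q i)) \<bullet> \<nu> j = (\<Sum>i\<in>?J. if i = j then k i / m * W i else 0)"
        using j unfolding inner_sum_left by (intro sum.cong refl) (simp add: pqJ)
      also have "\<dots> = k j / m * W j" using j by simp
      also have "\<dots> = (x - z) \<bullet> \<nu> j / s"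
        using m_pos s W(2) W(3)[OF j] by (simp add: k_def)
      finally show ?thesis unfolding HG by (simp add: inner_add_left)
    qed
    define t where "t = (W 1 / 2 + (x - z) \<bullet> \<nu> 1 - s * (H \<bullet> \<nu> 1 - q 1 \<bullet> \<nu> 1)) / ((1 - s) * W 1)"
    have p1: "p 1 \<bullet> \<nu> 1 = q 1 \<bullet> \<nu> 1 + W 1"
      using diff1 ortho[OF one one] by (metis add.commute diff_add_cancel inner_add_left inner_scaleR_left mult.right_neutral)
    have Hb: "0 \<le> s * (H \<bullet> \<nu> 1 - q 1 \<bullet> \<nu> 1)" "s * (H \<bullet> \<nu> 1 - q 1 \<bullet> \<nu> 1) \<le> s * W 1"
      using slab[OF H\<Omega>] p1 s by auto
    have num: "0 \<le> W 1 / 2 + (x - z) \<bullet> \<nu> 1 - s * (H \<bullet> \<nu> 1 - q 1 \<bullet> \<nu> 1)"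
      "W 1 / 2 + (x - z) \<bullet> \<nu> 1 - s * (H \<bullet> \<nu> 1 - q 1 \<bullet> \<nu> 1) \<le> (1 - s) * W 1"
    proof -
      have e1: "(1 - 2 * s) * W 1 / 2 = W 1 / 2 - s * W 1"
        by (simp add: left_diff_distrib diff_divide_distrib)
      have e2: "(1 - s) * W 1 = W 1 - s * W 1"
        by (simp add: left_diff_distrib)
      show "0 \<le> W 1 / 2 + (x - z) \<bullet> \<nu> 1 - s * (H \<bullet> \<nu> 1 - q 1 \<bullet> \<nu> 1)"
        using x1[unfolded e1] Hb by linarith
      show "W 1 / 2 + (x - z) \<bullet> \<nu> 1 - s * (H \<bullet> \<nu> 1 - q 1 \<bullet> \<nu> 1) \<le> (1 - s) * W 1"
        unfolding e2 using x1[unfolded e1] Hb by linarith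
    qed
    have den: "(1 - s) * W 1 > 0" using s W(1) by simp
    have t: "0 \<le> t" "t \<le> 1" using num den by (auto simp: t_def)
    define P where "P = (1 - t) *\<^sub>R q 1 + t *\<^sub>R p 1"
    have P\<Omega>: "P \<in> \<Omega>" unfolding P_def using t pq[OF one] by (intro convexD[OF convex]) auto
    have P: "P = q 1 + (t * W 1) *\<^sub>R \<nu> 1"
    proof -
      have "P = q 1 + t *\<^sub>R (p 1 - q 1)" by (simp add: P_def algebra_simps)
      then show ?thesis unfolding diff1 by simp
    qed
    \<comment> \<open>only the expansion of vectors in the frame is used, so the centre and the half-sides are arbitrary\<close>
    interpret frame: orthonormal_box "{1..DIM('a)}" \<nu> 0 "\<lambda>i. 1"
      by unfold_locales (use ortho in auto)
    have "x \<bullet> \<nu> j = ((1 - s) *\<^sub>R P + s *\<^sub>R H) \<bullet> \<nu> j" if j: "j \<in> {1..DIM('a)}" for j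
    proof (cases "j = 1")
      case True
      have "(1 - s) * (t * W 1) = W 1 / 2 + (x - z) \<bullet> \<nu> 1 - s * (H \<bullet> \<nu> 1 - q 1 \<bullet> \<nu> 1)"
      proof -
        have "(1 - s) * (t * W 1) = t * ((1 - s) * W 1)" by simp
        also have "\<dots> = W 1 / 2 + (x - z) \<bullet> \<nu> 1 - s * (H \<bullet> \<nu> 1 - q 1 \<bullet> \<nu> 1)"
          using den t_def nonzero_eq_divide_eq[of "(1 - s) * W 1" t] by (metis less_irrefl)
        finally show ?thesis .
      qed
      moreover have "((1 - s) *\<^sub>R P + s *\<^sub>R H) \<bullet> \<nu> 1 = (1 - s) * (q 1 \<bullet> \<nu> 1) + (1 - s) * (t * W 1) + s * (H \<bullet> \<nu> 1)"
        using ortho[OF one one] by (simp add: P inner_add_left algebra_simps)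
      ultimately show ?thesis
        using z1 True by (simp add: c_def inner_diff_left algebra_simps)
    next
      case False
      then have jJ: "j \<in> ?J" using j by auto
      have "((1 - s) *\<^sub>R P + s *\<^sub>R H) \<bullet> \<nu> j = (1 - s) * (q 1 \<bullet> \<nu> j) + s * (G \<bullet> \<nu> j + (x - z) \<bullet> \<nu> j / s)"
        using ortho[OF one J[OF jJ]] False HJ[OF jJ] by (simp add: P inner_add_left)
      also have "\<dots> = z \<bullet> \<nu> j + (x - z) \<bullet> \<nu> j"
        unfolding zJ[OF jJ] distrib_left using s by simp
      finally show ?thesis by (simp add: inner_diff_left)
    qed
    then have "x = (1 - s) *\<^sub>R P + s *\<^sub>R H"
      using frame.frame_expand[of x] frame.frame_expand[of "(1 - s) *\<^sub>R P + s *\<^sub>R H"] by (metis (no_types, lifting) sum.cong)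
    then show "x \<in> \<Omega>"
      using convexD[OF convex P\<Omega> H\<Omega>, of "1 - s" s] s by simp
  qed
qed

text \<open>The inner box is slightly smaller than the one found in the body, to bring it into the interior.
  With \<open>s\<^sup>2 = W\<^sub>1/W\<^sub>2\<close> the quotients \<open>r/a\<^sub>i\<close> are \<open>1/(1 - 3s)\<close> and, \<open>m\<close> times, \<open>2ms\<close>.\<close>

lemma cheeger_J_rhomboid_bounds:
  assumes m_def: "m = real (DIM('a) - 1)" and s: "0 < s" "s < 1 / 3" "s\<^sup>2 = W 1 / W 2"
  shows "pi\<^sup>2 / 4 / (1 / (1 - 3 * s) + 2 * m\<^sup>2 * s)\<^sup>2 \<le> cheeger_J (interior \<Omega>)"
    "cheeger_J (interior \<Omega>) \<le> pi\<^sup>2 / 4 * ((1 / (1 - 3 * s))\<^sup>2 + m * (2 * m * s)\<^sup>2)"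
proof -
  have m_pos: "m > 0" using dim by (simp add: m_def)
  have one: "1 \<in> {1..DIM('a)}" using dim by auto
  have n1: "norm (\<nu> 1) = 1" using ortho[OF one one] by (simp add: norm_eq_1)
  define r where "r = W 1 / 2"
  define a where "a i = (if i = 1 then (1 - 3 * s) * W 1 / 2 else s * W 2 / (4 * m))" for i :: nat
  define A where "A i = (if i = 1 then (1 - 2 * s) * W 1 / 2 else s * W 2 / (2 * m))" for i :: nat
  have r: "r > 0" using W(1) by (simp add: r_def)
  have apos: "a i > 0" for i using s W m_pos by (simp add: a_def)
  have aA: "a i \<le> A i" for i using s W m_pos by (simp add: a_def A_def field_simps)
  have aA': "a i < A i" for i using s W m_pos by (simp add: a_def A_def field_simps)
  obtain z where z: "\<And>x. \<bar>(x - z) \<bullet> \<nu> 1\<bar> \<le> (1 - 2 * s) * W 1 / 2 \<Longrightarrow>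
      (\<And>i. i \<in> {2..DIM('a)} \<Longrightarrow> \<bar>(x - z) \<bullet> \<nu> i\<bar> \<le> s * W 2 / (2 * m)) \<Longrightarrow> x \<in> \<Omega>"
    using contains_box[OF m_def, of s] s by auto
  interpret outer: orthonormal_box "{1..DIM('a)}" \<nu> z A
    by unfold_locales (use ortho less_le_trans[OF apos aA] in auto)
  interpret inner: orthonormal_box "{1..DIM('a)}" \<nu> z a
    by unfold_locales (use ortho apos in auto)
  have "outer.open_box \<subseteq> \<Omega>"
  proof
    fix x assume x: "x \<in> outer.open_box"
    show "x \<in> \<Omega>"
    proof (rule z)
      show "\<bar>(x - z) \<bullet> \<nu> 1\<bar> \<le> (1 - 2 * s) * W 1 / 2"
      proof -
        have "\<bar>(x - z) \<bullet> \<nu> 1\<bar> < A 1" using x one unfolding outer.open_box_def by blast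
        then show ?thesis by (simp add: A_def)
      qed
      show "\<bar>(x - z) \<bullet> \<nu> i\<bar> \<le> s * W 2 / (2 * m)" if "i \<in> {2..DIM('a)}" for i
      proof -
        have "i \<in> {1..DIM('a)}" using that by auto
        then have "\<bar>(x - z) \<bullet> \<nu> i\<bar> < A i" using x unfolding outer.open_box_def by blast
        then show ?thesis using that by (simp add: A_def)
      qed
    qed
  qed
  then have "outer.open_box \<subseteq> interior \<Omega>"
    by (rule interior_maximal[OF _ outer.open_open_box])
  moreover have "inner.box \<subseteq> outer.open_box"
  proof
    fix x assume x: "x \<in> inner.box"
    have "\<bar>(x - z) \<bullet> \<nu> i\<bar> < A i" if "i \<in> {1..DIM('a)}" for i
    proof -
      have "- a i \<le> (x - z) \<bullet> \<nu> i" "(x - z) \<bullet> \<nu> i < a i" using x that unfolding inner.box_def by blast+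
      then show ?thesis using aA'[of i] by linarith
    qed
    then show "x \<in> outer.open_box" unfolding outer.open_box_def by blast
  qed
  ultimately have box: "inner.box \<subseteq> interior \<Omega>" by blast
  have strip: "\<bar>(x - (q 1 + r *\<^sub>R \<nu> 1)) \<bullet> \<nu> 1\<bar> < r" if x: "x \<in> interior \<Omega>" for x
  proof -
    obtain e where e: "e > 0" "cball x e \<subseteq> \<Omega>"
      using x mem_interior_cball by blast
    have "x + e *\<^sub>R \<nu> 1 \<in> \<Omega>" "x - e *\<^sub>R \<nu> 1 \<in> \<Omega>"
      using e n1 by (auto intro!: subsetD[OF e(2)] simp: dist_norm)
    from slab(2)[OF this(1)] slab(1)[OF this(2)] 
    have "x \<bullet> \<nu> 1 + e \<le> p 1 \<bullet> \<nu> 1" "q 1 \<bullet> \<nu> 1 \<le> x \<bullet> \<nu> 1 - e"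
      using ortho[OF one one] by (simp_all add: inner_add_left inner_diff_left)
    moreover have "p 1 \<bullet> \<nu> 1 = q 1 \<bullet> \<nu> 1 + 2 * r"
      using diff1 ortho[OF one one] unfolding r_def
      by (metis add.commute diff_add_cancel inner_add_left inner_scaleR_left mult.right_neutral nonzero_mult_div_cancel_left times_divide_eq_right zero_neq_numeral)
    ultimately show ?thesis
      using e(1) ortho[OF one one] by (simp add: inner_diff_left inner_add_left abs_less_iff)
  qed
  have split: "(\<Sum>i\<in>{1..DIM('a)}. f (r / a i)) = f (1 / (1 - 3 * s)) + m * f (2 * m * s)" for f :: "real \<Rightarrow> real"
  proof -
    have I: "{1..DIM('a)} = insert 1 {2..DIM('a)}" using dim by auto
    have a1: "r / a 1 = 1 / (1 - 3 * s)" using W(1) s by (simp add: r_def a_def)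
    have "r / a i = 2 * m * s" if "i \<in> {2..DIM('a)}" for i
    proof -
      have "W 1 = s * s * W 2" using s(3) W(2) by (simp add: power2_eq_square field_simps)
      then show ?thesis using that W(2) s m_pos by (simp add: r_def a_def field_simps)
    qed
    then have "(\<Sum>i\<in>{2..DIM('a)}. f (r / a i)) = (\<Sum>i\<in>{2..DIM('a)}. f (2 * m * s))"
      by (intro sum.cong) auto
    then show ?thesis unfolding I using a1 dim by (simp add: m_def)
  qed
  note bounds = cheeger_J_bounds[OF open_interior bounded_subset[OF bounded interior_subset] n1 r strip
      inner.orthonormal_box_axioms box]
  show "pi\<^sup>2 / 4 / (1 / (1 - 3 * s) + 2 * m\<^sup>2 * s)\<^sup>2 \<le> cheeger_J (interior \<Omega>)"
    using bounds(1) split[of "\<lambda>t. t"] by (simp add: power2_eq_square mult_ac)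
  show "cheeger_J (interior \<Omega>) \<le> pi\<^sup>2 / 4 * ((1 / (1 - 3 * s))\<^sup>2 + m * (2 * m * s)\<^sup>2)"
    using bounds(2) split[of "\<lambda>t. t\<^sup>2"] by simp
qed

end

text \<open>The points \<open>p\<^sub>i\<close> and \<open>q\<^sub>i\<close> lie on opposite supporting hyperplanes, so their difference realises
  the width, and the width is positive because the interior is nonempty.\<close>

lemma rhomboid_like_imp_frame:
  fixes \<Omega> :: "'a::euclidean_space set"
  assumes dim: "DIM('a) \<ge> 2" and body: "convex_body \<Omega>" and rh: "rhomboid_like \<Omega>"
  obtains \<nu> p q W where "rhomboid_frame \<Omega> \<nu> p q W" "rel_width \<Omega> = ereal (W 1 / W 2)"
proof -
  obtain \<nu> p q where \<nu>: "principal_directions \<Omega> \<nu>"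
    and pq: "\<And>i. i \<in> {1..DIM('a)} \<Longrightarrow> p i \<in> \<Omega> \<inter> support_hyperplane \<Omega> (\<nu> i)"
      "\<And>i. i \<in> {1..DIM('a)} \<Longrightarrow> q i \<in> \<Omega> \<inter> support_hyperplane \<Omega> (- \<nu> i)"
      "\<And>i. i \<in> {1..DIM('a)} \<Longrightarrow> p i - q i \<in> span (\<nu> ` {1..i})"
      "\<And>i. i \<in> {1..DIM('a)} \<Longrightarrow> ereal ((p i - q i) \<bullet> \<nu> i) = principal_width \<Omega> i"
    and span: "\<And>i. i \<in> {2..DIM('a)} \<Longrightarrow> p i \<in> span {\<nu> 1, \<nu> i}" "\<And>i. i \<in> {2..DIM('a)} \<Longrightarrow> q i \<in> span {\<nu> 1, \<nu> i}"
    using rh unfolding rhomboid_like_def by blast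
  define W where "W i = (p i - q i) \<bullet> \<nu> i" for i
  have ortho: "\<nu> i \<bullet> \<nu> j = (if i = j then 1 else 0)" if "i \<in> {1..DIM('a)}" "j \<in> {1..DIM('a)}" for i j
    using principal_directions_orthonormal[OF \<nu> that] .
  have one: "1 \<in> {1..DIM('a)}" and two: "2 \<in> {1..DIM('a)}" using dim by auto
  have slab: "q i \<bullet> \<nu> i \<le> x \<bullet> \<nu> i" "x \<bullet> \<nu> i \<le> p i \<bullet> \<nu> i" if "i \<in> {1..DIM('a)}" "x \<in> \<Omega>" for i x
    using support_hyperplane_ge[of "p i" \<Omega> "\<nu> i" x] support_hyperplane_ge[of "q i" \<Omega> "- \<nu> i" x] pq(1,2)[OF that(1)] that(2)
    by auto
  have Wpos: "W i > 0" if i: "i \<in> {1..DIM('a)}" for i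
  proof -
    obtain c where "c \<in> interior \<Omega>" using body by (auto simp: convex_body_def)
    then obtain e where e: "e > 0" "cball c e \<subseteq> \<Omega>" using mem_interior_cball by blast
    have n: "norm (\<nu> i) = 1" using ortho[OF i i] by (simp add: norm_eq_1)
    have "c + e *\<^sub>R \<nu> i \<in> \<Omega>" "c \<in> \<Omega>"
      using e n by (auto intro!: subsetD[OF e(2)] simp: dist_norm)
    from slab(2)[OF i this(1)] slab(1)[OF i this(2)] show ?thesis
      using e(1) ortho[OF i i] by (simp add: W_def inner_add_left inner_diff_left)
  qed
  have "rhomboid_frame \<Omega> \<nu> p q W"
  proof
    show "p 1 - q 1 = W 1 *\<^sub>R \<nu> 1"
    proof -
      obtain t where t: "p 1 - q 1 = t *\<^sub>R \<nu> 1"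
        using pq(3)[OF one] by (auto simp: span_singleton)
      then have "W 1 = t" using ortho[OF one one] by (simp add: W_def)
      then show ?thesis using t by simp
    qed
    show "\<exists>t. p i - q i = W i *\<^sub>R \<nu> i + t *\<^sub>R \<nu> 1" if i: "i \<in> {2..DIM('a)}" for i
    proof -
      have i1: "i \<in> {1..DIM('a)}" "i \<noteq> 1" using i by auto
      have "p i - q i \<in> span {\<nu> 1, \<nu> i}" using span[OF i] by (rule span_diff)
      then obtain t u where tu: "p i - q i = t *\<^sub>R \<nu> 1 + u *\<^sub>R \<nu> i"
        unfolding span_insert[of "\<nu> 1" "{\<nu> i}"] span_singleton
        by (auto simp: algebra_simps)
      then have "W i = u" using ortho[OF one i1(1)] ortho[OF i1(1) i1(1)] i1(2) by (simp add: W_def inner_add_left)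
      then show ?thesis using tu by (intro exI[of _ t]) (simp add: add.commute)
    qed
    show "W 2 \<le> W i" if i: "i \<in> {2..DIM('a)}" for i
    proof -
      have "ereal (W 2) \<le> ereal (W i)"
        using principal_width_mono[of 2 i \<Omega>] pq(4)[OF two] pq(4)[of i] i by (simp add: W_def)
      then show ?thesis by simp
    qed
  qed (use dim body pq ortho slab[OF one] Wpos[OF one] Wpos[OF two] in \<open>auto simp: convex_body_def\<close>)
  moreover have "rel_width \<Omega> = ereal (W 1 / W 2)"
  proof -
    have "principal_width \<Omega> 1 = ereal (W 1)" "principal_width \<Omega> 2 = ereal (W 2)"
      using pq(4)[OF one] pq(4)[OF two] unfolding W_def by (simp_all only:)
    then show ?thesis unfolding rel_width_def using Wpos[OF two] by simp
  qed
  ultimately show ?thesis using that by blast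
qed

section \<open>Convergence\<close>

theorem theorem5p6:
  fixes \<Omega> :: "nat \<Rightarrow> 'a::euclidean_space set"
  assumes "DIM('a) \<ge> 2"
    and "\<And>n. convex_body (\<Omega> n)"
    and "\<And>n. rhomboid_like (\<Omega> n)"
    and "(\<lambda>n. rel_width (\<Omega> n)) \<longlonglongrightarrow> 0"
  shows "(\<lambda>n. cheeger_J (interior (\<Omega> n))) \<longlonglongrightarrow> pi\<^sup>2 / 4"
proof -
  define m where "m = real (DIM('a) - 1)"
  define s where "s n = sqrt (real_of_ereal (rel_width (\<Omega> n)))" for n
  have bounds: "0 < s n" "s n < 1 / 3 \<Longrightarrow>
      pi\<^sup>2 / 4 / (1 / (1 - 3 * s n) + 2 * m\<^sup>2 * s n)\<^sup>2 \<le> cheeger_J (interior (\<Omega> n)) \<and>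
      cheeger_J (interior (\<Omega> n)) \<le> pi\<^sup>2 / 4 * ((1 / (1 - 3 * s n))\<^sup>2 + m * (2 * m * s n)\<^sup>2)" for n
  proof -
    obtain \<nu> p q W where th: "rhomboid_frame (\<Omega> n) \<nu> p q W" and rel: "rel_width (\<Omega> n) = ereal (W 1 / W 2)"
      using rhomboid_like_imp_frame[OF assms(1) assms(2)[of n] assms(3)[of n]] by blast
    interpret rhomboid_frame "\<Omega> n" \<nu> p q W by (rule th)
    have pos: "W 1 / W 2 > 0" using W by simp
    then have sq: "(s n)\<^sup>2 = W 1 / W 2" by (simp add: s_def rel)
    show s0: "0 < s n" using pos by (simp add: s_def rel)
    show "pi\<^sup>2 / 4 / (1 / (1 - 3 * s n) + 2 * m\<^sup>2 * s n)\<^sup>2 \<le> cheeger_J (interior (\<Omega> n)) \<and>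
      cheeger_J (interior (\<Omega> n)) \<le> pi\<^sup>2 / 4 * ((1 / (1 - 3 * s n))\<^sup>2 + m * (2 * m * s n)\<^sup>2)"
      if "s n < 1 / 3"
      using cheeger_J_rhomboid_bounds[OF m_def s0 that sq] by blast
  qed
  have "(\<lambda>n. real_of_ereal (rel_width (\<Omega> n))) \<longlonglongrightarrow> 0"
    using lim_real_of_ereal[of "\<lambda>n. rel_width (\<Omega> n)" 0 sequentially] assms(4) by (simp add: zero_ereal_def)
  then have s0: "s \<longlonglongrightarrow> 0"
    unfolding s_def[abs_def] using tendsto_real_sqrt by fastforce
  then have small: "\<forall>\<^sub>F n in sequentially. s n < 1 / 3"
    by (rule order_tendstoD(2)) simp
  show ?thesis
  proof (rule tendsto_sandwich)
    show "\<forall>\<^sub>F n in sequentially. pi\<^sup>2 / 4 / (1 / (1 - 3 * s n) + 2 * m\<^sup>2 * s n)\<^sup>2 \<le> cheeger_J (interior (\<Omega> n))"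
      using small by (rule eventually_mono) (use bounds(2) in blast)
    show "\<forall>\<^sub>F n in sequentially. cheeger_J (interior (\<Omega> n)) \<le> pi\<^sup>2 / 4 * ((1 / (1 - 3 * s n))\<^sup>2 + m * (2 * m * s n)\<^sup>2)"
      using small by (rule eventually_mono) (use bounds(2) in blast)
    have "(\<lambda>n. pi\<^sup>2 / 4 / (1 / (1 - 3 * s n) + 2 * m\<^sup>2 * s n)\<^sup>2) \<longlonglongrightarrow> pi\<^sup>2 / 4 / (1 / (1 - 3 * 0) + 2 * m\<^sup>2 * 0)\<^sup>2"
      by (intro tendsto_intros s0) auto
    then show "(\<lambda>n. pi\<^sup>2 / 4 / (1 / (1 - 3 * s n) + 2 * m\<^sup>2 * s n)\<^sup>2) \<longlonglongrightarrow> pi\<^sup>2 / 4" by simp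
    have "(\<lambda>n. pi\<^sup>2 / 4 * ((1 / (1 - 3 * s n))\<^sup>2 + m * (2 * m * s n)\<^sup>2)) \<longlonglongrightarrow> pi\<^sup>2 / 4 * ((1 / (1 - 3 * 0))\<^sup>2 + m * (2 * m * 0)\<^sup>2)"
      by (intro tendsto_intros s0) auto
    then show "(\<lambda>n. pi\<^sup>2 / 4 * ((1 / (1 - 3 * s n))\<^sup>2 + m * (2 * m * s n)\<^sup>2)) \<longlonglongrightarrow> pi\<^sup>2 / 4" by simp
  qed
qed

end
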